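(* Let $n\ge 2$, let $I_n\subset \mathbb{C}[x_{ij} : 1\le i<j\le n]$ be the toric ideal of the second hypersimplex, and let $\prec$ be any circular term order. Then the set consisting of all $3\times 3$ off-diagonal minors, all degree $3$ master polynomials, and all products of pairs of $2\times 2$ off-diagonal minors is a Gröbner basis of the symbolic square $I_n^{(2)}$ with respect to $\prec$. Furthermore, $$I_n^{(2)}=I_n^2+I_n^{\{2\}}.$$
   Context: Notation: $[n]=\{1,\dots,n\}$; $\mathbb{C}[x]=\mathbb{C}[x_{ij}:1\le i<j\le n]$, with $x_{ji}:=x_{ij}$. The ideal $I_n$ is the kernel of $\phi_n:\mathbb{C}[x]\to\mathbb{C}[t_1,\dots,t_n]$, $x_{ij}\mapsto t_it_j$; it is prime. $I_n^{(2)}$ denotes its second symbolic power (the $I_n$-primary component of $I_n^2$). Secant ideal: for an ideal $I$ in a polynomial ring $K[x_1,\dots,x_m]$, $I^{\{2\}}=\big(I(y)+I(z)+\langle y_s+z_s-x_s: 1\le s\le m\rangle\big)\cap K[x_1,\dots,x_m]$, where $I(y)\subset K[y_1,\dots,y_m]$ and $I(z)\subset K[z_1,\dots,z_m]$ are copies of $I$ in new variables. For $I$ radical and homogeneous over an algebraically closed field this is the vanishing ideal of the secant variety of $V(I)$. Circular term order: place $1,\dots,n$ in this cyclic order at the vertices of a regular $n$-gon. The class of an edge $ab$ is determined by its circular distance $\min(|a-b|,\,n-|a-b|)\in\{1,\dots,\lfloor n/2\rfloor\}$. A circular term order is any block term order whose blocks are the sets of variables in each class, with variables of smaller circular distance in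 larger blocks: monomials are compared first on the block of distance $1$ (by some term order on that block), ties are broken on the block of distance $2$, and so on. For $r\in\{2,3\}$, an $r\times r$ off-diagonal minor is $\det(x_{ab})_{a\in R,\,b\in C}$ for disjoint $r$-element subsets $R,C\subset[n]$. Products of pairs of $2\times2$ minors include squares. Degree $3$ master polynomials: let $i_1,j_1,i_2,j_2,i_3,j_3\in[n]$ be six distinct elements appearing in this circular order (one revolution), i.e. there are integers $a_1<b_1<a_2<b_2<a_3<b_3<a_1+n$ with $i_l\equiv a_l$, $j_l\equiv b_l\pmod n$. Let $Z\cong\mathbb{Z}_2^3$ be the subgroup of the symmetric group on these six elements generated by the transpositions $(i_l\ j_{l-1})$, $l=1,2,3$ (subscripts mod $3$). For $\sigma\in Z$ let $\mathbf{x}^\sigma$ be the product of $x_{ab}$ over the $2$-cycles $(a\,b)$ of $\sigma\,(i_1\,j_1)(i_2\,j_2)(i_3\,j_3)\,\sigma^{-1}$. The master polynomial is $\sum_{\sigma\in Z}(-1)^\sigma\mathbf{x}^\sigma$, where $(-1)^\sigma$ is the sign of $\sigma$. *)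

theory Defs
  imports
    "HOL-Library.Poly_Mapping"
    "HOL-Number_Theory.Cong"
    "HOL-Algebra.Ideal_Product"
    "HOL-Algebra.Sym_Groups"
    "Jordan_Normal_Form.Determinant"
begin

section \<open>Polynomial rings over the complex numbers\<close>

text \<open>
  Monomials are exponent vectors of finite support, written additively. The type of polynomials
  admits all elements of the variable type as variables; \<open>poly_ring V\<close> is the polynomial ring
  whose set of variables is \<open>V\<close>.
\<close>

type_synonym 'v monomial = "'v \<Rightarrow>\<^sub>0 nat"
type_synonym 'v mpoly = "'v monomial \<Rightarrow>\<^sub>0 complex"

definition monomials :: "'v set \<Rightarrow> 'v monomial set" where
  "monomials V = {m. Poly_Mapping.keys m \<subseteq> V}"

definition poly_ring :: "'v set \<Rightarrow> 'v mpoly ring" where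
  "poly_ring V = \<lparr>carrier = {p. Poly_Mapping.keys p \<subseteq> monomials V},
     mult = (*), one = 1, zero = 0, add = (+)\<rparr>"

definition var :: "'v \<Rightarrow> 'v mpoly" where
  "var v = Poly_Mapping.single (Poly_Mapping.single v 1) 1"

definition subst :: "('v \<Rightarrow> 'w mpoly) \<Rightarrow> 'v mpoly \<Rightarrow> 'w mpoly" where
  "subst g p = (\<Sum>m\<in>Poly_Mapping.keys p. Poly_Mapping.single 0 (Poly_Mapping.lookup p m) *
     (\<Prod>v\<in>Poly_Mapping.keys m. g v ^ Poly_Mapping.lookup m v))"


section \<open>Symbolic squares\<close>

definition radical_of :: "('a, 'b) ring_scheme \<Rightarrow> 'a set \<Rightarrow> 'a set" where
  "radical_of R J = {a \<in> carrier R. \<exists>k::nat. a [^]\<^bsub>R\<^esub> k \<in> J}"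

definition primary_ideal :: "('a, 'b) ring_scheme \<Rightarrow> 'a set \<Rightarrow> bool" where
  "primary_ideal R Q \<longleftrightarrow> ideal Q R \<and> Q \<noteq> carrier R \<and>
     (\<forall>a\<in>carrier R. \<forall>b\<in>carrier R. a \<otimes>\<^bsub>R\<^esub> b \<in> Q \<longrightarrow> a \<in> Q \<or> b \<in> radical_of R Q)"

definition minimal_primary_decomposition ::
    "('a, 'b) ring_scheme \<Rightarrow> 'a set set \<Rightarrow> 'a set \<Rightarrow> bool" where
  "minimal_primary_decomposition R D J \<longleftrightarrow>
     finite D \<and> (\<forall>Q\<in>D. primary_ideal R Q) \<and> carrier R \<inter> \<Inter>D = J \<and>
     inj_on (radical_of R) D \<and> (\<forall>Q\<in>D. \<not> carrier R \<inter> \<Inter>(D - {Q}) \<subseteq> Q)"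

text \<open>
  For a prime ideal \<open>P\<close> of a Noetherian ring, \<open>P\<close> is the only minimal prime over its square, so the
  \<open>P\<close>-primary component below exists and does not depend on the decomposition.
\<close>

definition symbolic_square :: "('a, 'b) ring_scheme \<Rightarrow> 'a set \<Rightarrow> 'a set" where
  "symbolic_square R P =
     (THE Q. \<exists>D. minimal_primary_decomposition R D (ideal_prod R P P) \<and>
        Q \<in> D \<and> radical_of R Q = P)"


section \<open>Secant ideals\<close>

datatype 'v copies = CX 'v | CY 'v | CZ 'v

text \<open>The original variables are identified with their \<open>CX\<close> copies in the larger ring.\<close>

definition secant_ideal :: "'v set \<Rightarrow> 'v mpoly set \<Rightarrow> 'v mpoly set" where
  "secant_ideal V I = {f \<in> carrier (poly_ring V).
     subst (\<lambda>v. var (CX v)) f \<in>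
       genideal (poly_ring (CX ` V \<union> CY ` V \<union> CZ ` V))
        (subst (\<lambda>v. var (CY v)) ` I \<union> subst (\<lambda>v. var (CZ v)) ` I \<union>
         {var (CY v) + var (CZ v) - var (CX v) | v. v \<in> V})}"


section \<open>Term orders and Groebner bases\<close>

text \<open>A pair \<open>(a, b)\<close> in the relation means that \<open>a\<close> is less than or equal to \<open>b\<close>.\<close>

definition term_order :: "'v set \<Rightarrow> 'v monomial rel \<Rightarrow> bool" where
  "term_order V r \<longleftrightarrow> linear_order_on (monomials V) r \<and>
     (\<forall>a\<in>monomials V. (0, a) \<in> r) \<and>
     (\<forall>a b. \<forall>c\<in>monomials V. (a, b) \<in> r \<longrightarrow> (a + c, b + c) \<in> r)"

definition leading_monomial :: "'v monomial rel \<Rightarrow> 'v mpoly \<Rightarrow> 'v monomial" where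
  "leading_monomial r p =
     (THE m. m \<in> Poly_Mapping.keys p \<and> (\<forall>m'\<in>Poly_Mapping.keys p. (m', m) \<in> r))"

definition initial_ideal :: "'v set \<Rightarrow> 'v monomial rel \<Rightarrow> 'v mpoly set \<Rightarrow> 'v mpoly set" where
  "initial_ideal V r F =
     genideal (poly_ring V) {Poly_Mapping.single (leading_monomial r f) 1 | f. f \<in> F \<and> f \<noteq> 0}"

definition groebner_basis ::
    "'v set \<Rightarrow> 'v monomial rel \<Rightarrow> 'v mpoly set \<Rightarrow> 'v mpoly set \<Rightarrow> bool" where
  "groebner_basis V r I G \<longleftrightarrow> finite G \<and> G \<subseteq> I \<and> initial_ideal V r G = initial_ideal V r I"


section \<open>The toric ideal of the second hypersimplex\<close>

definition edges :: "nat \<Rightarrow> (nat \<times> nat) set" where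
  "edges n = {(i, j). 1 \<le> i \<and> i < j \<and> j \<le> n}"

definition xvar :: "nat \<Rightarrow> nat \<Rightarrow> (nat \<times> nat) mpoly" where
  "xvar i j = var (min i j, max i j)"

definition hypersimplex_ideal :: "nat \<Rightarrow> (nat \<times> nat) mpoly set" where
  "hypersimplex_ideal n =
     a_kernel (poly_ring (edges n)) (poly_ring {1..n}) (subst (\<lambda>(i, j). var i * var j))"


section \<open>Circular term orders\<close>

definition circular_distance :: "nat \<Rightarrow> nat \<times> nat \<Rightarrow> nat" where
  "circular_distance n = (\<lambda>(a, b). nat (min \<bar>int a - int b\<bar> (int n - \<bar>int a - int b\<bar>)))"

definition edge_class :: "nat \<Rightarrow> nat \<Rightarrow> (nat \<times> nat) set" where
  "edge_class n d = {e \<in> edges n. circular_distance n e = d}"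

definition restrict_monomial :: "'v set \<Rightarrow> 'v monomial \<Rightarrow> 'v monomial" where
  "restrict_monomial B = Poly_Mapping.mapp (\<lambda>v k. k when v \<in> B)"

definition circular_term_order :: "nat \<Rightarrow> (nat \<times> nat) monomial rel \<Rightarrow> bool" where
  "circular_term_order n r \<longleftrightarrow>
     (\<exists>s. (\<forall>d\<in>{1..n div 2}. term_order (edge_class n d) (s d)) \<and>
       r = {(a, b). a \<in> monomials (edges n) \<and> b \<in> monomials (edges n) \<and>
         (a = b \<or>
          (\<exists>d\<in>{1..n div 2}.
             (\<forall>e\<in>{1..<d}.
                restrict_monomial (edge_class n e) a = restrict_monomial (edge_class n e) b) \<and>
             restrict_monomial (edge_class n d) a \<noteq> restrict_monomial (edge_class n d) b \<and>
             (restrict_monomial (edge_class n d) a, restrict_monomial (edge_class n d) b)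
               \<in> s d))})"


section \<open>Off-diagonal minors and master polynomials\<close>

text \<open>Rows and columns of a minor are listed in increasing order; this fixes its sign.\<close>

definition minor :: "nat \<Rightarrow> nat set \<Rightarrow> nat set \<Rightarrow> (nat \<times> nat) mpoly" where
  "minor r A B =
     det (mat r r (\<lambda>(i, j). xvar (sorted_list_of_set A ! i) (sorted_list_of_set B ! j)))"

definition off_diagonal_minors :: "nat \<Rightarrow> nat \<Rightarrow> (nat \<times> nat) mpoly set" where
  "off_diagonal_minors n r = {minor r A B | A B.
     A \<subseteq> {1..n} \<and> B \<subseteq> {1..n} \<and> card A = r \<and> card B = r \<and> A \<inter> B = {}}"

definition circularly_ordered ::
    "nat \<Rightarrow> nat \<Rightarrow> nat \<Rightarrow> nat \<Rightarrow> nat \<Rightarrow> nat \<Rightarrow> nat \<Rightarrow> bool" where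
  "circularly_ordered n i\<^sub>1 j\<^sub>1 i\<^sub>2 j\<^sub>2 i\<^sub>3 j\<^sub>3 \<longleftrightarrow>
     {i\<^sub>1, j\<^sub>1, i\<^sub>2, j\<^sub>2, i\<^sub>3, j\<^sub>3} \<subseteq> {1..n} \<and> distinct [i\<^sub>1, j\<^sub>1, i\<^sub>2, j\<^sub>2, i\<^sub>3, j\<^sub>3] \<and>
     (\<exists>a\<^sub>1 b\<^sub>1 a\<^sub>2 b\<^sub>2 a\<^sub>3 b\<^sub>3 :: int.
        a\<^sub>1 < b\<^sub>1 \<and> b\<^sub>1 < a\<^sub>2 \<and> a\<^sub>2 < b\<^sub>2 \<and> b\<^sub>2 < a\<^sub>3 \<and> a\<^sub>3 < b\<^sub>3 \<and> b\<^sub>3 < a\<^sub>1 + int n \<and>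
        [int i\<^sub>1 = a\<^sub>1] (mod int n) \<and> [int j\<^sub>1 = b\<^sub>1] (mod int n) \<and>
        [int i\<^sub>2 = a\<^sub>2] (mod int n) \<and> [int j\<^sub>2 = b\<^sub>2] (mod int n) \<and>
        [int i\<^sub>3 = a\<^sub>3] (mod int n) \<and> [int j\<^sub>3 = b\<^sub>3] (mod int n))"

text \<open>
  The symmetric group on the six indices is regarded as a subgroup of the one on \<open>{1..n}\<close>.
  The polynomial \<open>two_cycle_monomial n \<rho>\<close> is the product of the variables indexed by the
  2-cycles of \<open>\<rho>\<close>, each taken once.
\<close>

definition two_cycle_monomial :: "nat \<Rightarrow> (nat \<Rightarrow> nat) \<Rightarrow> (nat \<times> nat) mpoly" where
  "two_cycle_monomial n \<rho> = (\<Prod>(a, b)\<in>{(a, b) \<in> edges n. \<rho> a = b \<and> \<rho> b = a}. xvar a b)"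

definition master_polynomial ::
    "nat \<Rightarrow> nat \<Rightarrow> nat \<Rightarrow> nat \<Rightarrow> nat \<Rightarrow> nat \<Rightarrow> nat \<Rightarrow> (nat \<times> nat) mpoly" where
  "master_polynomial n i\<^sub>1 j\<^sub>1 i\<^sub>2 j\<^sub>2 i\<^sub>3 j\<^sub>3 =
     (\<Sum>\<sigma>\<in>generate (sym_group n) {transpose i\<^sub>1 j\<^sub>3, transpose i\<^sub>2 j\<^sub>1, transpose i\<^sub>3 j\<^sub>2}.
        of_int (sign \<sigma>) *
        two_cycle_monomial n
          (\<sigma> \<circ> (transpose i\<^sub>1 j\<^sub>1 \<circ> transpose i\<^sub>2 j\<^sub>2 \<circ> transpose i\<^sub>3 j\<^sub>3) \<circ> inv' \<sigma>))"

definition master_polynomials :: "nat \<Rightarrow> (nat \<times> nat) mpoly set" where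
  "master_polynomials n = {master_polynomial n i\<^sub>1 j\<^sub>1 i\<^sub>2 j\<^sub>2 i\<^sub>3 j\<^sub>3 | i\<^sub>1 j\<^sub>1 i\<^sub>2 j\<^sub>2 i\<^sub>3 j\<^sub>3.
     circularly_ordered n i\<^sub>1 j\<^sub>1 i\<^sub>2 j\<^sub>2 i\<^sub>3 j\<^sub>3}"

end

theory Submission
  imports Defs "HOL-Algebra.RingHom"
begin

text \<open>
  Let \<open>I\<close> be the toric ideal and let \<open>D\<close> be the ideal of all polynomials that lie in \<open>I\<close> together
  with their first partial derivatives (\<open>tangential_ideal\<close>). If \<open>f\<close> lies in the symbolic square, then
  \<open>s \<cdot> f \<in> I\<^sup>2\<close> for some \<open>s \<notin> I\<close> (\<open>symbolic_square_eq\<close>), and the product rule yields \<open>f \<in> D\<close>. In the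
  converse direction no general theorem is invoked: it is a by-product of the Groebner basis. The
  listed polynomials lie in the symbolic square, hence in \<open>D\<close>, and their leading monomials divide
  the leading monomials of all nonzero elements of \<open>D\<close>. So they form a Groebner basis of \<open>D\<close>, they
  generate \<open>D\<close>, and \<open>D\<close> equals the symbolic square.

  The divisibility is proved as follows. Call two edges separated if, as chords of the circle, they
  are disjoint. A monomial without separated edges (a thrackle) is the least one with its vertex
  degrees, in every circular term order: among all monomials with these degrees it has the fewest
  edges inside each arc, and comparing arcs of growing length compares the monomials class by
  class (\<open>thrackle_least_in_fibre\<close>). Hence the leading monomial of a nonzero element of \<open>I\<close> has a
  pair of separated edges. Differentiating with respect to a variable of the leading monomial
  removes this variable from it. So the leading monomial of an element of \<open>D\<close> still has a separated
  pair after any of its edges is deleted, and then it is divisible by the product of two separated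
  pairs or by a triangle, that is, three pairwise separated edges (\<open>edge_ideal_symbolic_square\<close>).

  A separated pair leads a \<open>2 \<times> 2\<close> minor, and two of them lead a product of minors. A triangle is a
  planar perfect matching of a hexagon. If one of its edges lies between the other two, some
  \<open>3 \<times> 3\<close> minor has it as its only planar term, and otherwise a master polynomial does. Since these
  cubic forms lie in \<open>D\<close>, their leading terms must be planar, so the triangle leads whatever the
  order is (\<open>leading_monomial_cubic\<close>, \<open>triangle_is_leading\<close>).

  For the equation with the secant ideal, the products of minors lie in \<open>I\<^sup>2\<close>, and a cubic form
  \<open>f \<in> D\<close> lies in the secant ideal because each term of its expansion at \<open>y + z\<close> contains a value of
  \<open>f\<close> or of a derivative of \<open>f\<close> at \<open>y\<close> or at \<open>z\<close> (\<open>cubic_form_in_secant_ideal\<close>). Conversely, elements of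
  the secant ideal vanish on the lines that join a general point of the variety to the coordinate
  vectors, which are points of the variety too; this makes all partial derivatives vanish
  (\<open>secant_ideal_subset_tangential_ideal\<close>).
\<close>

section \<open>Primary decomposition under the ascending chain condition\<close>

text \<open>
  The relation leads from an ideal to the strictly larger ones, so its well-foundedness is the
  ascending chain condition, in the form needed for Noetherian induction.
\<close>

definition ideal_ascending :: "('a, 'b) ring_scheme \<Rightarrow> 'a set rel" where
  "ideal_ascending R = {(K, J). ideal J R \<and> ideal K R \<and> J \<subset> K}"

definition irreducible_ideal :: "('a, 'b) ring_scheme \<Rightarrow> 'a set \<Rightarrow> bool" where
  "irreducible_ideal R Q \<longleftrightarrow> ideal Q R \<and> Q \<noteq> carrier R \<and>
     (\<forall>K L. ideal K R \<longrightarrow> ideal L R \<longrightarrow> Q = K \<inter> L \<longrightarrow> Q = K \<or> Q = L)"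

context cring
begin

text \<open>
  Noetherian induction: an ideal that is neither irreducible nor the whole ring is an intersection
  of two larger ideals, which can be decomposed already.
\<close>

lemma irreducible_decomposition:
  assumes wf: "wf (ideal_ascending R)" and "ideal J R"
  shows "\<exists>D. finite D \<and> (\<forall>Q\<in>D. irreducible_ideal R Q) \<and> carrier R \<inter> \<Inter>D = J"
  using \<open>ideal J R\<close>
proof (induction J rule: wf_induct_rule[OF wf])
  case (1 J)
  show ?case
  proof (cases "J = carrier R \<or> irreducible_ideal R J")
    case True
    then show ?thesis
    proof
      assume "J = carrier R"
      then show ?thesis by (intro exI[of _ "{}"]) auto
    next
      assume "irreducible_ideal R J"
      then show ?thesis
        using ideal.Icarr[OF 1(2)] by (intro exI[of _ "{J}"]) auto
    qed
  next
    case False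
    then obtain K L where KL: "ideal K R" "ideal L R" "J = K \<inter> L" "J \<noteq> K" "J \<noteq> L"
      using 1(2) unfolding irreducible_ideal_def by blast
    have "(K, J) \<in> ideal_ascending R" "(L, J) \<in> ideal_ascending R"
      using KL 1(2) unfolding ideal_ascending_def by auto
    then obtain D E where "finite D" "\<forall>Q\<in>D. irreducible_ideal R Q" "carrier R \<inter> \<Inter>D = K"
      "finite E" "\<forall>Q\<in>E. irreducible_ideal R Q" "carrier R \<inter> \<Inter>E = L"
      using 1(1) KL by metis
    then show ?thesis
      using KL by (intro exI[of _ "D \<union> E"]) auto
  qed
qed

lemma nat_pow_ideal_closed:
  assumes "ideal Q R" "b \<in> carrier R" "c \<in> carrier R" "c \<otimes> b [^] (k::nat) \<in> Q" "k \<le> l"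
  shows "c \<otimes> b [^] l \<in> Q"
proof -
  have "c \<otimes> b [^] l = (c \<otimes> b [^] k) \<otimes> b [^] (l - k)"
    using assms by (simp add: m_assoc nat_pow_mult)
  then show ?thesis
    using assms ideal.I_r_closed[OF assms(1,4), of "b [^] (l - k)"] by simp
qed

lemma ideal_sum_principal_iff:
  "x \<in> Q <+>\<^bsub>R\<^esub> PIdl a \<longleftrightarrow> (\<exists>q\<in>Q. \<exists>s\<in>carrier R. x = q \<oplus> s \<otimes> a)"
  unfolding set_add_def' cgenideal_def by auto

text \<open>
  Noether's argument: if \<open>a \<cdot> b \<in> Q\<close>, then the ascending chain of the quotients \<open>(Q : b\<^sup>k)\<close> becomes
  stationary at some \<open>k\<close>, and there \<open>Q = (Q + (a)) \<inter> (Q + (b\<^sup>k))\<close>.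
\<close>

lemma irreducible_imp_primary:
  assumes wf: "wf (ideal_ascending R)" and irr: "irreducible_ideal R Q"
  shows "primary_ideal R Q"
proof -
  interpret Q: ideal Q R using irr unfolding irreducible_ideal_def by blast
  have "a \<in> Q \<or> b \<in> radical_of R Q"
    if ab: "a \<in> carrier R" "b \<in> carrier R" "a \<otimes> b \<in> Q" for a b
  proof -
    define C where "C = (\<lambda>k::nat. {c \<in> carrier R. c \<otimes> b [^] k \<in> Q})"
    have C_ideal: "ideal (C k) R" for k
    proof (rule idealI[OF ring_axioms])
      show "subgroup (C k) (add_monoid R)"
      proof (rule add.subgroupI)
        show "C k \<subseteq> carrier R" unfolding C_def by auto
        have "\<zero> \<in> C k" using ab by (simp add: C_def)
        then show "C k \<noteq> {}" by blast
        show "\<ominus> c \<in> C k" if "c \<in> C k" for c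
          using that ab by (auto simp: C_def l_minus Q.a_inv_closed)
        show "c \<oplus> d \<in> C k" if "c \<in> C k" "d \<in> C k" for c d
          using that ab by (auto simp: C_def l_distr Q.a_closed)
      qed
      show "x \<otimes> c \<in> C k" if "c \<in> C k" "x \<in> carrier R" for c x
        using that ab by (auto simp: C_def m_assoc Q.I_l_closed)
      show "c \<otimes> x \<in> C k" if "c \<in> C k" "x \<in> carrier R" for c x
      proof -
        have "c \<otimes> x \<otimes> b [^] k = x \<otimes> (c \<otimes> b [^] k)"
          using that ab by (simp add: C_def m_ac)
        then show ?thesis using that by (auto simp: C_def Q.I_l_closed)
      qed
    qed
    have "\<exists>z\<in>range C. \<forall>y. (y, z) \<in> ideal_ascending R \<longrightarrow> y \<notin> range C"
      using wf unfolding wf_eq_minimal by blast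
    then obtain k where k: "\<And>l. (C l, C k) \<notin> ideal_ascending R" by blast
    have "C k \<subseteq> C (Suc k)"
      using nat_pow_ideal_closed[OF Q.is_ideal ab(2), of _ k "Suc k"] unfolding C_def
      by (auto simp del: nat_pow_Suc)
    then have stat: "C (Suc k) = C k"
      using k[of "Suc k"] C_ideal unfolding ideal_ascending_def by blast
    \<comment> \<open>An element \<open>q' + s' \<cdot> b\<^sup>k\<close> of both ideals is in \<open>Q\<close> after multiplication by \<open>b\<close>, as \<open>a \<cdot> b \<in> Q\<close>;
      so \<open>s'\<close> lies in \<open>(Q : b\<^sup>k\<^sup>+\<^sup>1) = (Q : b\<^sup>k)\<close>.\<close>
    let ?K = "Q <+>\<^bsub>R\<^esub> PIdl a" and ?L = "Q <+>\<^bsub>R\<^esub> PIdl (b [^] k)"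
    have K: "ideal ?K R" and L: "ideal ?L R"
      using ab by (auto intro!: add_ideals Q.is_ideal cgenideal_ideal)
    have sub: "Q \<subseteq> Q <+>\<^bsub>R\<^esub> PIdl c" if "c \<in> carrier R" for c
      unfolding ideal_sum_principal_iff subset_iff
      using that by (metis Q.Icarr l_null r_zero zero_closed)
    have gen: "c \<in> Q <+>\<^bsub>R\<^esub> PIdl c" if "c \<in> carrier R" for c
      unfolding ideal_sum_principal_iff
      using that Q.additive_subgroup_axioms
      by (metis additive_subgroup.zero_closed l_one l_zero one_closed)
    have "x \<in> Q" if x: "x \<in> ?K" "x \<in> ?L" for x
    proof -
      from x obtain q s q' s' where q: "q \<in> Q" "s \<in> carrier R" "x = q \<oplus> s \<otimes> a"
        and q': "q' \<in> Q" "s' \<in> carrier R" "x = q' \<oplus> s' \<otimes> b [^] k"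
        unfolding ideal_sum_principal_iff by blast
      have cl: "q \<in> carrier R" "q' \<in> carrier R" "b [^] k \<in> carrier R"
        using q q' ab by (auto intro: Q.Icarr)
      have "x \<otimes> b = q \<otimes> b \<oplus> s \<otimes> (a \<otimes> b)"
        using q ab cl by (simp add: l_distr m_assoc)
      then have xb: "x \<otimes> b \<in> Q"
        using q ab by (simp add: Q.a_closed Q.I_l_closed Q.I_r_closed)
      have cancel: "u = (v \<oplus> u) \<ominus> v" if "u \<in> carrier R" "v \<in> carrier R" for u v
        using that by (simp add: a_minus_def a_comm[of v u] a_assoc r_neg)
      have "x \<otimes> b = q' \<otimes> b \<oplus> s' \<otimes> b [^] Suc k"
        using q' ab cl by (simp add: l_distr m_assoc)
      then have "s' \<otimes> b [^] Suc k = x \<otimes> b \<ominus> q' \<otimes> b"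
        using cancel[of "s' \<otimes> b [^] Suc k" "q' \<otimes> b"] q' ab cl by simp
      then have "s' \<otimes> b [^] Suc k \<in> Q"
        using xb q' ab by (simp add: a_minus_def Q.a_closed Q.a_inv_closed Q.I_r_closed)
      then have "s' \<in> C k" using stat q' unfolding C_def by auto
      then show ?thesis
        using q' unfolding C_def by (simp add: Q.a_closed)
    qed
    then have "Q = ?K \<inter> ?L" using sub ab by auto
    then have "Q = ?K \<or> Q = ?L"
      using irr K L unfolding irreducible_ideal_def by blast
    then show ?thesis
    proof
      assume "Q = ?K" then show ?thesis using gen ab by blast
    next
      assume "Q = ?L"
      then have "b [^] k \<in> Q" using gen ab by blast
      then show ?thesis using ab unfolding radical_of_def by blast
    qed
  qed
  then show ?thesis
    using irr Q.is_ideal unfolding primary_ideal_def irreducible_ideal_def by blast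
qed

lemma radical_of_Int:
  assumes "ideal P R" "ideal Q R"
  shows "radical_of R (P \<inter> Q) = radical_of R P \<inter> radical_of R Q"
proof
  show "radical_of R P \<inter> radical_of R Q \<subseteq> radical_of R (P \<inter> Q)"
  proof
    fix a assume a: "a \<in> radical_of R P \<inter> radical_of R Q"
    then obtain k l :: nat where kl: "a \<in> carrier R" "a [^] k \<in> P" "a [^] l \<in> Q"
      unfolding radical_of_def by auto
    have "a [^] (k + l) = a [^] k \<otimes> a [^] l" using kl by (simp add: nat_pow_mult)
    then have "a [^] (k + l) \<in> P \<inter> Q"
      using kl assms by (simp add: ideal.I_l_closed ideal.I_r_closed)
    then show "a \<in> radical_of R (P \<inter> Q)" using kl unfolding radical_of_def by blast
  qed
qed (auto simp: radical_of_def)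

lemma primary_Int:
  assumes "primary_ideal R P" "primary_ideal R Q" "radical_of R P = radical_of R Q"
  shows "primary_ideal R (P \<inter> Q)"
proof -
  have id: "ideal P R" "ideal Q R" and ne: "P \<noteq> carrier R"
    using assms unfolding primary_ideal_def by auto
  have rad: "radical_of R (P \<inter> Q) = radical_of R P"
    using radical_of_Int[OF id] assms(3) by simp
  have "P \<inter> Q \<noteq> carrier R"
    using ne ideal.Icarr[OF id(1)] by auto
  moreover have "a \<in> P \<inter> Q \<or> b \<in> radical_of R P"
    if "a \<in> carrier R" "b \<in> carrier R" "a \<otimes> b \<in> P \<inter> Q" for a b
    using assms that unfolding primary_ideal_def by auto
  ultimately show ?thesis
    using rad i_intersect[OF id] unfolding primary_ideal_def by simp
qed

text \<open>
  The Lasker-Noether theorem. A primary decomposition with the least number of components is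
  minimal: two components with the same radical could be merged, and a redundant one removed.
\<close>

lemma minimal_primary_decomposition_exists:
  assumes wf: "wf (ideal_ascending R)" and J: "ideal J R"
  shows "\<exists>D. minimal_primary_decomposition R D J"
proof -
  define dec where "dec = (\<lambda>D. finite D \<and> (\<forall>Q\<in>D. primary_ideal R Q) \<and> carrier R \<inter> \<Inter>D = J)"
  have "\<exists>D. dec D"
    using irreducible_decomposition[OF wf J] irreducible_imp_primary[OF wf]
    unfolding dec_def by blast
  then obtain D where D: "dec D" and least: "\<And>E. dec E \<Longrightarrow> card D \<le> card E"
    using ex_has_least_nat[of dec _ card] by metis
  have inj: "inj_on (radical_of R) D"
  proof (rule inj_onI, rule ccontr)
    fix P Q assume PQ: "P \<in> D" "Q \<in> D" "radical_of R P = radical_of R Q" "P \<noteq> Q"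
    let ?E = "insert (P \<inter> Q) (D - {P, Q})"
    have "dec ?E"
      using D PQ primary_Int unfolding dec_def by auto
    moreover have "card ?E < card D"
    proof -
      have "card (D - {P, Q}) = card D - 2" "card D \<ge> 2"
        using PQ D card_mono[of D "{P, Q}"] unfolding dec_def by (auto simp: card_Diff_subset)
      moreover have "card ?E \<le> Suc (card (D - {P, Q}))"
        using D unfolding dec_def by (simp add: card_insert_if)
      ultimately show ?thesis by linarith
    qed
    ultimately show False using least[of ?E] by linarith
  qed
  have "\<not> carrier R \<inter> \<Inter>(D - {Q}) \<subseteq> Q" if Q: "Q \<in> D" for Q
  proof
    assume "carrier R \<inter> \<Inter>(D - {Q}) \<subseteq> Q"
    then have "dec (D - {Q})"
      using D Q unfolding dec_def by auto
    moreover have "card (D - {Q}) < card D"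
      using D Q unfolding dec_def by (intro psubset_card_mono) auto
    ultimately show False using least[of "D - {Q}"] by linarith
  qed
  then show ?thesis
    using D inj unfolding dec_def minimal_primary_decomposition_def by blast
qed

lemma prime_nat_pow:
  assumes "primeideal P R" "a \<in> carrier R" "a [^] (k::nat) \<in> P"
  shows "a \<in> P"
proof -
  interpret P: primeideal P R by fact
  show ?thesis
    using assms(3)
  proof (induction k)
    case 0
    then have "P = carrier R" using P.one_imp_carrier by simp
    then show ?case using P.I_notcarr by simp
  next
    case (Suc k)
    then show ?case using P.I_prime[of "a [^] k" a] assms(2) by auto
  qed
qed

text \<open>
  A product of elements outside a prime ideal, one from each member of \<open>D\<close>, stays outside.
\<close>

lemma finite_prod_avoid_prime:
  assumes P: "primeideal P R" and "finite D"
    and "\<And>Q. Q \<in> D \<Longrightarrow> ideal Q R" "\<And>Q. Q \<in> D \<Longrightarrow> \<not> Q \<subseteq> P"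
  shows "\<exists>s \<in> carrier R - P. \<forall>Q\<in>D. s \<in> Q"
  using assms(2-)
proof (induction D)
  case empty
  interpret P: primeideal P R by fact
  have "\<one> \<notin> P" using P.one_imp_carrier P.I_notcarr by auto
  then show ?case by auto
next
  case (insert Q D)
  interpret P: primeideal P R by fact
  obtain s where s: "s \<in> carrier R - P" "\<forall>Q\<in>D. s \<in> Q"
    using insert.IH insert.prems by auto
  obtain t where t: "t \<in> Q" "t \<notin> P" using insert.prems by blast
  have tc: "t \<in> carrier R" using t insert.prems(1)[of Q] ideal.Icarr[of Q R t] by simp
  have "s \<otimes> t \<notin> P" using P.I_prime[of s t] s t tc by auto
  moreover have "\<forall>Q'\<in>insert Q D. s \<otimes> t \<in> Q'"
    using s t tc insert.prems by (auto intro: ideal.I_l_closed ideal.I_r_closed)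
  ultimately show ?case using s tc by (intro bexI[of _ "s \<otimes> t"]) auto
qed

text \<open>
  The second symbolic power is the contraction of the square of \<open>P\<close> from the localization at \<open>P\<close>.
  Every component other than the \<open>P\<close>-primary one contains an element outside \<open>P\<close>, so it becomes
  trivial in the localization.
\<close>

theorem symbolic_square_eq:
  assumes wf: "wf (ideal_ascending R)" and P: "primeideal P R"
  shows "symbolic_square R P =
    {f \<in> carrier R. \<exists>s \<in> carrier R - P. s \<otimes> f \<in> ideal_prod R P P}"
proof -
  interpret P: primeideal P R by fact
  let ?S = "{f \<in> carrier R. \<exists>s \<in> carrier R - P. s \<otimes> f \<in> ideal_prod R P P}"
  have PP: "ideal (ideal_prod R P P) R"
    by (rule ideal_prod_is_ideal[OF P.is_ideal P.is_ideal])
  have radical_eq: "radical_of R (ideal_prod R P P) = P"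
  proof
    show "P \<subseteq> radical_of R (ideal_prod R P P)"
    proof
      fix a assume a: "a \<in> P"
      then have "a [^] (2::nat) \<in> ideal_prod R P P"
        using P.Icarr by (simp add: numeral_2_eq_2 ideal_prod.prod)
      then show "a \<in> radical_of R (ideal_prod R P P)"
        using a P.Icarr unfolding radical_of_def by blast
    qed
    have "ideal_prod R P P \<subseteq> P"
      using ideal_prod_inter[OF P.is_ideal P.is_ideal] by blast
    then show "radical_of R (ideal_prod R P P) \<subseteq> P"
      using prime_nat_pow[OF P] unfolding radical_of_def by blast
  qed
  have component: "Q = ?S"
    if D: "minimal_primary_decomposition R D (ideal_prod R P P)"
      and Q: "Q \<in> D" "radical_of R Q = P" for D Q
  proof -
    have prim: "\<And>Q'. Q' \<in> D \<Longrightarrow> primary_ideal R Q'" and fin: "finite D"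
      and Int: "carrier R \<inter> \<Inter>D = ideal_prod R P P" and inj: "inj_on (radical_of R) D"
      using D unfolding minimal_primary_decomposition_def by auto
    have "\<not> Q' \<subseteq> P" if Q': "Q' \<in> D - {Q}" for Q'
    proof
      assume "Q' \<subseteq> P"
      then have "radical_of R Q' \<subseteq> P"
        using prime_nat_pow[OF P] unfolding radical_of_def by blast
      moreover have "P \<subseteq> radical_of R Q'"
      proof -
        have "ideal_prod R P P \<subseteq> Q'" using Int Q' by blast
        then show ?thesis using radical_eq unfolding radical_of_def by blast
      qed
      ultimately have "radical_of R Q' = radical_of R Q" using Q by blast
      then show False using inj Q Q' unfolding inj_on_def by blast
    qed
    then obtain s where s: "s \<in> carrier R - P" "\<forall>Q'\<in>D - {Q}. s \<in> Q'"
      using finite_prod_avoid_prime[OF P, of "D - {Q}"] fin prim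
      unfolding primary_ideal_def by auto
    have "f \<in> ?S" if f: "f \<in> Q" for f
    proof -
      have fc: "f \<in> carrier R" using f prim[OF Q(1)] ideal.Icarr[of Q R f] unfolding primary_ideal_def by blast
      have "s \<otimes> f \<in> Q'" if "Q' \<in> D" for Q'
      proof -
        have "ideal Q' R" using prim that unfolding primary_ideal_def by blast
        then show ?thesis
          using s f fc that by (cases "Q' = Q") (auto intro: ideal.I_l_closed ideal.I_r_closed)
      qed
      then have "s \<otimes> f \<in> ideal_prod R P P" using Int s fc by auto
      then show ?thesis using s fc by blast
    qed
    moreover have "f \<in> Q" if f: "f \<in> ?S" for f
    proof -
      from f obtain t where t: "f \<in> carrier R" "t \<in> carrier R" "t \<notin> P" "t \<otimes> f \<in> ideal_prod R P P"
        by blast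
      have "f \<otimes> t \<in> Q" using t Int Q m_comm by auto
      then show ?thesis
        using prim[OF Q(1)] t Q unfolding primary_ideal_def by blast
    qed
    ultimately show ?thesis by blast
  qed
  obtain D where D: "minimal_primary_decomposition R D (ideal_prod R P P)"
    using minimal_primary_decomposition_exists[OF wf PP] by blast
  have prim: "\<And>Q. Q \<in> D \<Longrightarrow> primary_ideal R Q" and fin: "finite D"
    and Int: "carrier R \<inter> \<Inter>D = ideal_prod R P P"
    using D unfolding minimal_primary_decomposition_def by auto
  have "\<exists>Q\<in>D. Q \<subseteq> P"
  proof (rule ccontr)
    assume "\<not> ?thesis"
    then obtain s where "s \<in> carrier R - P" "\<forall>Q\<in>D. s \<in> Q"
      using finite_prod_avoid_prime[OF P fin] prim unfolding primary_ideal_def by blast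
    then have "s \<in> ideal_prod R P P" using Int by blast
    then show False
      using \<open>s \<in> carrier R - P\<close> ideal_prod_inter[OF P.is_ideal P.is_ideal] by blast
  qed
  then obtain Q where Q: "Q \<in> D" "Q \<subseteq> P" by blast
  have "radical_of R Q \<subseteq> P"
    using Q prime_nat_pow[OF P] unfolding radical_of_def by blast
  moreover have "P \<subseteq> radical_of R Q"
  proof -
    have "ideal_prod R P P \<subseteq> Q" using Int Q by blast
    then show ?thesis using radical_eq unfolding radical_of_def by blast
  qed
  ultimately have radQ: "radical_of R Q = P" by blast
  have "symbolic_square R P = Q"
    unfolding symbolic_square_def
  proof (rule the_equality)
    show "\<exists>D. minimal_primary_decomposition R D (ideal_prod R P P) \<and> Q \<in> D \<and> radical_of R Q = P"
      by (intro exI[of _ D] conjI D Q(1) radQ)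
    fix Q' assume "\<exists>D. minimal_primary_decomposition R D (ideal_prod R P P) \<and> Q' \<in> D \<and>
      radical_of R Q' = P"
    then have "Q' = ?S" by (elim exE conjE) (rule component)
    also have "\<dots> = Q" by (rule component[OF D Q(1) radQ, symmetric])
    finally show "Q' = Q" .
  qed
  also have "\<dots> = ?S" by (rule component[OF D Q(1) radQ])
  finally show ?thesis .
qed

end

section \<open>Polynomial rings, substitutions and partial derivatives\<close>

abbreviation lookup :: "('a \<Rightarrow>\<^sub>0 'b::zero) \<Rightarrow> 'a \<Rightarrow> 'b" where
  "lookup \<equiv> Poly_Mapping.lookup"

abbreviation keys :: "('a \<Rightarrow>\<^sub>0 'b::zero) \<Rightarrow> 'a set" where
  "keys \<equiv> Poly_Mapping.keys"

abbreviation single :: "'a \<Rightarrow> 'b \<Rightarrow> 'a \<Rightarrow>\<^sub>0 'b::zero" where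
  "single \<equiv> Poly_Mapping.single"

lemma poly_ring_simps [simp]:
  "mult (poly_ring V) = (*)" "one (poly_ring V) = 1" "zero (poly_ring V) = 0"
  "add (poly_ring V) = (+)"
  unfolding poly_ring_def by simp_all

lemma mem_poly_ring: "p \<in> carrier (poly_ring V) \<longleftrightarrow> keys p \<subseteq> monomials V"
  unfolding poly_ring_def by simp

lemma zero_in_monomials [simp]: "0 \<in> monomials V"
  unfolding monomials_def by simp

lemma add_in_monomials: "a \<in> monomials V \<Longrightarrow> b \<in> monomials V \<Longrightarrow> a + b \<in> monomials V"
  unfolding monomials_def using keys_add[of a b] by auto

lemma single_in_monomials: "v \<in> V \<Longrightarrow> single v k \<in> monomials V"
  unfolding monomials_def by auto

lemma monomials_add_cancel: "a + b \<in> monomials V \<Longrightarrow> b \<in> monomials V"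
  unfolding monomials_def by (auto simp: in_keys_iff lookup_add)

lemma minus_in_monomials: "a \<in> monomials V \<Longrightarrow> a - b \<in> monomials V"
  unfolding monomials_def by (auto simp: in_keys_iff lookup_minus)

lemma poly_ring_single: "m \<in> monomials V \<Longrightarrow> single m c \<in> carrier (poly_ring V)"
  unfolding mem_poly_ring by auto

lemma poly_ring_zero [simp]: "0 \<in> carrier (poly_ring V)"
  and poly_ring_one [simp]: "1 \<in> carrier (poly_ring V)"
  by (simp_all add: mem_poly_ring)

lemma poly_ring_var: "v \<in> V \<Longrightarrow> var v \<in> carrier (poly_ring V)"
  unfolding var_def by (intro poly_ring_single single_in_monomials)

lemma poly_ring_add:
  "p \<in> carrier (poly_ring V) \<Longrightarrow> q \<in> carrier (poly_ring V) \<Longrightarrow> p + q \<in> carrier (poly_ring V)"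
  unfolding mem_poly_ring using keys_add[of p q] by blast

lemma poly_ring_mult:
  "p \<in> carrier (poly_ring V) \<Longrightarrow> q \<in> carrier (poly_ring V) \<Longrightarrow> p * q \<in> carrier (poly_ring V)"
  unfolding mem_poly_ring using keys_mult[of p q] add_in_monomials by fast

lemma poly_ring_uminus: "p \<in> carrier (poly_ring V) \<Longrightarrow> - p \<in> carrier (poly_ring V)"
  unfolding mem_poly_ring by (auto simp: in_keys_iff)

lemma poly_ring_diff:
  "p \<in> carrier (poly_ring V) \<Longrightarrow> q \<in> carrier (poly_ring V) \<Longrightarrow> p - q \<in> carrier (poly_ring V)"
  using poly_ring_add[of p V "- q"] poly_ring_uminus by force

lemma poly_ring_power: "p \<in> carrier (poly_ring V) \<Longrightarrow> p ^ k \<in> carrier (poly_ring V)"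
  by (induction k) (auto intro: poly_ring_mult)

lemma poly_ring_sum:
  "(\<And>x. x \<in> A \<Longrightarrow> f x \<in> carrier (poly_ring V)) \<Longrightarrow> sum f A \<in> carrier (poly_ring V)"
  by (induction A rule: infinite_finite_induct) (auto intro: poly_ring_add)

lemma poly_ring_prod:
  "(\<And>x. x \<in> A \<Longrightarrow> f x \<in> carrier (poly_ring V)) \<Longrightarrow> prod f A \<in> carrier (poly_ring V)"
  by (induction A rule: infinite_finite_induct) (auto intro: poly_ring_mult)

lemmas poly_ring_closed = poly_ring_zero poly_ring_one poly_ring_add poly_ring_mult
  poly_ring_uminus poly_ring_diff poly_ring_power poly_ring_sum poly_ring_prod poly_ring_var

lemma cring_poly_ring: "cring (poly_ring V)"
proof (rule cringI)
  show "abelian_group (poly_ring V)"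
  proof (rule abelian_groupI)
    show "\<exists>q\<in>carrier (poly_ring V). q \<oplus>\<^bsub>poly_ring V\<^esub> p = \<zero>\<^bsub>poly_ring V\<^esub>"
      if "p \<in> carrier (poly_ring V)" for p
      using that by (intro bexI[of _ "- p"]) (auto intro: poly_ring_uminus)
  qed (auto intro: poly_ring_closed)
  show "comm_monoid (poly_ring V)"
    by (rule comm_monoidI) (auto intro: poly_ring_closed simp: ac_simps)
qed (auto simp: algebra_simps)

interpretation poly_ring: cring "poly_ring V"
  rewrites "mult (poly_ring V) = (*)" and "one (poly_ring V) = 1" and "zero (poly_ring V) = 0"
    and "add (poly_ring V) = (+)"
  by (simp_all add: cring_poly_ring)

lemma poly_ring_ideal:
  assumes "ideal J (poly_ring V)"
  shows poly_ring_ideal_subset: "J \<subseteq> carrier (poly_ring V)"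
    and poly_ring_ideal_zero: "0 \<in> J"
    and poly_ring_ideal_add: "f \<in> J \<Longrightarrow> g \<in> J \<Longrightarrow> f + g \<in> J"
    and poly_ring_ideal_mult_left: "f \<in> J \<Longrightarrow> h \<in> carrier (poly_ring V) \<Longrightarrow> h * f \<in> J"
    and poly_ring_ideal_mult_right: "f \<in> J \<Longrightarrow> h \<in> carrier (poly_ring V) \<Longrightarrow> f * h \<in> J"
    and poly_ring_ideal_uminus: "f \<in> J \<Longrightarrow> - f \<in> J"
    and poly_ring_ideal_diff: "f \<in> J \<Longrightarrow> g \<in> J \<Longrightarrow> f - g \<in> J"
proof -
  interpret J: ideal J "poly_ring V" by fact
  show "J \<subseteq> carrier (poly_ring V)" using J.Icarr by blast
  show "0 \<in> J" using J.zero_closed by simp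
  show add: "f + g \<in> J" if "f \<in> J" "g \<in> J" for f g
    using J.a_closed that by simp
  show mult: "h * f \<in> J" if "f \<in> J" "h \<in> carrier (poly_ring V)" for f h
    using J.I_l_closed that by simp
  show "f * h \<in> J" if "f \<in> J" "h \<in> carrier (poly_ring V)" for f h
    using J.I_r_closed that by simp
  have minus_one: "- 1 \<in> carrier (poly_ring V)" by (auto intro: poly_ring_closed)
  show uminus: "- f \<in> J" if "f \<in> J" for f
    using mult[OF that minus_one] by simp
  show "f - g \<in> J" if "f \<in> J" "g \<in> J" for f g
    using add[OF that(1) uminus[OF that(2)]] by simp
qed

lemma poly_ring_ideal_sum:
  assumes "ideal J (poly_ring V)" "\<And>x. x \<in> A \<Longrightarrow> f x \<in> J"
  shows "sum f A \<in> J"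
  using assms(2) by (induction A rule: infinite_finite_induct)
    (auto intro: poly_ring_ideal_add[OF assms(1)] poly_ring_ideal_zero[OF assms(1)])

lemma poly_ring_idealI:
  assumes "J \<subseteq> carrier (poly_ring V)" "0 \<in> J"
    "\<And>f g. f \<in> J \<Longrightarrow> g \<in> J \<Longrightarrow> f + g \<in> J"
    "\<And>f h. f \<in> J \<Longrightarrow> h \<in> carrier (poly_ring V) \<Longrightarrow> h * f \<in> J"
  shows "ideal J (poly_ring V)"
proof (rule idealI[OF poly_ring.ring_axioms])
  have uminus: "- f \<in> J" if "f \<in> J" for f
    using assms(4)[OF that, of "- 1"] by (simp add: poly_ring_uminus)
  have inv: "inv\<^bsub>add_monoid (poly_ring V)\<^esub> f = - f" if "f \<in> carrier (poly_ring V)" for f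
    unfolding a_inv_def[symmetric]
    by (rule poly_ring.minus_equality) (use that in \<open>auto intro: poly_ring_uminus\<close>)
  have "abelian_group (poly_ring V)"
    by (rule ring.is_abelian_group[OF cring.axioms(1)[OF cring_poly_ring]])
  then show "subgroup J (add_monoid (poly_ring V))"
    by (intro group.subgroupI abelian_group.a_group)
      (use assms uminus inv in auto)
  show "h \<otimes>\<^bsub>poly_ring V\<^esub> f \<in> J" "f \<otimes>\<^bsub>poly_ring V\<^esub> h \<in> J"
    if "f \<in> J" "h \<in> carrier (poly_ring V)" for f h
    using assms(4)[OF that] by (simp_all add: mult.commute)
qed

lemma poly_mapping_sum_single:
  fixes p :: "'a \<Rightarrow>\<^sub>0 'b::comm_monoid_add"
  shows "p = (\<Sum>m\<in>keys p. single m (lookup p m))"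
  by (rule poly_mapping_eqI)
    (simp add: lookup_sum lookup_single when_def in_keys_iff sum.delta')

lemma poly_mapping_single_induct [case_names zero single add]:
  fixes p :: "'a \<Rightarrow>\<^sub>0 'b::comm_monoid_add"
  assumes "P 0" "\<And>m c. m \<in> keys p \<Longrightarrow> P (single m c)"
    "\<And>f g. P f \<Longrightarrow> P g \<Longrightarrow> P (f + g)"
  shows "P p"
proof -
  have "P (\<Sum>m\<in>A. single m (lookup p m))" if "finite A" "A \<subseteq> keys p" for A
    using that by (induction A) (auto intro: assms)
  from this[of "keys p"] show ?thesis
    by (simp flip: poly_mapping_sum_single)
qed

lemma var_power: "var v ^ k = single (single v k) 1"
  by (induction k) (simp_all add: var_def mult_single single_add[symmetric])

lemma prod_single:
  fixes f :: "'i \<Rightarrow> 'v monomial"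
  shows "(\<Prod>i\<in>A. single (f i) (1::complex)) = single (\<Sum>i\<in>A. f i) 1"
  by (induction A rule: infinite_finite_induct) (simp_all add: mult_single)

lemma single_eq_prod_var:
  "single m c =
    single 0 c * (\<Prod>v\<in>keys m. var v ^ lookup m v)"
  using poly_mapping_sum_single[of m] by (simp add: var_power prod_single mult_single)

lemma poly_ring_induct [consumes 1, case_names const var add mult]:
  assumes "p \<in> carrier (poly_ring V)"
    and const: "\<And>c. P (single 0 c)" and "\<And>v. v \<in> V \<Longrightarrow> P (var v)"
    and "\<And>f g. P f \<Longrightarrow> P g \<Longrightarrow> P (f + g)" and mult: "\<And>f g. P f \<Longrightarrow> P g \<Longrightarrow> P (f * g)"
  shows "P p"
proof (induction p rule: poly_mapping_single_induct)
  case zero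
  show ?case using const[of 0] by simp
next
  case (single m c)
  then have m: "keys m \<subseteq> V"
    using assms(1) unfolding mem_poly_ring monomials_def by auto
  have "P (\<Prod>v\<in>A. var v ^ lookup m v)" if "finite A" "A \<subseteq> keys m" for A
    using that
  proof (induction A)
    case empty
    show ?case using const[of 1] by simp
  next
    case (insert v A)
    have "P (var v ^ k)" for k
    proof (induction k)
      case 0
      show ?case using const[of 1] by simp
    qed (use insert assms m in auto)
    then show ?case using insert by (auto intro: mult)
  qed
  then show ?case
    by (subst single_eq_prod_var) (auto intro: mult const)
qed (use assms in blast)

definition monomial_value :: "('v \<Rightarrow> 'w mpoly) \<Rightarrow> 'v monomial \<Rightarrow> 'w mpoly" where
  "monomial_value g m = (\<Prod>v\<in>keys m. g v ^ lookup m v)"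

lemma monomial_value_superset:
  "finite A \<Longrightarrow> keys m \<subseteq> A \<Longrightarrow> monomial_value g m = (\<Prod>v\<in>A. g v ^ lookup m v)"
  unfolding monomial_value_def
  by (rule prod.mono_neutral_left) (auto simp: in_keys_iff)

lemma monomial_value_add: "monomial_value g (a + b) = monomial_value g a * monomial_value g b"
proof -
  let ?A = "keys a \<union> keys b"
  have "monomial_value g m = (\<Prod>v\<in>?A. g v ^ lookup m v)" if "m \<in> {a, b, a + b}" for m
    using that keys_add[of a b] by (intro monomial_value_superset) auto
  then show ?thesis by (simp add: lookup_add power_add prod.distrib)
qed

lemma subst_superset:
  assumes "finite A" "keys p \<subseteq> A"
  shows "subst g p = (\<Sum>m\<in>A. single 0 (lookup p m) * monomial_value g m)"
  unfolding subst_def monomial_value_def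
  by (rule sum.mono_neutral_left) (use assms in \<open>auto simp: in_keys_iff\<close>)

lemma subst_add [simp]: "subst g (p + q) = subst g p + subst g q"
proof -
  let ?A = "keys p \<union> keys q"
  have "subst g r = (\<Sum>m\<in>?A. single 0 (lookup r m) * monomial_value g m)"
    if "r \<in> {p, q, p + q}" for r
    using that keys_add[of p q] by (intro subst_superset) auto
  then show ?thesis by (simp add: lookup_add single_add distrib_right sum.distrib)
qed

lemma subst_single: "subst g (single m c) = single 0 c * monomial_value g m"
  by (subst subst_superset[of "{m}"]) auto

lemma subst_const [simp]: "subst g (single 0 c) = single 0 c"
  by (simp add: subst_single monomial_value_def)

lemma subst_zero [simp]: "subst g 0 = 0"
  by (simp add: subst_def)

lemma subst_one [simp]: "subst g 1 = 1"
  using subst_const[of g 1] by simp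

lemma subst_var [simp]: "subst g (var v) = g v"
  unfolding var_def by (simp add: subst_single monomial_value_def)

lemma subst_mult [simp]:
  fixes g :: "'v \<Rightarrow> 'w mpoly"
  shows "subst g (p * q) = subst g p * subst g q"
proof (induction p rule: poly_mapping_single_induct)
  case (single m c)
  show ?case
  proof (induction q rule: poly_mapping_single_induct)
    case (single k d)
    have split: "single (0 :: 'w monomial) (c * d) = single 0 c * single 0 d"
      by (simp add: mult_single)
    have "subst g (single m c * single k d) =
        single 0 (c * d) * (monomial_value g m * monomial_value g k)"
      by (simp add: mult_single subst_single monomial_value_add)
    also have "\<dots> = (single 0 c * monomial_value g m) * (single 0 d * monomial_value g k)"
      unfolding split by (simp only: ac_simps)
    finally show ?case by (simp only: subst_single)
  qed (simp_all add: distrib_left)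
qed (simp_all add: distrib_right)

lemma subst_uminus [simp]: "subst g (- p) = - subst g p"
  using subst_add[of g p "- p"] by (simp add: eq_neg_iff_add_eq_0 add.commute)

lemma subst_diff [simp]: "subst g (p - q) = subst g p - subst g q"
  using subst_add[of g p "- q"] by simp

lemma subst_power [simp]: "subst g (p ^ k) = subst g p ^ k"
  by (induction k) simp_all

lemma subst_closed:
  assumes "p \<in> carrier (poly_ring V)" "\<And>v. v \<in> V \<Longrightarrow> g v \<in> carrier (poly_ring W)"
  shows "subst g p \<in> carrier (poly_ring W)"
  using assms(1) by (induction p rule: poly_ring_induct)
    (auto intro: assms poly_ring_closed poly_ring_single)

lemma subst_cong:
  assumes "p \<in> carrier (poly_ring V)" "\<And>v. v \<in> V \<Longrightarrow> g v = h v"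
  shows "subst g p = subst h p"
  using assms(1) by (induction p rule: poly_ring_induct) (simp_all add: assms)

lemma poly_ring_UNIV: "p \<in> carrier (poly_ring UNIV)"
  by (simp add: mem_poly_ring monomials_def)

lemma subst_subst: "subst g (subst h p) = subst (\<lambda>v. subst g (h v)) p"
  using poly_ring_UNIV[of p] by (induction p rule: poly_ring_induct) simp_all

lemma ring_hom_subst:
  assumes "\<And>v. v \<in> V \<Longrightarrow> g v \<in> carrier (poly_ring W)"
  shows "ring_hom_ring (poly_ring V) (poly_ring W) (subst g)"
  by (intro ring_hom_ringI poly_ring.ring_axioms) (auto intro: subst_closed assms)

lemma mem_kernel_subst:
  "p \<in> a_kernel (poly_ring V) (poly_ring W) (subst g) \<longleftrightarrow>
    p \<in> carrier (poly_ring V) \<and> subst g p = 0"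
  by (simp add: a_kernel_def')

definition pd :: "'v \<Rightarrow> 'v mpoly \<Rightarrow> 'v mpoly" where
  "pd e p = (\<Sum>m\<in>keys p.
     single (m - single e 1) (of_nat (lookup m e) * lookup p m))"

text \<open>
  The factor \<open>lookup m e + 1\<close> never vanishes in characteristic zero; this is what lets the leading
  monomial survive differentiation.
\<close>

lemma lookup_pd:
  "lookup (pd e p) m = of_nat (lookup m e + 1) * lookup p (m + single e 1)"
proof -
  let ?k = "m + single e 1"
  have eq: "(of_nat (lookup k e) * lookup p k when k - single e 1 = m) =
      (of_nat (lookup m e + 1) * lookup p ?k when k = ?k)" for k
  proof (cases "lookup k e = 0")
    case True
    then have "k \<noteq> ?k" by (metis add_is_0 lookup_add lookup_single_eq one_neq_zero)
    with True show ?thesis by simp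
  next
    case False
    have "k - single e 1 = m \<longleftrightarrow> k = ?k"
    proof
      assume "k - single e 1 = m"
      then show "k = ?k" using False
        by (intro poly_mapping_eqI) (auto simp: lookup_add lookup_minus lookup_single when_def)
    qed simp
    then show ?thesis by (auto simp: lookup_add when_def)
  qed
  have "lookup (pd e p) m =
      (\<Sum>k\<in>keys p. of_nat (lookup m e + 1) * lookup p ?k when k = ?k)"
    unfolding pd_def lookup_sum lookup_single eq ..
  also have "\<dots> = of_nat (lookup m e + 1) * lookup p ?k"
    by (simp add: when_def sum.delta in_keys_iff)
  finally show ?thesis .
qed

lemma pd_add [simp]: "pd e (p + q) = pd e p + pd e q"
  by (rule poly_mapping_eqI) (simp add: lookup_pd lookup_add algebra_simps)

lemma pd_diff [simp]: "pd e (p - q) = pd e p - pd e q"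
  by (rule poly_mapping_eqI) (simp add: lookup_pd lookup_minus algebra_simps)

lemma pd_zero [simp]: "pd e 0 = 0"
  by (simp add: pd_def)

lemma pd_single:
  "pd e (single m c) =
    single (m - single e 1) (of_nat (lookup m e) * c)"
  by (cases "c = 0") (simp_all add: pd_def)

lemma pd_const [simp]: "pd e (single 0 c) = 0"
  by (simp add: pd_single)

lemma pd_var: "pd e (var v) = (if v = e then 1 else 0)"
  by (simp add: var_def pd_single lookup_single when_def)

lemma monomial_minus_add:
  fixes a b :: "'v monomial"
  assumes "lookup a e \<noteq> 0"
  shows "a + b - single e 1 = (a - single e 1) + b"
  using assms by (intro poly_mapping_eqI) (auto simp: lookup_add lookup_minus lookup_single when_def)

lemma pd_mult: "pd e (p * q) = pd e p * q + p * pd e q"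
proof (induction p rule: poly_mapping_single_induct)
  case (single m c)
  show ?case
  proof (induction q rule: poly_mapping_single_induct)
    case (single k d)
    have "single (m + k - single e 1) (of_nat (lookup m e) * (c * d)) =
        single (m - single e 1 + k) (of_nat (lookup m e) * (c * d))"
      by (cases "lookup m e = 0") (simp_all add: monomial_minus_add del: One_nat_def)
    moreover have "single (m + k - single e 1) (of_nat (lookup k e) * (c * d)) =
        single (m + (k - single e 1)) (of_nat (lookup k e) * (c * d))"
      using monomial_minus_add[of k e m] by (cases "lookup k e = 0") (simp_all add: add.commute del: One_nat_def)
    ultimately show ?case
      by (simp add: mult_single pd_single lookup_add distrib_left distrib_right single_add mult.left_commute
          mult.assoc del: One_nat_def)
  qed (simp_all add: distrib_left algebra_simps)
qed (simp_all add: distrib_right algebra_simps)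

lemma pd_closed:
  assumes "p \<in> carrier (poly_ring V)"
  shows "pd e p \<in> carrier (poly_ring V)"
proof -
  have "m - single e 1 \<in> monomials V" if "m \<in> keys p" for m
    using that assms by (auto simp: mem_poly_ring intro!: minus_in_monomials)
  then show ?thesis
    unfolding pd_def by (intro poly_ring_sum poly_ring_single)
qed

text \<open>
  Taylor expansion up to second order in the direction of one variable. Both the claim and its
  remainder term pass through sums and products, so it suffices to check constants and variables.
\<close>

lemma subst_taylor:
  "\<exists>h. subst (\<lambda>v. if v = e then g v + c else g v) p =
     subst g p + c * subst g (pd e p) + c ^ 2 * h"
  using poly_ring_UNIV[of p]
proof (induction p rule: poly_ring_induct)
  case (const a)
  show ?case by (intro exI[of _ 0]) simp
next
  case (var v)
  show ?case by (intro exI[of _ 0]) (simp add: pd_var)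
next
  case (add p q)
  then obtain h k where
    "subst (\<lambda>v. if v = e then g v + c else g v) p = subst g p + c * subst g (pd e p) + c ^ 2 * h"
    "subst (\<lambda>v. if v = e then g v + c else g v) q = subst g q + c * subst g (pd e q) + c ^ 2 * k"
    by blast
  then show ?case by (intro exI[of _ "h + k"]) (simp add: algebra_simps)
next
  case (mult p q)
  then obtain h k where
    "subst (\<lambda>v. if v = e then g v + c else g v) p = subst g p + c * subst g (pd e p) + c ^ 2 * h"
    "subst (\<lambda>v. if v = e then g v + c else g v) q = subst g q + c * subst g (pd e q) + c ^ 2 * k"
    by blast
  then show ?case
    by (intro exI[of _ "subst g (pd e p) * subst g (pd e q) + h * subst g q + subst g p * k +
          c * (subst g (pd e p) * k + h * subst g (pd e q)) + c ^ 2 * (h * k)"])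
      (simp add: pd_mult algebra_simps power2_eq_square)
qed

section \<open>Term orders and leading monomials\<close>

lemma exists_nondecreasing_subsequence:
  fixes f :: "nat \<Rightarrow> nat"
  shows "\<exists>\<phi>::nat \<Rightarrow> nat. strict_mono \<phi> \<and> mono (\<lambda>i. f (\<phi> i))"
proof -
  obtain \<phi> where \<phi>: "strict_mono \<phi>" "monoseq (\<lambda>i. f (\<phi> i))"
    using seq_monosub[of f] by auto
  show ?thesis
  proof (cases "mono (\<lambda>i. f (\<phi> i))")
    case True
    with \<phi> show ?thesis by blast
  next
    case False
    then have dec: "f (\<phi> j) \<le> f (\<phi> i)" if "i \<le> j" for i j
      using \<phi>(2) that unfolding monoseq_def mono_def by blast
    obtain N where N: "\<And>i. f (\<phi> N) \<le> f (\<phi> i)"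
      using ex_has_least_nat[of "\<lambda>_. True" 0 "\<lambda>i. f (\<phi> i)"] by auto
    have "f (\<phi> (i + N)) = f (\<phi> N)" for i
      using N[of "i + N"] dec[of N "i + N"] by simp
    then show ?thesis
      using \<phi>(1) by (intro exI[of _ "\<lambda>i. \<phi> (i + N)"]) (auto simp: strict_mono_def mono_def)
  qed
qed

lemma exists_pointwise_nondecreasing_subsequence:
  fixes s :: "nat \<Rightarrow> 'v monomial"
  assumes "finite W"
  shows "\<exists>\<phi>::nat \<Rightarrow> nat. strict_mono \<phi> \<and> (\<forall>v\<in>W. mono (\<lambda>i. lookup (s (\<phi> i)) v))"
  using assms
proof (induction W)
  case empty
  show ?case by (intro exI[of _ id]) (simp add: strict_mono_def)
next
  case (insert v W)
  then obtain \<phi> :: "nat \<Rightarrow> nat" where \<phi>: "strict_mono \<phi>" "\<forall>v\<in>W. mono (\<lambda>i. lookup (s (\<phi> i)) v)"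
    by blast
  obtain \<psi> :: "nat \<Rightarrow> nat" where \<psi>: "strict_mono \<psi>" "mono (\<lambda>i. lookup (s (\<phi> (\<psi> i))) v)"
    using exists_nondecreasing_subsequence[of "\<lambda>i. lookup (s (\<phi> i)) v"] by blast
  have "mono (\<lambda>i. lookup (s (\<phi> (\<psi> i))) w)" if "w \<in> W" for w
    using \<phi>(2) that strict_mono_mono[OF \<psi>(1)] unfolding mono_def by blast
  moreover have "strict_mono (\<lambda>i. \<phi> (\<psi> i))"
    using \<phi>(1) \<psi>(1) unfolding strict_mono_def by blast
  ultimately show ?case using \<psi>(2) by (intro exI[of _ "\<lambda>i. \<phi> (\<psi> i)"]) simp
qed

lemma monomial_le_imp_add:
  fixes a b :: "'v monomial"
  assumes "\<And>v. lookup a v \<le> lookup b v"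
  shows "b = (b - a) + a"
  using assms by (intro poly_mapping_eqI) (simp add: lookup_add lookup_minus)

text \<open>
  Dickson's lemma. A subsequence along which all exponents are nondecreasing exists because there
  are finitely many variables; each of its terms divides the next one.
\<close>

lemma dickson:
  fixes s :: "nat \<Rightarrow> 'v monomial"
  assumes "finite V" and s: "\<And>i. s i \<in> monomials V"
  shows "\<exists>i j. i < j \<and> (\<exists>c\<in>monomials V. s j = c + s i)"
proof -
  obtain \<phi> :: "nat \<Rightarrow> nat" where \<phi>: "strict_mono \<phi>" "\<forall>v\<in>V. mono (\<lambda>i. lookup (s (\<phi> i)) v)"
    using exists_pointwise_nondecreasing_subsequence[OF assms(1), of s] by blast
  have "lookup (s (\<phi> 0)) v \<le> lookup (s (\<phi> 1)) v" for v
  proof (cases "v \<in> V")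
    case True
    then show ?thesis using \<phi>(2) unfolding mono_def by blast
  next
    case False
    then have "lookup (s (\<phi> 0)) v = 0"
      using s[of "\<phi> 0"] unfolding monomials_def by (auto simp: in_keys_iff)
    then show ?thesis by simp
  qed
  then have "s (\<phi> 1) = (s (\<phi> 1) - s (\<phi> 0)) + s (\<phi> 0)"
    by (rule monomial_le_imp_add)
  moreover have "\<phi> 0 < \<phi> 1" using \<phi>(1) unfolding strict_mono_def by simp
  ultimately show ?thesis using minus_in_monomials s by blast
qed

definition leading_monomials :: "'v monomial rel \<Rightarrow> 'v mpoly set \<Rightarrow> 'v monomial set" where
  "leading_monomials r J = {leading_monomial r f | f. f \<in> J \<and> f \<noteq> 0}"

locale monomial_order =
  fixes V :: "'v set" and r :: "'v monomial rel"
  assumes finite_vars: "finite V" and term_order: "term_order V r"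
begin

lemma refl: "a \<in> monomials V \<Longrightarrow> (a, a) \<in> r"
  and antisym: "(a, b) \<in> r \<Longrightarrow> (b, a) \<in> r \<Longrightarrow> a = b"
  and trans: "(a, b) \<in> r \<Longrightarrow> (b, c) \<in> r \<Longrightarrow> (a, c) \<in> r"
  and total: "a \<in> monomials V \<Longrightarrow> b \<in> monomials V \<Longrightarrow> (a, b) \<in> r \<or> (b, a) \<in> r"
  and add_mono: "(a, b) \<in> r \<Longrightarrow> c \<in> monomials V \<Longrightarrow> (a + c, b + c) \<in> r"
  and zero_least: "a \<in> monomials V \<Longrightarrow> (0, a) \<in> r"
proof -
  have r: "refl_on (monomials V) r" "Relation.antisym r" "Relation.trans r"
    "total_on (monomials V) r"
    using term_order
    unfolding term_order_def linear_order_on_def partial_order_on_def preorder_on_def by auto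
  show "a \<in> monomials V \<Longrightarrow> (a, a) \<in> r" using r(1) by (rule refl_onD)
  show "(a, b) \<in> r \<Longrightarrow> (b, a) \<in> r \<Longrightarrow> a = b" using r(2) by (rule antisymD)
  show "(a, b) \<in> r \<Longrightarrow> (b, c) \<in> r \<Longrightarrow> (a, c) \<in> r" using r(3) by (rule transD)
  show "a \<in> monomials V \<Longrightarrow> b \<in> monomials V \<Longrightarrow> (a, b) \<in> r \<or> (b, a) \<in> r"
    using r(1,4) unfolding refl_on_def total_on_def by metis
  show "(a, b) \<in> r \<Longrightarrow> c \<in> monomials V \<Longrightarrow> (a + c, b + c) \<in> r"
    using term_order unfolding term_order_def by simp
  show "a \<in> monomials V \<Longrightarrow> (0, a) \<in> r"
    using term_order unfolding term_order_def by simp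
qed

lemma le_add: "a \<in> monomials V \<Longrightarrow> c \<in> monomials V \<Longrightarrow> (a, c + a) \<in> r"
  using add_mono[OF zero_least] by force

lemma add_cancel:
  assumes "(a + c, b + c) \<in> r" "a \<in> monomials V" "b \<in> monomials V" "c \<in> monomials V"
  shows "(a, b) \<in> r"
proof (rule ccontr)
  assume "(a, b) \<notin> r"
  then have "(b, a) \<in> r" using total assms by blast
  then have "a + c = b + c" using antisym[OF assms(1)] add_mono assms by blast
  then show False using \<open>(a, b) \<notin> r\<close> refl assms by simp
qed

text \<open>
  In an infinite descending chain some term would divide a later one and hence be below it.
\<close>

lemma wf_strict: "wf (r - Id)"
proof (rule ccontr)
  assume "\<not> wf (r - Id)"
  then obtain s where s: "\<And>i. (s (Suc i), s i) \<in> r - Id"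
    unfolding wf_iff_no_infinite_down_chain by blast
  have desc: "(s j, s i) \<in> r - Id" if "i < j" for i j
    using that
  proof (induction j)
    case (Suc j)
    show ?case
    proof (cases "i = j")
      case False
      then have ji: "(s j, s i) \<in> r - Id" using Suc by simp
      have "s (Suc j) \<noteq> s i" using ji s[of j] antisym[of "s j" "s i"] by auto
      then show ?thesis using ji s[of j] trans[of "s (Suc j)" "s j" "s i"] by auto
    qed (use s in simp)
  qed simp
  have "r \<subseteq> monomials V \<times> monomials V"
    using term_order unfolding term_order_def linear_order_on_def partial_order_on_def
      preorder_on_def refl_on_def by blast
  then have mon: "s i \<in> monomials V" for i using s[of i] by auto
  obtain i j where ij: "i < j" "\<exists>c\<in>monomials V. s j = c + s i"
    using dickson[where s = s, OF finite_vars mon] by (elim exE conjE)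
  then have "(s i, s j) \<in> r" using le_add mon by auto
  then show False using desc[OF ij(1)] antisym[of "s i" "s j"] by auto
qed

lemma exists_greatest:
  assumes "finite A" "A \<noteq> {}" "A \<subseteq> monomials V"
  shows "\<exists>m\<in>A. \<forall>m'\<in>A. (m', m) \<in> r"
  using assms
proof (induction A rule: finite_ne_induct)
  case (singleton a)
  then show ?case using refl by simp
next
  case (insert a A)
  then obtain m where m: "m \<in> A" "\<forall>m'\<in>A. (m', m) \<in> r" by auto
  show ?case
  proof (cases "(a, m) \<in> r")
    case True
    then show ?thesis using m by blast
  next
    case False
    then have "(m, a) \<in> r" using total m insert.prems by blast
    then show ?thesis using m refl[of a] insert.prems trans[of _ m a] by auto
  qed
qed

lemma leading_monomial_eqI:
  assumes "m \<in> keys p" "\<And>m'. m' \<in> keys p \<Longrightarrow> (m', m) \<in> r"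
  shows "leading_monomial r p = m"
  unfolding leading_monomial_def using assms antisym by (intro the_equality) auto

lemma leading_monomial:
  assumes "p \<in> carrier (poly_ring V)" "p \<noteq> 0"
  shows leading_monomial_in_keys: "leading_monomial r p \<in> keys p"
    and leading_monomial_greatest: "m' \<in> keys p \<Longrightarrow> (m', leading_monomial r p) \<in> r"
    and leading_monomial_in_monomials: "leading_monomial r p \<in> monomials V"
proof -
  obtain m where m: "m \<in> keys p" "\<forall>m'\<in>keys p. (m', m) \<in> r"
    using exists_greatest[of "keys p"] assms unfolding mem_poly_ring by auto
  then have "leading_monomial r p = m" using leading_monomial_eqI by blast
  then show "leading_monomial r p \<in> keys p" "m' \<in> keys p \<Longrightarrow> (m', leading_monomial r p) \<in> r"
    "leading_monomial r p \<in> monomials V"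
    using m assms unfolding mem_poly_ring by auto
qed

lemma leading_monomial_single:
  assumes "c \<noteq> 0" "m \<in> monomials V"
  shows "leading_monomial r (single m c) = m"
  using assms refl by (intro leading_monomial_eqI) auto

lemma leading_monomial_mult:
  assumes f: "f \<in> carrier (poly_ring V)" "f \<noteq> 0" and g: "g \<in> carrier (poly_ring V)" "g \<noteq> 0"
  shows leading_monomial_mult_eq:
      "leading_monomial r (f * g) = leading_monomial r f + leading_monomial r g"
    and mult_nonzero: "f * g \<noteq> 0"
proof -
  let ?a = "leading_monomial r f" and ?b = "leading_monomial r g"
  note lf = leading_monomial[OF f] and lg = leading_monomial[OF g]
  have mf: "i \<in> monomials V" if "i \<in> keys f" for i using f that unfolding mem_poly_ring by blast
  have mg: "j \<in> monomials V" if "j \<in> keys g" for j using g that unfolding mem_poly_ring by blast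
  have unique: "i = ?a \<and> j = ?b" if "i \<in> keys f" "j \<in> keys g" "i + j = ?a + ?b" for i j
  proof -
    have 1: "(i + j, ?a + j) \<in> r" using add_mono lf(2) mg that by blast
    have 2: "(?a + j, ?a + ?b) \<in> r"
      using add_mono[OF lg(2)[OF that(2)] lf(3)] by (simp add: add.commute)
    then have "i + j = ?a + j" using antisym 1 that(3) by metis
    then show ?thesis using that(3) by simp
  qed
  have "f * g = (\<Sum>i\<in>keys f. single i (lookup f i)) * (\<Sum>j\<in>keys g. single j (lookup g j))"
    by (simp flip: poly_mapping_sum_single)
  also have "\<dots> = (\<Sum>(i, j)\<in>keys f \<times> keys g. single (i + j) (lookup f i * lookup g j))"
    by (simp add: sum_product mult_single sum.cartesian_product)
  finally have "lookup (f * g) (?a + ?b) =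
      (\<Sum>(i, j)\<in>keys f \<times> keys g. lookup f i * lookup g j when i + j = ?a + ?b)"
    by (simp add: lookup_sum lookup_single case_prod_unfold)
  also have "\<dots> = (\<Sum>(i, j)\<in>{(?a, ?b)}. lookup f i * lookup g j when i + j = ?a + ?b)"
  proof (rule sum.mono_neutral_right)
    show "{(?a, ?b)} \<subseteq> keys f \<times> keys g" using lf(1) lg(1) by simp
    show "\<forall>p\<in>keys f \<times> keys g - {(?a, ?b)}.
        (case p of (i, j) \<Rightarrow> lookup f i * lookup g j when i + j = ?a + ?b) = 0"
    proof
      fix p assume p: "p \<in> keys f \<times> keys g - {(?a, ?b)}"
      then have "fst p + snd p \<noteq> ?a + ?b" using unique[of "fst p" "snd p"] by auto
      then show "(case p of (i, j) \<Rightarrow> lookup f i * lookup g j when i + j = ?a + ?b) = 0"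
        by (simp add: case_prod_unfold)
    qed
  qed simp
  finally have coeff: "lookup (f * g) (?a + ?b) \<noteq> 0"
    using lf lg by (simp add: in_keys_iff)
  then show "f * g \<noteq> 0" by auto
  show "leading_monomial r (f * g) = ?a + ?b"
  proof (rule leading_monomial_eqI)
    show "?a + ?b \<in> keys (f * g)" using coeff by (simp add: in_keys_iff)
    fix m assume "m \<in> keys (f * g)"
    then obtain i j where ij: "i \<in> keys f" "j \<in> keys g" "m = i + j"
      using keys_mult[of f g] by blast
    have "(i + j, ?a + j) \<in> r" using add_mono lf(2) mg ij by blast
    moreover have "(?a + j, ?a + ?b) \<in> r"
      using add_mono[OF lg(2)[OF ij(2)] lf(3)] by (simp add: add.commute)
    ultimately show "(m, ?a + ?b) \<in> r" using trans ij by blast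
  qed
qed

text \<open>
  Differentiation lowers the leading monomial, because the characteristic is zero: the leading
  coefficient gets multiplied by a nonzero exponent.
\<close>

lemma leading_monomial_pd:
  assumes f: "f \<in> carrier (poly_ring V)" "f \<noteq> 0" and e: "e \<in> keys (leading_monomial r f)"
  shows "leading_monomial r (pd e f) = leading_monomial r f - single e 1"
    and "pd e f \<noteq> 0"
proof -
  let ?m = "leading_monomial r f"
  note lf = leading_monomial[OF f]
  have eV: "single e 1 \<in> monomials V"
    using e lf(3) by (auto simp: monomials_def)
  have m: "?m - single e 1 + single e 1 = ?m"
    using e by (intro monomial_le_imp_add[symmetric])
      (auto simp: lookup_single when_def in_keys_iff)
  have key: "?m - single e 1 \<in> keys (pd e f)"
    using lf(1) m by (simp add: in_keys_iff lookup_pd del: One_nat_def of_nat_add)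
  then show "pd e f \<noteq> 0" by auto
  show "leading_monomial r (pd e f) = ?m - single e 1"
  proof (rule leading_monomial_eqI[OF key])
    fix k assume k: "k \<in> keys (pd e f)"
    then have "k + single e 1 \<in> keys f" by (auto simp: in_keys_iff lookup_pd)
    then have "(k + single e 1, ?m - single e 1 + single e 1) \<in> r"
      using lf(2) m by simp
    moreover have "k \<in> monomials V"
      using k pd_closed[OF f(1), of e] unfolding mem_poly_ring by blast
    ultimately show "(k, ?m - single e 1) \<in> r"
      using add_cancel eV minus_in_monomials lf(3) by blast
  qed
qed

lemma leading_monomials_add:
  assumes J: "ideal J (poly_ring V)" and "m \<in> leading_monomials r J" "c \<in> monomials V"
  shows "c + m \<in> leading_monomials r J"
proof -
  obtain f where f: "f \<in> J" "f \<noteq> 0" "m = leading_monomial r f"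
    using assms(2) unfolding leading_monomials_def by blast
  have c: "single c 1 \<in> carrier (poly_ring V)" "single c (1::complex) \<noteq> 0"
    using assms(3) poly_ring_single by (auto simp flip: keys_eq_empty)
  have fV: "f \<in> carrier (poly_ring V)" using f poly_ring_ideal_subset[OF J] by blast
  have "single c 1 * f \<in> J" using poly_ring_ideal_mult_left[OF J f(1) c(1)] .
  moreover have "leading_monomial r (single c 1 * f) = c + m"
    using leading_monomial_mult_eq[OF c fV f(2)] leading_monomial_single assms(3) f(3) by simp
  ultimately show ?thesis
    using mult_nonzero[OF c fV f(2)] unfolding leading_monomials_def by force
qed

lemma leading_monomials_mono: "J \<subseteq> K \<Longrightarrow> leading_monomials r J \<subseteq> leading_monomials r K"
  unfolding leading_monomials_def by blast

text \<open>The division algorithm, for a divisor ideal in place of a list of divisors.\<close>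

lemma ideal_eq_of_leading_monomials:
  assumes J: "ideal J (poly_ring V)" and K: "ideal K (poly_ring V)" and "J \<subseteq> K"
    and LM: "leading_monomials r K \<subseteq> leading_monomials r J"
  shows "J = K"
proof -
  have "f \<in> J" if "f \<in> K" "f \<noteq> 0" "leading_monomial r f = m" for f m
    using that
  proof (induction m arbitrary: f rule: wf_induct_rule[OF wf_strict])
    case (1 m)
    have fV: "f \<in> carrier (poly_ring V)" using 1 poly_ring_ideal_subset[OF K] by blast
    obtain g where g: "g \<in> J" "g \<noteq> 0" "leading_monomial r g = m"
      using 1 LM unfolding leading_monomials_def by force
    have gV: "g \<in> carrier (poly_ring V)" using g poly_ring_ideal_subset[OF J] by blast
    note lf = leading_monomial[OF fV 1(3), unfolded 1(4)]
    note lg = leading_monomial[OF gV g(2), unfolded g(3)]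
    define c where "c = lookup f m / lookup g m"
    let ?h = "single 0 c * g"
    have hJ: "?h \<in> J" by (intro poly_ring_ideal_mult_left[OF J g(1)] poly_ring_single) simp
    have lookup_h: "lookup ?h k = c * lookup g k" for k
      by (simp add: mult_map_scale_conv_mult[symmetric] Poly_Mapping.map.rep_eq when_def)
    have lookup_m: "c * lookup g m = lookup f m"
      using lg(1) unfolding c_def by (simp add: in_keys_iff)
    have "f - ?h \<in> J"
    proof (cases "f - ?h = 0")
      case True
      then show ?thesis using poly_ring_ideal_zero[OF J] by simp
    next
      case False
      have K': "f - ?h \<in> K" using poly_ring_ideal_diff[OF K 1(2)] hJ \<open>J \<subseteq> K\<close> by blast
      then have "f - ?h \<in> carrier (poly_ring V)" using poly_ring_ideal_subset[OF K] by blast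
      note l = leading_monomial_in_keys[OF this False]
      have "leading_monomial r (f - ?h) \<in> keys f \<union> keys g" "leading_monomial r (f - ?h) \<noteq> m"
        using l lookup_m by (auto simp: in_keys_iff lookup_minus lookup_h)
      then have "(leading_monomial r (f - ?h), m) \<in> r - Id" using lf lg by auto
      then show ?thesis using 1(1) K' False by blast
    qed
    then show ?case using poly_ring_ideal_add[OF J _ hJ] by force
  qed
  then show ?thesis
    using \<open>J \<subseteq> K\<close> poly_ring_ideal_zero[OF J] by blast
qed

text \<open>
  Hilbert's basis theorem in the form of the ascending chain condition, after Gordan: along a
  strictly ascending chain of ideals new leading monomials would appear forever, none of them
  divisible by an earlier one.
\<close>

lemma wf_ideal_ascending: "wf (ideal_ascending (poly_ring V))"
proof (rule ccontr)
  assume "\<not> ?thesis"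
  then obtain J where J: "\<And>i. (J (Suc i), J i) \<in> ideal_ascending (poly_ring V)"
    unfolding wf_iff_no_infinite_down_chain by blast
  then have ideal: "ideal (J i) (poly_ring V)" and sub: "J i \<subset> J (Suc i)" for i
    unfolding ideal_ascending_def by blast+
  have "\<exists>m. m \<in> leading_monomials r (J (Suc i)) - leading_monomials r (J i)" for i
    using ideal_eq_of_leading_monomials[OF ideal[of i] ideal[of "Suc i"]] sub[of i] by blast
  then obtain m where m: "\<And>i. m i \<in> leading_monomials r (J (Suc i)) - leading_monomials r (J i)"
    by metis
  have mon: "m i \<in> monomials V" for i
  proof -
    obtain f where f: "f \<in> J (Suc i)" "f \<noteq> 0" "m i = leading_monomial r f"
      using m[of i] unfolding leading_monomials_def by auto
    then show ?thesis
      using poly_ring_ideal_subset[OF ideal[of "Suc i"]] leading_monomial_in_monomials[of f] by auto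
  qed
  obtain i j where ij: "i < j" "\<exists>c\<in>monomials V. m j = c + m i"
    using dickson[where s = m, OF finite_vars mon] by (elim exE conjE)
  have "J (Suc i) \<subseteq> J j"
    using ij(1) sub lift_Suc_mono_le[of J "Suc i" j] by (simp add: less_imp_le)
  then have "m i \<in> leading_monomials r (J j)"
    using m[of i] leading_monomials_mono by blast
  then show False
    using leading_monomials_add[OF ideal[of j]] ij(2) m[of j] by auto
qed

text \<open>
  The divisibility of leading monomials also forces \<open>G\<close> to generate \<open>D\<close>. This is how a differential
  description of an ideal will be matched with one by generators.
\<close>

lemma groebner_basisI:
  assumes D: "ideal D (poly_ring V)" and G: "finite G" "G \<subseteq> D"
    and LM: "\<And>f. f \<in> D \<Longrightarrow> f \<noteq> 0 \<Longrightarrow>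
      \<exists>g\<in>G. g \<noteq> 0 \<and> (\<exists>c\<in>monomials V. leading_monomial r f = c + leading_monomial r g)"
  shows "groebner_basis V r D G" and "genideal (poly_ring V) G = D"
proof -
  have DV: "D \<subseteq> carrier (poly_ring V)" by (rule poly_ring_ideal_subset[OF D])
  have monomial_carrier: "{single (leading_monomial r f) 1 |f. f \<in> F \<and> f \<noteq> 0} \<subseteq> carrier (poly_ring V)"
    if "F \<subseteq> D" for F
    using that DV leading_monomial_in_monomials by (auto intro!: poly_ring_single)
  have ideal_initial: "ideal (initial_ideal V r F) (poly_ring V)" if "F \<subseteq> D" for F
    unfolding initial_ideal_def by (rule poly_ring.genideal_ideal[OF monomial_carrier[OF that]])
  have mem_initial: "single (leading_monomial r f) (1::complex) \<in> initial_ideal V r F"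
    if "F \<subseteq> D" "f \<in> F" "f \<noteq> 0" for f F
    unfolding initial_ideal_def
    using poly_ring.genideal_self[OF monomial_carrier[OF that(1)]] that by blast
  have "initial_ideal V r G \<subseteq> initial_ideal V r D"
    unfolding initial_ideal_def[of _ _ G]
    using G(2) mem_initial[of D] ideal_initial[of D] by (intro poly_ring.genideal_minimal) auto
  moreover have "initial_ideal V r D \<subseteq> initial_ideal V r G"
    unfolding initial_ideal_def[of _ _ D]
  proof (intro poly_ring.genideal_minimal ideal_initial G(2) subsetI)
    fix x :: "'v mpoly" assume "x \<in> {single (leading_monomial r f) 1 |f. f \<in> D \<and> f \<noteq> 0}"
    then obtain f where f: "f \<in> D" "f \<noteq> 0" "x = single (leading_monomial r f) 1" by blast
    then obtain g c where g: "g \<in> G" "g \<noteq> 0" "c \<in> monomials V"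
      "leading_monomial r f = c + leading_monomial r g" using LM by blast
    have "x = single c 1 * single (leading_monomial r g) 1"
      using f g by (simp add: mult_single)
    then show "x \<in> initial_ideal V r G"
      using poly_ring_ideal_mult_left[OF ideal_initial[OF G(2)] mem_initial[OF G(2) g(1,2)]]
        poly_ring_single[OF g(3)] by simp
  qed
  ultimately show "groebner_basis V r D G"
    using G unfolding groebner_basis_def by blast
  have GV: "G \<subseteq> carrier (poly_ring V)" using G(2) DV by blast
  note ideal_G = poly_ring.genideal_ideal[OF GV]
  show "genideal (poly_ring V) G = D"
  proof (rule ideal_eq_of_leading_monomials[OF ideal_G D])
    show "genideal (poly_ring V) G \<subseteq> D" by (rule poly_ring.genideal_minimal[OF D G(2)])
    show "leading_monomials r D \<subseteq> leading_monomials r (genideal (poly_ring V) G)"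
    proof
      fix m assume "m \<in> leading_monomials r D"
      then obtain f where f: "f \<in> D" "f \<noteq> 0" "m = leading_monomial r f"
        unfolding leading_monomials_def by blast
      then obtain g c where g: "g \<in> G" "g \<noteq> 0" "c \<in> monomials V" "m = c + leading_monomial r g"
        using LM by blast
      have "leading_monomial r g \<in> leading_monomials r (genideal (poly_ring V) G)"
        using g poly_ring.genideal_self[OF GV] unfolding leading_monomials_def by blast
      then show "m \<in> leading_monomials r (genideal (poly_ring V) G)"
        using leading_monomials_add[OF ideal_G] g by blast
    qed
  qed
qed

end

section \<open>The second symbolic power of an edge ideal\<close>

text \<open>
  The second symbolic power of the edge ideal of a graph is generated by the products of two edges
  and by the triangles. Membership of \<open>m\<close> is expressed by differentiation: \<open>m\<close> contains an edge, and
  still does after any one of its variables is divided out. For an edge \<open>uv\<close> of \<open>m\<close>, an edge that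
  remains after removing \<open>u\<close> is disjoint from \<open>uv\<close> or ends in \<open>v\<close>, and likewise with \<open>u\<close> and \<open>v\<close>
  exchanged. In the last case the edges \<open>av\<close> and \<open>cu\<close> form a product of two edges or, for \<open>a = c\<close>, a
  triangle with \<open>uv\<close>.
\<close>

lemma edge_ideal_symbolic_square:
  fixes m :: "'v monomial"
  assumes sym: "\<And>a b. E a b \<Longrightarrow> E b a" and irrefl: "\<And>a. \<not> E a a"
    and edge: "\<exists>a b. E a b \<and> a \<in> keys m \<and> b \<in> keys m"
    and derivative: "\<And>v. v \<in> keys m \<Longrightarrow>
      \<exists>a b. E a b \<and> a \<in> keys (m - single v 1) \<and> b \<in> keys (m - single v 1)"
  shows "(\<exists>a b c d k. E a b \<and> E c d \<and>
      m = k + ((single a 1 + single b 1) + (single c 1 + single d 1))) \<or>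
    (\<exists>a b c k. E a b \<and> E b c \<and> E a c \<and> m = k + (single a 1 + single b 1 + single c 1))"
proof -
  have divides: "\<exists>k. m = k + s" if "\<And>x. lookup s x \<le> lookup m x" for s
    using monomial_le_imp_add[of s m] that by blast
  obtain u v where uv: "E u v" "u \<in> keys m" "v \<in> keys m" using edge by blast
  then have uv': "u \<noteq> v" "lookup m u \<noteq> 0" "lookup m v \<noteq> 0" using irrefl by (auto simp: in_keys_iff)
  have next_edge: "(\<exists>a b. E a b \<and> (\<exists>k. m = k + ((single w 1 + single w' 1) + (single a 1 + single b 1))))
      \<or> (\<exists>a. E a w' \<and> lookup m a \<noteq> 0 \<and> (a = w \<longrightarrow> lookup m a \<ge> 2))"
    if w: "E w w'" "lookup m w \<noteq> 0" "lookup m w' \<noteq> 0" for w w'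
  proof -
    obtain a b where ab: "E a b" "a \<in> keys (m - single w 1)" "b \<in> keys (m - single w 1)"
      using derivative[of w] w by (auto simp: in_keys_iff)
    then have l: "lookup m a \<noteq> 0" "a = w \<longrightarrow> lookup m a \<ge> 2"
      "lookup m b \<noteq> 0" "b = w \<longrightarrow> lookup m b \<ge> 2"
      by (auto simp: in_keys_iff lookup_minus lookup_single when_def)
    show ?thesis
    proof (cases "w' \<in> {a, b}")
      case True
      then show ?thesis using ab l sym by blast
    next
      case False
      have "a \<noteq> b" "w \<noteq> w'" using ab w irrefl by auto
      then have "\<exists>k. m = k + ((single w 1 + single w' 1) + (single a 1 + single b 1))"
        using False l w by (intro divides) (auto simp: lookup_add lookup_single when_def)
      then show ?thesis using ab by blast
    qed
  qed
  show ?thesis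
  proof (cases "\<exists>a b c d k. E a b \<and> E c d \<and>
      m = k + ((single a 1 + single b 1) + (single c 1 + single d 1))")
    case False
    then obtain a where a: "E a v" "lookup m a \<noteq> 0" "a = u \<longrightarrow> lookup m a \<ge> 2"
      using next_edge[of u v] uv uv' by blast
    obtain c where c: "E c u" "lookup m c \<noteq> 0" "c = v \<longrightarrow> lookup m c \<ge> 2"
      using next_edge[of v u] uv uv' sym False by blast
    have ne: "a \<noteq> v" "c \<noteq> u" using a c irrefl by auto
    have "a = c"
    proof (rule ccontr)
      assume "a \<noteq> c"
      then have "\<exists>k. m = k + ((single a 1 + single v 1) + (single c 1 + single u 1))"
        using a c ne uv' by (intro divides) (auto simp: lookup_add lookup_single when_def)
      then show False using False a c by blast
    qed
    then have "\<exists>k. m = k + (single u 1 + single v 1 + single a 1)"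
      using a ne uv' by (intro divides) (auto simp: lookup_add lookup_single when_def)
    then show ?thesis using a c uv \<open>a = c\<close> sym by blast
  qed blast
qed

section \<open>Circular term orders and thrackles\<close>

lemma finite_edges: "finite (edges n)"
  by (rule finite_subset[of _ "{1..n} \<times> {1..n}"]) (auto simp: edges_def)

lemma edges_iff: "e \<in> edges n \<longleftrightarrow> 1 \<le> fst e \<and> fst e < snd e \<and> snd e \<le> n"
  by (cases e) (simp add: edges_def)

lemma circular_distance_edge:
  assumes "e \<in> edges n"
  shows "circular_distance n e = min (snd e - fst e) (n - (snd e - fst e))"
    and "circular_distance n e \<in> {1..n div 2}"
proof -
  obtain a b where e: "e = (a, b)" by fastforce
  have ab: "1 \<le> a" "a < b" "b \<le> n" using assms e by (auto simp: edges_iff)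
  show "circular_distance n e = min (snd e - fst e) (n - (snd e - fst e))"
    using ab e unfolding circular_distance_def by (simp add: min_def nat_diff_distrib of_nat_diff)
  then show "circular_distance n e \<in> {1..n div 2}"
    using ab e by auto
qed

lemma lookup_restrict_monomial: "lookup (restrict_monomial B m) v = (if v \<in> B then lookup m v else 0)"
  unfolding restrict_monomial_def by (auto simp: lookup_mapp in_keys_iff when_def)

lemma restrict_monomial_in_monomials: "restrict_monomial B m \<in> monomials B"
  unfolding monomials_def by (auto simp: in_keys_iff lookup_restrict_monomial split: if_splits)

lemma restrict_monomial_add:
  "restrict_monomial B (a + b) = restrict_monomial B a + restrict_monomial B b"
  by (rule poly_mapping_eqI) (simp add: lookup_restrict_monomial lookup_add)

lemma lookup_outside_eq_0:
  assumes "m \<in> monomials V" "v \<notin> V"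
  shows "lookup m v = 0"
proof -
  have "v \<notin> keys m" using assms unfolding monomials_def by blast
  then show ?thesis by (simp add: in_keys_iff)
qed

lemma monomials_eq_of_classes:
  assumes "a \<in> monomials (edges n)" "b \<in> monomials (edges n)"
    and "\<And>d. d \<in> {1..n div 2} \<Longrightarrow>
      restrict_monomial (edge_class n d) a = restrict_monomial (edge_class n d) b"
  shows "a = b"
proof (rule poly_mapping_eqI)
  fix e
  show "lookup a e = lookup b e"
  proof (cases "e \<in> edges n")
    case True
    let ?d = "circular_distance n e"
    have "lookup (restrict_monomial (edge_class n ?d) a) e = lookup (restrict_monomial (edge_class n ?d) b) e"
      using assms(3) circular_distance_edge(2)[OF True] by simp
    then show ?thesis using True by (simp add: lookup_restrict_monomial edge_class_def)
  next
    case False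
    then show ?thesis using assms(1,2) lookup_outside_eq_0 by metis
  qed
qed

lemma first_differing_class:
  assumes "a \<in> monomials (edges n)" "b \<in> monomials (edges n)" "a \<noteq> b"
  obtains d where "d \<in> {1..n div 2}"
    "\<And>e. e \<in> {1..<d} \<Longrightarrow>
      restrict_monomial (edge_class n e) a = restrict_monomial (edge_class n e) b"
    "restrict_monomial (edge_class n d) a \<noteq> restrict_monomial (edge_class n d) b"
proof -
  let ?P = "\<lambda>d. d \<in> {1..n div 2} \<and>
    restrict_monomial (edge_class n d) a \<noteq> restrict_monomial (edge_class n d) b"
  define d where "d = (LEAST d. ?P d)"
  have "\<exists>d. ?P d" using monomials_eq_of_classes[OF assms(1,2)] assms(3) by blast
  then have d: "?P d" unfolding d_def by (rule LeastI_ex)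
  have "restrict_monomial (edge_class n e) a = restrict_monomial (edge_class n e) b"
    if "e \<in> {1..<d}" for e
  proof -
    have "\<not> ?P e" using not_less_Least[of e ?P] that unfolding d_def by simp
    then show ?thesis using that d by auto
  qed
  then show thesis using that[of d] d by simp
qed

text \<open>
  The parameter \<open>s\<close> collects the term orders on the blocks, which a circular term order merely
  asserts to exist.
\<close>

locale circular_order =
  fixes n :: nat and s :: "nat \<Rightarrow> (nat \<times> nat) monomial rel" and r :: "(nat \<times> nat) monomial rel"
  assumes class_order: "\<And>d. d \<in> {1..n div 2} \<Longrightarrow> term_order (edge_class n d) (s d)"
    and r_eq: "r = {(a, b). a \<in> monomials (edges n) \<and> b \<in> monomials (edges n) \<and>
         (a = b \<or>
          (\<exists>d\<in>{1..n div 2}.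
             (\<forall>e\<in>{1..<d}.
                restrict_monomial (edge_class n e) a = restrict_monomial (edge_class n e) b) \<and>
             restrict_monomial (edge_class n d) a \<noteq> restrict_monomial (edge_class n d) b \<and>
             (restrict_monomial (edge_class n d) a, restrict_monomial (edge_class n d) b)
               \<in> s d))}"
begin

abbreviation "block \<equiv> edge_class n"

definition first_diff :: "(nat \<times> nat) monomial \<Rightarrow> (nat \<times> nat) monomial \<Rightarrow> nat \<Rightarrow> bool" where
  "first_diff a b d \<longleftrightarrow> d \<in> {1..n div 2} \<and>
     (\<forall>e\<in>{1..<d}. restrict_monomial (block e) a = restrict_monomial (block e) b) \<and>
     restrict_monomial (block d) a \<noteq> restrict_monomial (block d) b"

lemma mem_r: "(a, b) \<in> r \<longleftrightarrow> a \<in> monomials (edges n) \<and> b \<in> monomials (edges n) \<and>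
    (a = b \<or> (\<exists>d. first_diff a b d \<and> (restrict_monomial (block d) a, restrict_monomial (block d) b) \<in> s d))"
  unfolding r_eq first_diff_def by blast

lemma first_diff_exists:
  "a \<in> monomials (edges n) \<Longrightarrow> b \<in> monomials (edges n) \<Longrightarrow> a \<noteq> b \<Longrightarrow> \<exists>d. first_diff a b d"
  unfolding first_diff_def by (metis first_differing_class)

lemma first_diff_unique: "first_diff a b d \<Longrightarrow> first_diff a b d' \<Longrightarrow> d = d'"
  unfolding first_diff_def by (cases d d' rule: linorder_cases) auto

lemma first_diff_sym: "first_diff a b d \<Longrightarrow> first_diff b a d"
  unfolding first_diff_def by auto

lemma class_monomial_order: "d \<in> {1..n div 2} \<Longrightarrow> monomial_order (block d) (s d)"
  using class_order finite_edges[of n]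
  by (simp add: monomial_order_def edge_class_def)

lemma order_trans:
  assumes "(a, b) \<in> r" "(b, c) \<in> r"
  shows "(a, c) \<in> r"
proof (cases "a = b \<or> b = c")
  case False
  let ?m = "\<lambda>d. restrict_monomial (block d)"
  obtain d where d: "first_diff a b d" "(?m d a, ?m d b) \<in> s d" using assms(1) False mem_r by blast
  obtain d' where d': "first_diff b c d'" "(?m d' b, ?m d' c) \<in> s d'" using assms(2) False mem_r by blast
  have mon: "a \<in> monomials (edges n)" "c \<in> monomials (edges n)" using assms mem_r by blast+
  consider "d < d'" | "d' < d" | "d = d'" by linarith
  then have "first_diff a c (min d d') \<and> (?m (min d d') a, ?m (min d d') c) \<in> s (min d d')"
  proof cases
    case 1
    then show ?thesis using d d' unfolding first_diff_def by (auto simp: min_def)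
  next
    case 2
    then show ?thesis using d d' unfolding first_diff_def by (auto simp: min_def)
  next
    case 3
    interpret D: monomial_order "block d" "s d"
      using d by (intro class_monomial_order) (simp add: first_diff_def)
    have "(?m d a, ?m d c) \<in> s d" using d d' 3 D.trans by blast
    moreover have "?m d a \<noteq> ?m d c"
      using d d' 3 D.antisym[of "?m d a" "?m d b"] unfolding first_diff_def by auto
    ultimately show ?thesis using d d' 3 unfolding first_diff_def by auto
  qed
  then show ?thesis using mon mem_r by blast
qed (use assms in auto)

lemma term_order_edges: "term_order (edges n) r"
proof -
  let ?m = "\<lambda>d. restrict_monomial (block d)"
  have "refl_on (monomials (edges n)) r" "r \<subseteq> monomials (edges n) \<times> monomials (edges n)"
    unfolding refl_on_def using mem_r by auto
  moreover have "Relation.trans r" using order_trans by (intro transI)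
  moreover have "Relation.antisym r"
  proof (rule antisymI, rule ccontr)
    fix a b assume ab: "(a, b) \<in> r" "(b, a) \<in> r" "a \<noteq> b"
    then obtain d where d: "first_diff a b d" "(?m d a, ?m d b) \<in> s d" using mem_r by blast
    obtain d' where d': "first_diff b a d'" "(?m d' b, ?m d' a) \<in> s d'"
      using ab mem_r[of b a] by auto
    have "d' = d" using d d' first_diff_unique first_diff_sym by blast
    interpret D: monomial_order "block d" "s d"
      using d by (intro class_monomial_order) (simp add: first_diff_def)
    show False
      using D.antisym[of "?m d a" "?m d b"] d d' \<open>d' = d\<close> unfolding first_diff_def by auto
  qed
  moreover have "total_on (monomials (edges n)) r"
    unfolding total_on_def
  proof (intro ballI impI)
    fix a b assume ab: "a \<in> monomials (edges n)" "b \<in> monomials (edges n)" "a \<noteq> b"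
    then obtain d where d: "first_diff a b d" using first_diff_exists by blast
    interpret D: monomial_order "block d" "s d"
      using d by (intro class_monomial_order) (simp add: first_diff_def)
    have "(?m d a, ?m d b) \<in> s d \<or> (?m d b, ?m d a) \<in> s d"
      by (intro D.total restrict_monomial_in_monomials)
    then show "(a, b) \<in> r \<or> (b, a) \<in> r"
      using ab d first_diff_sym[OF d] mem_r by blast
  qed
  ultimately have "linear_order_on (monomials (edges n)) r"
    unfolding linear_order_on_def partial_order_on_def preorder_on_def by blast
  moreover have "(0, a) \<in> r" if a: "a \<in> monomials (edges n)" for a
  proof (cases "a = 0")
    case False
    then obtain d where d: "first_diff 0 a d" using first_diff_exists[of 0 a] a by auto
    interpret D: monomial_order "block d" "s d"
      using d by (intro class_monomial_order) (simp add: first_diff_def)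
    have "?m d 0 = 0" by (rule poly_mapping_eqI) (simp add: lookup_restrict_monomial)
    then have "(?m d 0, ?m d a) \<in> s d" using D.zero_least[OF restrict_monomial_in_monomials[of "block d" a]] by simp
    then show ?thesis using d a mem_r by auto
  qed (use a mem_r in auto)
  moreover have "(a + c, b + c) \<in> r" if ab: "(a, b) \<in> r" and c: "c \<in> monomials (edges n)" for a b c
  proof (cases "a = b")
    case True
    then show ?thesis using ab c mem_r add_in_monomials by blast
  next
    case False
    then obtain d where d: "first_diff a b d" "(?m d a, ?m d b) \<in> s d" using ab mem_r by blast
    interpret D: monomial_order "block d" "s d"
      using d by (intro class_monomial_order) (simp add: first_diff_def)
    have "first_diff (a + c) (b + c) d"
      using d(1) unfolding first_diff_def by (simp add: restrict_monomial_add)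
    moreover have "(?m d (a + c), ?m d (b + c)) \<in> s d"
      using D.add_mono[OF d(2) restrict_monomial_in_monomials[of "block d" c]]
      by (simp add: restrict_monomial_add)
    moreover have "a + c \<in> monomials (edges n)" "b + c \<in> monomials (edges n)"
      using ab c mem_r add_in_monomials by blast+
    ultimately show ?thesis using mem_r by blast
  qed
  ultimately show ?thesis unfolding term_order_def by blast
qed

sublocale monomial_order "edges n" r
  by (rule monomial_order.intro[OF finite_edges term_order_edges])

text \<open>
  At the first class where the two monomials differ, the hypothesis makes the block of \<open>a\<close> divide
  the block of \<open>b\<close>, and divisibility implies the inequality in every term order on that block.
\<close>

lemma le_of_first_class_le:
  assumes mon: "a \<in> monomials (edges n)" "b \<in> monomials (edges n)"
    and le: "\<And>e. e \<in> edges n \<Longrightarrow>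
      (\<And>f. f \<in> edges n \<Longrightarrow> circular_distance n f < circular_distance n e \<Longrightarrow> lookup a f = lookup b f) \<Longrightarrow>
      lookup a e \<le> lookup b e"
  shows "(a, b) \<in> r"
proof (cases "a = b")
  case False
  let ?m = "\<lambda>d. restrict_monomial (block d)"
  obtain d where d: "first_diff a b d" using first_diff_exists mon False by blast
  interpret D: monomial_order "block d" "s d"
    using d by (intro class_monomial_order) (simp add: first_diff_def)
  have "lookup (?m d a) e \<le> lookup (?m d b) e" for e
  proof (cases "e \<in> block d")
    case True
    have "lookup a f = lookup b f"
      if f: "f \<in> edges n" "circular_distance n f < circular_distance n e" for f
    proof -
      let ?d = "circular_distance n f"
      have "?d \<in> {1..<d}"
        using f True circular_distance_edge(2)[OF f(1)] by (simp add: edge_class_def)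
      then have "?m ?d a = ?m ?d b" using d unfolding first_diff_def by blast
      then have "lookup (?m ?d a) f = lookup (?m ?d b) f" by simp
      then show ?thesis using f by (simp add: lookup_restrict_monomial edge_class_def)
    qed
    then have "lookup a e \<le> lookup b e" using le True by (simp add: edge_class_def)
    then show ?thesis by (simp add: lookup_restrict_monomial)
  qed (simp add: lookup_restrict_monomial)
  then have "?m d b = (?m d b - ?m d a) + ?m d a" by (rule monomial_le_imp_add)
  then have "(?m d a, ?m d b) \<in> s d"
    using D.le_add[of "?m d a" "?m d b - ?m d a"] restrict_monomial_in_monomials minus_in_monomials
    by metis
  then show ?thesis using mon d mem_r by blast
qed (use mon refl in blast)

end

text \<open>
  For edges with increasing endpoints this says that the chords are disjoint in the closed disk:
  as intervals they are disjoint without common endpoint, or one lies strictly inside the other.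
\<close>

definition separated :: "nat \<times> nat \<Rightarrow> nat \<times> nat \<Rightarrow> bool" where
  "separated e f \<longleftrightarrow> snd e < fst f \<or> snd f < fst e \<or>
     fst e < fst f \<and> snd f < snd e \<or> fst f < fst e \<and> snd e < snd f"

lemma separated_sym: "separated e f \<longleftrightarrow> separated f e"
  unfolding separated_def by auto

text \<open>
  The shorter of the two arcs cut off by an edge, endpoints included. All other edges inside it
  have smaller circular distance; for a diameter either arc has this property.
\<close>

definition arc :: "nat \<Rightarrow> nat \<times> nat \<Rightarrow> nat set" where
  "arc n e = (if 2 * (snd e - fst e) \<le> n then {fst e..snd e} else {1..fst e} \<union> {snd e..n})"

lemma arc_subset: "e \<in> edges n \<Longrightarrow> arc n e \<subseteq> {1..n}"
  unfolding arc_def edges_iff by auto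

lemma arc_endpoints: "e \<in> edges n \<Longrightarrow> fst e \<in> arc n e \<and> snd e \<in> arc n e"
  unfolding arc_def edges_iff by auto

lemma arc_circular_distance:
  assumes e: "e \<in> edges n" and f: "f \<in> edges n" and "fst f \<in> arc n e" "snd f \<in> arc n e" "f \<noteq> e"
  shows "circular_distance n f < circular_distance n e"
proof -
  have "fst f \<noteq> fst e \<or> snd f \<noteq> snd e" using assms(5) prod_eqI by blast
  then show ?thesis
    using assms unfolding circular_distance_edge(1)[OF e] circular_distance_edge(1)[OF f] arc_def edges_iff
    by (auto simp: min_def split: if_splits)
qed

lemma arc_separated:
  assumes "e \<in> edges n" "f \<in> edges n" "g \<in> edges n"
    and "fst f \<in> arc n e" "snd f \<in> arc n e" "fst g \<notin> arc n e" "snd g \<notin> arc n e"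
  shows "separated f g"
  using assms unfolding arc_def edges_iff separated_def by (auto split: if_splits)

definition vertex_degree :: "(nat \<times> nat) monomial \<Rightarrow> nat monomial" where
  "vertex_degree m = (\<Sum>e\<in>keys m. single (fst e) (lookup m e) + single (snd e) (lookup m e))"

definition inner_edges :: "nat set \<Rightarrow> (nat \<times> nat) monomial \<Rightarrow> nat" where
  "inner_edges S m = (\<Sum>e\<in>keys m. if fst e \<in> S \<and> snd e \<in> S then lookup m e else 0)"

lemma sum_vertex_degree:
  assumes "finite S"
  shows "(\<Sum>i\<in>S. lookup (vertex_degree m) i) =
    (\<Sum>e\<in>keys m. (if fst e \<in> S then lookup m e else 0) + (if snd e \<in> S then lookup m e else 0))"
proof -
  have "(\<Sum>i\<in>S. lookup (vertex_degree m) i) = (\<Sum>e\<in>keys m. \<Sum>i\<in>S.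
      (if fst e = i then lookup m e else 0) + (if snd e = i then lookup m e else 0))"
    unfolding vertex_degree_def
    by (subst sum.swap) (simp add: lookup_sum lookup_add lookup_single when_def)
  also have "\<dots> = (\<Sum>e\<in>keys m. (if fst e \<in> S then lookup m e else 0) + (if snd e \<in> S then lookup m e else 0))"
    using assms by (simp add: sum.distrib)
  finally show ?thesis .
qed

text \<open>Every edge leaving \<open>S\<close> contributes once to both sides.\<close>

lemma vertex_degree_balance:
  assumes m: "m \<in> monomials (edges n)" and S: "S \<subseteq> {1..n}"
  shows "(\<Sum>i\<in>S. lookup (vertex_degree m) i) + 2 * inner_edges ({1..n} - S) m =
    (\<Sum>i\<in>{1..n} - S. lookup (vertex_degree m) i) + 2 * inner_edges S m"
proof -
  have "finite S" using S finite_subset by blast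
  have "fst e \<in> {1..n} \<and> snd e \<in> {1..n}" if "e \<in> keys m" for e
  proof -
    have "e \<in> edges n" using m that by (auto simp: monomials_def)
    then show ?thesis by (auto simp: edges_iff)
  qed
  then show ?thesis
    using \<open>finite S\<close>
    by (auto simp: sum_vertex_degree inner_edges_def sum_distrib_left simp flip: sum.distrib
        intro!: sum.cong)
qed

text \<open>
  By the balance equation the numbers of edges inside an arc and inside its complement have a
  difference that depends on the vertex degrees only. In a thrackle one of the two numbers is zero,
  since an edge inside the arc and one inside the complement are separated. So the number of
  edges inside the arc is as small as the degrees permit.
\<close>

lemma inner_edges_thrackle_le:
  assumes m: "m \<in> monomials (edges n)" and m': "m' \<in> monomials (edges n)"
    and deg: "vertex_degree m = vertex_degree m'"
    and thrackle: "\<And>e f. e \<in> keys m \<Longrightarrow> f \<in> keys m \<Longrightarrow> \<not> separated e f" and e: "e \<in> edges n"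
  shows "inner_edges (arc n e) m \<le> inner_edges (arc n e) m'"
proof -
  let ?S = "arc n e" and ?T = "{1..n} - arc n e"
  have mE: "f \<in> edges n" if "f \<in> keys m" for f using that m by (auto simp: monomials_def)
  note S = arc_subset[OF e]
  note bal = vertex_degree_balance[OF m S] vertex_degree_balance[OF m' S]
  have "inner_edges ?S m = 0 \<or> inner_edges ?T m = 0"
  proof (rule ccontr)
    assume "\<not> ?thesis"
    then obtain f g where "f \<in> keys m" "fst f \<in> ?S" "snd f \<in> ?S"
      "g \<in> keys m" "fst g \<in> ?T" "snd g \<in> ?T"
      unfolding inner_edges_def by (auto split: if_splits)
    then show False using thrackle arc_separated[OF e, of f g] mE by auto
  qed
  then show ?thesis using bal deg by auto
qed

lemma lookup_eq_inner_edges_minus: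
  assumes m: "m \<in> monomials (edges n)" and e: "e \<in> edges n"
  shows "inner_edges (arc n e) m = lookup m e +
    (\<Sum>f\<in>edges n - {e}. if fst f \<in> arc n e \<and> snd f \<in> arc n e then lookup m f else 0)"
proof -
  have "inner_edges (arc n e) m = (\<Sum>f\<in>edges n. if fst f \<in> arc n e \<and> snd f \<in> arc n e then lookup m f else 0)"
    unfolding inner_edges_def
    by (rule sum.mono_neutral_left) (use m finite_edges in \<open>auto simp: monomials_def in_keys_iff\<close>)
  then show ?thesis
    using e arc_endpoints[OF e] by (simp add: sum.remove[OF finite_edges e])
qed

text \<open>
  If the multiplicities of all edges of smaller circular distance agree, then the numbers of edges
  inside the arc of \<open>e\<close> differ exactly by the multiplicities of \<open>e\<close>.
\<close>

theorem (in circular_order) thrackle_least_in_fibre: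
  assumes m: "m \<in> monomials (edges n)" and m': "m' \<in> monomials (edges n)"
    and deg: "vertex_degree m = vertex_degree m'"
    and thrackle: "\<And>e f. e \<in> keys m \<Longrightarrow> f \<in> keys m \<Longrightarrow> \<not> separated e f"
  shows "(m, m') \<in> r"
proof (rule le_of_first_class_le[OF m m'])
  fix e assume e: "e \<in> edges n"
    and eq: "\<And>f. f \<in> edges n \<Longrightarrow> circular_distance n f < circular_distance n e \<Longrightarrow> lookup m f = lookup m' f"
  have "(\<Sum>f\<in>edges n - {e}. if fst f \<in> arc n e \<and> snd f \<in> arc n e then lookup m f else 0) =
      (\<Sum>f\<in>edges n - {e}. if fst f \<in> arc n e \<and> snd f \<in> arc n e then lookup m' f else 0)"
    using eq arc_circular_distance[OF e] by (intro sum.cong) auto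
  then show "lookup m e \<le> lookup m' e"
    using inner_edges_thrackle_le[OF m m' deg thrackle e]
      lookup_eq_inner_edges_minus[OF m e] lookup_eq_inner_edges_minus[OF m' e] by simp
qed

section \<open>The toric ideal and its initial monomials\<close>

abbreviation param :: "nat \<times> nat \<Rightarrow> nat mpoly" where
  "param \<equiv> \<lambda>(i, j). var i * var j"

lemma param_closed: "e \<in> edges n \<Longrightarrow> param e \<in> carrier (poly_ring {1..n})"
  by (auto simp: edges_iff case_prod_unfold intro!: poly_ring_closed)

lemma mem_hypersimplex_ideal:
  "f \<in> hypersimplex_ideal n \<longleftrightarrow> f \<in> carrier (poly_ring (edges n)) \<and> subst param f = 0"
  unfolding hypersimplex_ideal_def by (rule mem_kernel_subst)

lemma ideal_hypersimplex_ideal: "ideal (hypersimplex_ideal n) (poly_ring (edges n))"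
  unfolding hypersimplex_ideal_def
  by (intro ring_hom_ring.kernel_is_ideal ring_hom_subst param_closed)

lemma hypersimplex_ideal_prime:
  assumes "f \<in> carrier (poly_ring (edges n))" "g \<in> carrier (poly_ring (edges n))"
    "f * g \<in> hypersimplex_ideal n"
  shows "f \<in> hypersimplex_ideal n \<or> g \<in> hypersimplex_ideal n"
  using assms by (simp add: mem_hypersimplex_ideal)

lemma primeideal_hypersimplex_ideal: "primeideal (hypersimplex_ideal n) (poly_ring (edges n))"
proof (rule primeidealI[OF ideal_hypersimplex_ideal cring_poly_ring])
  have "1 \<notin> hypersimplex_ideal n" by (simp add: mem_hypersimplex_ideal)
  then show "carrier (poly_ring (edges n)) \<noteq> hypersimplex_ideal n" by auto
qed (use hypersimplex_ideal_prime in simp)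

lemma monomial_value_param: "monomial_value param m = single (vertex_degree m) 1"
  unfolding monomial_value_def vertex_degree_def prod_single[symmetric]
  by (simp add: case_prod_unfold power_mult_distrib var_power mult_single)

text \<open>
  The coefficients of a relation sum to zero over each fibre of the monomial map, so no term of it
  is alone in its fibre.
\<close>

lemma hypersimplex_ideal_fibre:
  assumes f: "f \<in> hypersimplex_ideal n" and m: "m \<in> keys f"
  obtains m' where "m' \<in> keys f" "m' \<noteq> m" "vertex_degree m' = vertex_degree m"
proof -
  have "subst param f = (\<Sum>m'\<in>keys f. single (vertex_degree m') (lookup f m'))"
    unfolding subst_superset[of "keys f" f, OF finite_keys order_refl] monomial_value_param
    by (simp add: mult_single)
  then have "(\<Sum>m'\<in>keys f. single (vertex_degree m') (lookup f m')) = 0"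
    using f by (simp add: mem_hypersimplex_ideal)
  from arg_cong[OF this, of "\<lambda>p. lookup p (vertex_degree m)"]
  have "0 = (\<Sum>m'\<in>keys f. lookup f m' when vertex_degree m' = vertex_degree m)"
    by (simp add: lookup_sum lookup_single)
  also have "\<dots> = lookup f m +
      (\<Sum>m'\<in>keys f - {m}. lookup f m' when vertex_degree m' = vertex_degree m)"
    using m by (simp add: sum.remove)
  finally have "(\<Sum>m'\<in>keys f - {m}. lookup f m' when vertex_degree m' = vertex_degree m) \<noteq> 0"
    using m by (auto simp: in_keys_iff)
  then obtain m' where "m' \<in> keys f - {m}" "(lookup f m' when vertex_degree m' = vertex_degree m) \<noteq> 0"
    by (rule sum.not_neutral_contains_not_neutral)
  then show thesis using that[of m'] by (simp add: when_def split: if_splits)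
qed

text \<open>
  A thrackle would lie below another term of \<open>f\<close> from the same fibre.
\<close>

theorem (in circular_order) leading_monomial_hypersimplex_ideal:
  assumes f: "f \<in> hypersimplex_ideal n" "f \<noteq> 0"
  shows "\<exists>e\<in>keys (leading_monomial r f). \<exists>e'\<in>keys (leading_monomial r f). separated e e'"
proof (rule ccontr)
  assume thrackle: "\<not> ?thesis"
  let ?m = "leading_monomial r f"
  have fV: "f \<in> carrier (poly_ring (edges n))" using f mem_hypersimplex_ideal by blast
  note l = leading_monomial[OF fV f(2)]
  obtain m' where m': "m' \<in> keys f" "m' \<noteq> ?m" "vertex_degree m' = vertex_degree ?m"
    using hypersimplex_ideal_fibre[OF f(1) l(1)] by blast
  have "m' \<in> monomials (edges n)" using m' fV unfolding mem_poly_ring by blast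
  then have "(?m, m') \<in> r"
    using thrackle_least_in_fibre[OF l(3) _ m'(3)[symmetric]] thrackle by blast
  then show False using antisym l(2)[OF m'(1)] m'(2) by blast
qed

text \<open>
  The polynomials that vanish to second order along the toric variety.
\<close>

definition tangential_ideal :: "nat \<Rightarrow> (nat \<times> nat) mpoly set" where
  "tangential_ideal n =
     {f \<in> hypersimplex_ideal n. \<forall>e\<in>edges n. pd e f \<in> hypersimplex_ideal n}"

lemma ideal_tangential_ideal: "ideal (tangential_ideal n) (poly_ring (edges n))"
proof (rule poly_ring_idealI)
  note I = ideal_hypersimplex_ideal[of n]
  show "tangential_ideal n \<subseteq> carrier (poly_ring (edges n))"
    using poly_ring_ideal_subset[OF I] unfolding tangential_ideal_def by blast
  show "0 \<in> tangential_ideal n"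
    using poly_ring_ideal_zero[OF I] unfolding tangential_ideal_def by simp
  show "f + g \<in> tangential_ideal n" if "f \<in> tangential_ideal n" "g \<in> tangential_ideal n" for f g
    using that poly_ring_ideal_add[OF I] unfolding tangential_ideal_def by simp
  show "h * f \<in> tangential_ideal n"
    if f: "f \<in> tangential_ideal n" and h: "h \<in> carrier (poly_ring (edges n))" for f h
  proof -
    have "pd e (h * f) \<in> hypersimplex_ideal n" if "e \<in> edges n" for e
      unfolding pd_mult
      using f h that unfolding tangential_ideal_def
      by (intro poly_ring_ideal_add[OF I] poly_ring_ideal_mult_left[OF I] pd_closed) auto
    moreover have "h * f \<in> hypersimplex_ideal n"
      using f h unfolding tangential_ideal_def by (intro poly_ring_ideal_mult_left[OF I]) auto
    ultimately show ?thesis unfolding tangential_ideal_def by blast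
  qed
qed

lemma square_subset_tangential_ideal:
  "ideal_prod (poly_ring (edges n)) (hypersimplex_ideal n) (hypersimplex_ideal n) \<subseteq> tangential_ideal n"
proof
  note I = ideal_hypersimplex_ideal[of n]
  note IR = poly_ring_ideal_subset[OF I, THEN subsetD]
  fix f assume "f \<in> ideal_prod (poly_ring (edges n)) (hypersimplex_ideal n) (hypersimplex_ideal n)"
  then show "f \<in> tangential_ideal n"
  proof (induction f rule: ideal_prod.induct)
    case (prod f g)
    then have "f * g \<in> hypersimplex_ideal n"
      by (intro poly_ring_ideal_mult_left[OF I] IR)
    moreover have "pd e (f * g) \<in> hypersimplex_ideal n" for e
      unfolding pd_mult using prod
      by (intro poly_ring_ideal_add[OF I] poly_ring_ideal_mult_left[OF I prod(2)]
          poly_ring_ideal_mult_right[OF I prod(1)] pd_closed IR)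
    ultimately show ?case unfolding tangential_ideal_def by simp
  next
    case (sum f g)
    then show ?case using poly_ring_ideal_add[OF ideal_tangential_ideal] by simp
  qed
qed

text \<open>
  From \<open>g \<cdot> \<partial>f = \<partial>(g \<cdot> f) - \<partial>g \<cdot> f\<close> and the primality of the toric ideal.
\<close>

lemma tangential_ideal_cancel:
  assumes f: "f \<in> carrier (poly_ring (edges n))" and g: "g \<in> carrier (poly_ring (edges n))"
    and "g \<notin> hypersimplex_ideal n" "g * f \<in> tangential_ideal n"
  shows "f \<in> tangential_ideal n"
proof -
  note I = ideal_hypersimplex_ideal[of n]
  have f': "f \<in> hypersimplex_ideal n"
    using assms hypersimplex_ideal_prime[OF g f] unfolding tangential_ideal_def by blast
  have "pd e f \<in> hypersimplex_ideal n" if "e \<in> edges n" for e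
  proof -
    have "pd e (g * f) - pd e g * f \<in> hypersimplex_ideal n"
      using assms(4) that f' pd_closed[OF g]
      by (intro poly_ring_ideal_diff[OF I] poly_ring_ideal_mult_left[OF I])
        (auto simp: tangential_ideal_def)
    then have "g * pd e f \<in> hypersimplex_ideal n" by (simp add: pd_mult)
    then show ?thesis using hypersimplex_ideal_prime[OF g pd_closed[OF f]] assms(3) by blast
  qed
  then show ?thesis using f' unfolding tangential_ideal_def by blast
qed

text \<open>
  The derivative by a variable \<open>v\<close> of the leading monomial is a nonzero element of the toric ideal,
  with the leading monomial divided by \<open>v\<close>. So the leading monomial meets the differential criterion
  for the graph whose vertices are the edges of the complete graph and whose adjacency is separation.
\<close>

theorem (in circular_order) leading_monomial_tangential_ideal:
  assumes f: "f \<in> tangential_ideal n" "f \<noteq> 0"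
  defines "E \<equiv> \<lambda>e e'. e \<in> edges n \<and> e' \<in> edges n \<and> separated e e'"
  shows "(\<exists>a b c d k. E a b \<and> E c d \<and>
      leading_monomial r f = k + ((single a 1 + single b 1) + (single c 1 + single d 1))) \<or>
    (\<exists>a b c k. E a b \<and> E b c \<and> E a c \<and>
      leading_monomial r f = k + (single a 1 + single b 1 + single c 1))"
proof (rule edge_ideal_symbolic_square)
  let ?m = "leading_monomial r f"
  have fI: "f \<in> hypersimplex_ideal n" using f unfolding tangential_ideal_def by blast
  then have fV: "f \<in> carrier (poly_ring (edges n))" using mem_hypersimplex_ideal by blast
  have mE: "keys ?m \<subseteq> edges n" using leading_monomial(3)[OF fV f(2)] by (simp add: monomials_def)
  show "E a b \<Longrightarrow> E b a" for a b unfolding E_def using separated_sym by blast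
  show "\<not> E a a" for a unfolding E_def separated_def edges_iff by auto
  show "\<exists>a b. E a b \<and> a \<in> keys ?m \<and> b \<in> keys ?m"
    using leading_monomial_hypersimplex_ideal[OF fI f(2)] mE unfolding E_def by blast
  fix v assume v: "v \<in> keys ?m"
  note l = leading_monomial_pd[OF fV f(2) v]
  have "pd v f \<in> hypersimplex_ideal n" using f v mE unfolding tangential_ideal_def by blast
  then have "\<exists>e\<in>keys (?m - single v 1). \<exists>e'\<in>keys (?m - single v 1). separated e e'"
    using leading_monomial_hypersimplex_ideal l by metis
  moreover have "keys (?m - single v 1) \<subseteq> edges n"
    using mE minus_in_monomials[of ?m "edges n"] by (auto simp: monomials_def)
  ultimately show "\<exists>a b. E a b \<and> a \<in> keys (?m - single v 1) \<and> b \<in> keys (?m - single v 1)"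
    unfolding E_def by blast
qed

section \<open>The secant ideal\<close>

text \<open>
  Congruent values of the variables give congruent values of polynomials. This allows the
  replacement of \<open>x\<close> by \<open>y + z\<close> modulo the secant generators.
\<close>

lemma subst_congruent_mod_ideal:
  assumes J: "ideal J (poly_ring W)" and f: "f \<in> carrier (poly_ring V)"
    and g: "\<And>v. v \<in> V \<Longrightarrow> g v \<in> carrier (poly_ring W)"
    and h: "\<And>v. v \<in> V \<Longrightarrow> h v \<in> carrier (poly_ring W)"
    and gh: "\<And>v. v \<in> V \<Longrightarrow> g v - h v \<in> J"
  shows "subst g f - subst h f \<in> J"
proof -
  have "subst g f \<in> carrier (poly_ring W) \<and> subst h f \<in> carrier (poly_ring W) \<and>
      subst g f - subst h f \<in> J"
    using f
  proof (induction f rule: poly_ring_induct)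
    case (const c)
    then show ?case using poly_ring_single[of 0 W c] poly_ring_ideal_zero[OF J] by simp
  next
    case (var v)
    then show ?case using g h gh by simp
  next
    case (add p q)
    then have "(subst g p - subst h p) + (subst g q - subst h q) \<in> J"
      using poly_ring_ideal_add[OF J] by blast
    then show ?case using add by (simp add: poly_ring_add algebra_simps)
  next
    case (mult p q)
    then have "subst g p * (subst g q - subst h q) + (subst g p - subst h p) * subst h q \<in> J"
      by (intro poly_ring_ideal_add[OF J] poly_ring_ideal_mult_left[OF J]
          poly_ring_ideal_mult_right[OF J]) auto
    then show ?case using mult by (simp add: poly_ring_mult algebra_simps)
  qed
  then show ?thesis by blast
qed

definition copies_set :: "'v set \<Rightarrow> 'v copies set" where
  "copies_set V = CX ` V \<union> CY ` V \<union> CZ ` V"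

definition secant_generators :: "'v set \<Rightarrow> 'v mpoly set \<Rightarrow> 'v copies mpoly set" where
  "secant_generators V I = subst (\<lambda>v. var (CY v)) ` I \<union> subst (\<lambda>v. var (CZ v)) ` I \<union>
     {var (CY v) + var (CZ v) - var (CX v) | v. v \<in> V}"

lemma secant_ideal_eq:
  "secant_ideal V I = {f \<in> carrier (poly_ring V). subst (\<lambda>v. var (CX v)) f \<in>
    genideal (poly_ring (copies_set V)) (secant_generators V I)}"
  unfolding secant_ideal_def copies_set_def secant_generators_def ..

lemma copies_var_closed:
  assumes "v \<in> V"
  shows "var (CX v) \<in> carrier (poly_ring (copies_set V))"
    and "var (CY v) \<in> carrier (poly_ring (copies_set V))"
    and "var (CZ v) \<in> carrier (poly_ring (copies_set V))"
  using assms by (auto simp: copies_set_def intro!: poly_ring_var)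

lemma secant_generators_closed:
  assumes "I \<subseteq> carrier (poly_ring V)"
  shows "secant_generators V I \<subseteq> carrier (poly_ring (copies_set V))"
  using assms unfolding secant_generators_def
  by (auto intro!: subst_closed[where V = V] copies_var_closed poly_ring_add poly_ring_diff)

lemma ideal_secant_generators:
  assumes "I \<subseteq> carrier (poly_ring V)"
  shows "ideal (genideal (poly_ring (copies_set V)) (secant_generators V I)) (poly_ring (copies_set V))"
  by (rule poly_ring.genideal_ideal[OF secant_generators_closed[OF assms]])

lemma ideal_secant_ideal:
  assumes "I \<subseteq> carrier (poly_ring V)"
  shows "ideal (secant_ideal V I) (poly_ring V)"
proof -
  note J = ideal_secant_generators[OF assms]
  show ?thesis
    unfolding secant_ideal_eq
  proof (rule poly_ring_idealI, goal_cases)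
    case 2
    then show ?case using poly_ring_ideal_zero[OF J] by simp
  next
    case (3 f g)
    then show ?case using poly_ring_ideal_add[OF J] by (simp add: poly_ring_add)
  next
    case (4 f h)
    then have "subst (\<lambda>v. var (CX v)) h \<in> carrier (poly_ring (copies_set V))"
      by (intro subst_closed[of h V] copies_var_closed(1))
    then show ?case
      using 4 poly_ring_ideal_mult_left[OF J] by (simp add: poly_ring_mult)
  qed auto
qed

text \<open>
  For an edge \<open>e = {i, j}\<close>, the coordinate vector of \<open>e\<close> times \<open>u\<^sup>2\<close> is the point of the variety with
  parameter \<open>u\<close> at \<open>i\<close> and \<open>j\<close> and \<open>0\<close> elsewhere. So \<open>f\<close> vanishes at its sum with a general point of
  the variety, and the coefficient of \<open>u\<^sup>2\<close> in the expansion is the derivative of \<open>f\<close> by \<open>e\<close>. The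
  variable with index \<open>0\<close> is none of the parameters of the general point and can serve as \<open>u\<close>.
\<close>

theorem secant_ideal_subset_tangential_ideal:
  assumes "n \<ge> 2"
  shows "secant_ideal (edges n) (hypersimplex_ideal n) \<subseteq> tangential_ideal n"
proof
  let ?I = "hypersimplex_ideal n" and ?V = "edges n"
  let ?J = "genideal (poly_ring (copies_set ?V)) (secant_generators ?V ?I)"
  fix f assume "f \<in> secant_ideal ?V ?I"
  then have f: "f \<in> carrier (poly_ring ?V)" and fJ: "subst (\<lambda>v. var (CX v)) f \<in> ?J"
    unfolding secant_ideal_eq by auto
  define u :: "nat mpoly" where "u = var 0"
  \<comment> \<open>The substitution \<open>\<kappa>\<close> extracts the part without \<open>u\<close>.\<close>
  define \<kappa> :: "nat \<Rightarrow> nat mpoly" where "\<kappa> = (\<lambda>k. if k = 0 then 0 else var k)"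
  have \<kappa>_param: "subst \<kappa> (subst param g) = subst param g" if "g \<in> carrier (poly_ring ?V)" for g
    unfolding subst_subst
    by (rule subst_cong[OF that]) (auto simp: \<kappa>_def edges_iff)
  have "subst param f = 0 \<and> subst param (pd e f) = 0" if e: "e \<in> ?V" for e
  proof -
    define \<sigma> :: "nat \<Rightarrow> nat mpoly" where "\<sigma> = (\<lambda>k. if k = fst e \<or> k = snd e then u else 0)"
    \<comment> \<open>At \<open>y\<close> the general point, at \<open>z\<close> the multiple of a coordinate vector, and \<open>x = y + z\<close>.\<close>
    define \<psi> where "\<psi> = (\<lambda>c. case c of
        CX v \<Rightarrow> (if v = e then param v + u ^ 2 else param v)
      | CY v \<Rightarrow> param v
      | CZ v \<Rightarrow> if v = e then u ^ 2 else 0)"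
    have \<sigma>_param: "subst \<sigma> (param v) = (if v = e then u ^ 2 else 0)" if "v \<in> ?V" for v
      using that e by (cases v; cases e) (auto simp: \<sigma>_def edges_iff power2_eq_square)
    let ?K = "{p \<in> carrier (poly_ring (copies_set ?V)). subst \<psi> p = 0}"
    have K: "ideal ?K (poly_ring (copies_set ?V))"
      by (rule poly_ring_idealI) (auto intro: poly_ring_add poly_ring_mult)
    have "subst \<psi> p = 0" if p: "p \<in> secant_generators ?V ?I" for p
    proof -
      have "subst (\<lambda>v. \<psi> (CY v)) g = 0" if "g \<in> ?I" for g
        using that by (simp add: \<psi>_def mem_hypersimplex_ideal)
      moreover have "subst (\<lambda>v. \<psi> (CZ v)) g = 0" if g: "g \<in> ?I" for g
      proof -
        have "subst (\<lambda>v. \<psi> (CZ v)) g = subst (\<lambda>v. subst \<sigma> (param v)) g"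
          using g by (intro subst_cong[of g ?V]) (auto simp: \<psi>_def \<sigma>_param mem_hypersimplex_ideal
            simp del: subst_mult)
        also have "\<dots> = subst \<sigma> (subst param g)" by (rule subst_subst[symmetric])
        also have "\<dots> = 0" using g by (simp add: mem_hypersimplex_ideal)
        finally show ?thesis .
      qed
      moreover have "\<psi> (CY v) + \<psi> (CZ v) - \<psi> (CX v) = 0" for v by (simp add: \<psi>_def)
      ultimately show ?thesis
        using p unfolding secant_generators_def by (auto simp: subst_subst)
    qed
    then have "?J \<subseteq> ?K"
      using secant_generators_closed poly_ring_ideal_subset[OF ideal_hypersimplex_ideal]
      by (intro poly_ring.genideal_minimal[OF K]) blast
    then have "subst \<psi> (subst (\<lambda>v. var (CX v)) f) = 0" using fJ by blast
    then have "subst (\<lambda>v. if v = e then param v + u ^ 2 else param v) f = 0"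
      by (simp add: subst_subst \<psi>_def)
    then obtain h where h: "subst param f + u ^ 2 * subst param (pd e f) + (u ^ 2) ^ 2 * h = 0"
      using subst_taylor[of e param "u ^ 2" f] by auto
    have \<kappa>_u: "subst \<kappa> u = 0" by (simp add: \<kappa>_def u_def)
    have 0: "subst param f = 0"
      using arg_cong[OF h, of "subst \<kappa>"] by (simp add: \<kappa>_param[OF f] \<kappa>_u)
    have "u \<noteq> 0" unfolding u_def var_def by (simp flip: keys_eq_empty)
    have "u ^ 2 * (subst param (pd e f) + u ^ 2 * h) = 0"
      using h 0 by (simp add: algebra_simps power2_eq_square)
    then have "subst param (pd e f) + u ^ 2 * h = 0" using \<open>u \<noteq> 0\<close> by simp
    from arg_cong[OF this, of "subst \<kappa>"] show ?thesis
      using 0 by (simp add: \<kappa>_param[OF pd_closed[OF f]] \<kappa>_u)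
  qed
  note * = this
  have "(1, 2) \<in> ?V" using assms by (simp add: edges_def)
  then have "subst param f = 0" using * by blast
  then show "f \<in> tangential_ideal n"
    using * f pd_closed[OF f] unfolding tangential_ideal_def by (simp add: mem_hypersimplex_ideal)
qed

text \<open>
  Closure under sums and differences suffices for polynomials with coefficients \<open>\<plusminus>1\<close>, and
  it allows induction over the terms.
\<close>

inductive_set cubic_forms :: "'v set \<Rightarrow> 'v mpoly set" for V where
  triple: "a \<in> V \<Longrightarrow> b \<in> V \<Longrightarrow> c \<in> V \<Longrightarrow> var a * var b * var c \<in> cubic_forms V"
| add: "f \<in> cubic_forms V \<Longrightarrow> g \<in> cubic_forms V \<Longrightarrow> f + g \<in> cubic_forms V"
| diff: "f \<in> cubic_forms V \<Longrightarrow> g \<in> cubic_forms V \<Longrightarrow> f - g \<in> cubic_forms V"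

text \<open>
  The terms of a cubic form at \<open>y + z\<close> of degree 2 in \<open>y\<close> are linear in \<open>z\<close>, with the derivatives at \<open>y\<close> as
  coefficients, and symmetrically.
\<close>

lemma cubic_form_polarization:
  assumes "finite V" "f \<in> cubic_forms V"
  shows "subst (\<lambda>v. y v + z v) f = subst y f + (\<Sum>e\<in>V. z e * subst y (pd e f)) +
    (\<Sum>e\<in>V. y e * subst z (pd e f)) + subst z f"
  using assms(2)
proof (induction f rule: cubic_forms.induct)
  case (triple a b c)
  have if_mult: "x * (if P then 1 else 0) = (if P then x else 0)"
    "(if P then 1 else 0) * x = (if P then x else 0)" for x :: "'b mpoly" and P
    by auto
  have "(\<Sum>e\<in>V. w e * subst x (pd e (var a * var b * var c))) =
      w a * x b * x c + x a * w b * x c + x a * x b * w c" for w x :: "'a \<Rightarrow> 'b mpoly"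
  proof -
    have subst_if: "subst x (if P then 1 else 0) = (if P then 1 else 0)" for P by simp
    have "w e * subst x (pd e (var a * var b * var c)) =
        (if a = e then w a * x b * x c else 0) + (if b = e then x a * w b * x c else 0) +
        (if c = e then x a * x b * w c else 0)" for e
      by (simp add: pd_mult pd_var subst_if algebra_simps)
    then show ?thesis using triple assms(1) by (simp add: sum.distrib)
  qed
  then show ?case by (simp add: algebra_simps)
next
  case (add f g)
  then show ?case by (simp add: algebra_simps sum.distrib)
next
  case (diff f g)
  then show ?case by (simp add: algebra_simps sum_subtractf)
qed

lemma cubic_form_in_secant_ideal:
  assumes V: "finite V" and I: "ideal I (poly_ring V)" and f: "f \<in> cubic_forms V" "f \<in> I"
    and pd: "\<And>e. e \<in> V \<Longrightarrow> pd e f \<in> I"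
  shows "f \<in> secant_ideal V I"
proof -
  let ?y = "\<lambda>v. var (CY v) :: 'a copies mpoly" and ?z = "\<lambda>v. var (CZ v) :: 'a copies mpoly"
    and ?x = "\<lambda>v. var (CX v) :: 'a copies mpoly"
  let ?J = "genideal (poly_ring (copies_set V)) (secant_generators V I)"
  note IV = poly_ring_ideal_subset[OF I]
  note J = ideal_secant_generators[OF IV]
  note gen = poly_ring.genideal_self[OF secant_generators_closed[OF IV], THEN subsetD]
  have y: "subst ?y g \<in> ?J" and z: "subst ?z g \<in> ?J" if "g \<in> I" for g
    by (rule gen, use that in \<open>simp add: secant_generators_def\<close>)+
  have "subst (\<lambda>v. ?y v + ?z v) f \<in> ?J"
    unfolding cubic_form_polarization[OF V f(1)]
    by (intro poly_ring_ideal_add[OF J] poly_ring_ideal_sum[OF J] poly_ring_ideal_mult_left[OF J]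
        y z f pd copies_var_closed)
  moreover have "subst (\<lambda>v. ?y v + ?z v) f - subst ?x f \<in> ?J"
  proof (rule subst_congruent_mod_ideal[OF J])
    show "f \<in> carrier (poly_ring V)" using f IV by blast
    show "?y v + ?z v - ?x v \<in> ?J" if "v \<in> V" for v
      using that by (intro gen) (auto simp: secant_generators_def)
  qed (auto intro: poly_ring_add copies_var_closed)
  ultimately have "subst (\<lambda>v. ?y v + ?z v) f - (subst (\<lambda>v. ?y v + ?z v) f - subst ?x f) \<in> ?J"
    using poly_ring_ideal_diff[OF J] by blast
  then show ?thesis using f IV unfolding secant_ideal_eq by auto
qed

section \<open>Off-diagonal minors\<close>

lemma xvar_commute: "xvar a b = xvar b a"
  unfolding xvar_def by (simp add: min.commute max.commute)

lemma xvar_less: "a < b \<Longrightarrow> xvar a b = var (a, b)" "b < a \<Longrightarrow> xvar a b = var (b, a)"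
  unfolding xvar_def by simp_all

lemma subst_param_xvar: "subst param (xvar a b) = var a * var b"
  unfolding xvar_def by (cases "a \<le> b") (simp_all add: min_def max_def mult.commute)

lemma min_max_edge: "a \<in> {1..n} \<Longrightarrow> b \<in> {1..n} \<Longrightarrow> a \<noteq> b \<Longrightarrow> (min a b, max a b) \<in> edges n"
  by (auto simp: edges_iff min_def max_def)

lemma xvar_closed:
  "a \<in> {1..n} \<Longrightarrow> b \<in> {1..n} \<Longrightarrow> a \<noteq> b \<Longrightarrow> xvar a b \<in> carrier (poly_ring (edges n))"
  unfolding xvar_def by (intro poly_ring_var min_max_edge)

lemma var_nonzero: "var v \<noteq> 0"
  unfolding var_def by (simp flip: keys_eq_empty)

lemma xvar_not_in_hypersimplex_ideal: "xvar a b \<notin> hypersimplex_ideal n"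
  by (simp add: mem_hypersimplex_ideal subst_param_xvar var_nonzero)

lemma binomial_in_hypersimplex_ideal:
  assumes "{a, b, c, d} \<subseteq> {1..n}" "a \<noteq> b" "c \<noteq> d" "a \<noteq> d" "c \<noteq> b"
  shows "xvar a b * xvar c d - xvar a d * xvar c b \<in> hypersimplex_ideal n"
  unfolding mem_hypersimplex_ideal
  using assms by (auto simp: subst_param_xvar intro!: poly_ring_closed xvar_closed)

lemma det_mat2:
  fixes f :: "nat \<times> nat \<Rightarrow> 'a::comm_ring_1"
  shows "det (mat 2 2 f) = f (0, 0) * f (1, 1) - f (0, 1) * f (1, 0)"
proof -
  have "det (mat 2 2 f) = (\<Sum>j<2. mat 2 2 f $$ (0, j) * cofactor (mat 2 2 f) 0 j)"
    by (rule laplace_expansion_row) auto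
  moreover have "det (mat (Suc 0) (Suc 0) g) = g (0, 0)" for g :: "nat \<times> nat \<Rightarrow> 'a"
    by (subst det_single) auto
  ultimately show ?thesis
    by (simp add: numeral_2_eq_2 cofactor_def mat_delete_def)
qed

lemma det_mat3:
  fixes f :: "nat \<times> nat \<Rightarrow> 'a::comm_ring_1"
  shows "det (mat 3 3 f) =
    f (0, 0) * (f (1, 1) * f (2, 2) - f (1, 2) * f (2, 1)) -
    f (0, 1) * (f (1, 0) * f (2, 2) - f (1, 2) * f (2, 0)) +
    f (0, 2) * (f (1, 0) * f (2, 1) - f (1, 1) * f (2, 0))"
proof -
  have delete: "mat_delete (mat 3 3 f) 0 j =
      mat 2 2 (\<lambda>(a, b). f (Suc a, if b < j then b else Suc b))" if "j < 3" for j
    using that by (intro eq_matI) (auto simp: mat_delete_def)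
  have "det (mat 3 3 f) = (\<Sum>j<3. mat 3 3 f $$ (0, j) * cofactor (mat 3 3 f) 0 j)"
    by (rule laplace_expansion_row) auto
  also have "\<dots> = (\<Sum>j<3. f (0, j) * ((- 1) ^ j *
      det (mat 2 2 (\<lambda>(a, b). f (Suc a, if b < j then b else Suc b)))))"
    by (intro sum.cong refl) (simp add: cofactor_def delete)
  also have "\<dots> = f (0, 0) * ((- 1) ^ 0 * det (mat 2 2 (\<lambda>(a, b). f (Suc a, if b < 0 then b else Suc b)))) +
      f (0, 1) * ((- 1) ^ 1 * det (mat 2 2 (\<lambda>(a, b). f (Suc a, if b < 1 then b else Suc b)))) +
      f (0, 2) * ((- 1) ^ 2 * det (mat 2 2 (\<lambda>(a, b). f (Suc a, if b < 2 then b else Suc b))))"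
    by (simp only: lessThan_Suc numeral_3_eq_3 numeral_2_eq_2 One_nat_def lessThan_0) (simp add: add_ac)
  finally show ?thesis
    unfolding det_mat2 by (simp add: numeral_2_eq_2 algebra_simps)
qed

lemma card2_sorted:
  fixes A :: "nat set"
  assumes "card A = 2"
  obtains a b where "a < b" "A = {a, b}"
  using assms unfolding card_2_iff by (metis insert_commute linorder_neqE_nat)

lemma card3_sorted:
  fixes A :: "nat set"
  assumes "card A = 3"
  obtains a b c where "a < b" "b < c" "A = {a, b, c}"
proof -
  have fin: "finite A" using assms card.infinite by fastforce
  define xs where "xs = sorted_list_of_set A"
  have xs: "length xs = 3" "sorted_wrt (<) xs" "set xs = A"
    using assms fin unfolding xs_def by auto
  then obtain a b c where "xs = [a, b, c]"
    by (auto simp: numeral_3_eq_3 length_Suc_conv)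
  with xs have "{a, b, c} = A" "a < b" "b < c" by auto
  then show thesis using that[of a b c] by auto
qed

lemma minor2_eq:
  assumes "a0 < a1" "b0 < b1"
  shows "minor 2 {a0, a1} {b0, b1} = xvar a0 b0 * xvar a1 b1 - xvar a0 b1 * xvar a1 b0"
proof -
  have "sorted_list_of_set {a0, a1} = [a0, a1]" "sorted_list_of_set {b0, b1} = [b0, b1]"
    using assms sorted_list_of_set.idem_if_sorted_distinct[of "[a0, a1]"]
      sorted_list_of_set.idem_if_sorted_distinct[of "[b0, b1]"] by auto
  then show ?thesis unfolding minor_def by (simp add: det_mat2)
qed

lemma minor3_eq:
  assumes "a0 < a1" "a1 < a2" "b0 < b1" "b1 < b2"
  shows "minor 3 {a0, a1, a2} {b0, b1, b2} =
    xvar a0 b0 * xvar a1 b1 * xvar a2 b2 + xvar a0 b1 * xvar a1 b2 * xvar a2 b0 +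
    xvar a0 b2 * xvar a1 b0 * xvar a2 b1 - xvar a0 b0 * xvar a1 b2 * xvar a2 b1 -
    xvar a0 b1 * xvar a1 b0 * xvar a2 b2 - xvar a0 b2 * xvar a1 b1 * xvar a2 b0"
proof -
  have "sorted_list_of_set {a0, a1, a2} = [a0, a1, a2]"
    "sorted_list_of_set {b0, b1, b2} = [b0, b1, b2]"
    using assms sorted_list_of_set.idem_if_sorted_distinct[of "[a0, a1, a2]"]
      sorted_list_of_set.idem_if_sorted_distinct[of "[b0, b1, b2]"] by auto
  then show ?thesis unfolding minor_def by (simp add: det_mat3 numeral_2_eq_2 algebra_simps)
qed

lemma off_diagonal_minor2_cases:
  assumes "f \<in> off_diagonal_minors n 2"
  obtains a0 a1 b0 b1 where "a0 < a1" "b0 < b1" "{a0, a1, b0, b1} \<subseteq> {1..n}"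
    "{a0, a1} \<inter> {b0, b1} = {}" "f = minor 2 {a0, a1} {b0, b1}"
proof -
  obtain A B where AB: "A \<subseteq> {1..n}" "B \<subseteq> {1..n}" "card A = 2" "card B = 2" "A \<inter> B = {}"
    "f = minor 2 A B"
    using assms unfolding off_diagonal_minors_def by blast
  obtain a0 a1 where A: "a0 < a1" "A = {a0, a1}" using AB card2_sorted by blast
  obtain b0 b1 where B: "b0 < b1" "B = {b0, b1}" using AB card2_sorted by blast
  show thesis using that[OF A(1) B(1)] AB A B by simp
qed

lemma off_diagonal_minor3_cases:
  assumes "f \<in> off_diagonal_minors n 3"
  obtains a0 a1 a2 b0 b1 b2 where "a0 < a1" "a1 < a2" "b0 < b1" "b1 < b2"
    "{a0, a1, a2, b0, b1, b2} \<subseteq> {1..n}"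
    "{a0, a1, a2} \<inter> {b0, b1, b2} = {}" "f = minor 3 {a0, a1, a2} {b0, b1, b2}"
proof -
  obtain A B where AB: "A \<subseteq> {1..n}" "B \<subseteq> {1..n}" "card A = 3" "card B = 3" "A \<inter> B = {}"
    "f = minor 3 A B"
    using assms unfolding off_diagonal_minors_def by blast
  obtain a0 a1 a2 where A: "a0 < a1" "a1 < a2" "A = {a0, a1, a2}" using AB card3_sorted by blast
  obtain b0 b1 b2 where B: "b0 < b1" "b1 < b2" "B = {b0, b1, b2}" using AB card3_sorted by blast
  show thesis using that[OF A(1,2) B(1,2)] AB A B by simp
qed

lemma minor2_mem:
  assumes "{a0, a1, b0, b1} \<subseteq> {1..n}" "{a0, a1} \<inter> {b0, b1} = {}" "a0 < a1" "b0 < b1"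
  shows "minor 2 {a0, a1} {b0, b1} \<in> off_diagonal_minors n 2"
  using assms unfolding off_diagonal_minors_def
  by (intro CollectI exI[of _ "{a0, a1}"] exI[of _ "{b0, b1}"]) auto

lemma minor3_mem:
  assumes "{a0, a1, a2, b0, b1, b2} \<subseteq> {1..n}" "{a0, a1, a2} \<inter> {b0, b1, b2} = {}"
    "a0 < a1" "a1 < a2" "b0 < b1" "b1 < b2"
  shows "minor 3 {a0, a1, a2} {b0, b1, b2} \<in> off_diagonal_minors n 3"
  using assms unfolding off_diagonal_minors_def
  by (intro CollectI exI[of _ "{a0, a1, a2}"] exI[of _ "{b0, b1, b2}"]) auto

lemma finite_off_diagonal_minors: "finite (off_diagonal_minors n k)"
proof (rule finite_subset)
  show "off_diagonal_minors n k \<subseteq> (\<lambda>(A, B). minor k A B) ` (Pow {1..n} \<times> Pow {1..n})"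
    unfolding off_diagonal_minors_def by auto
qed simp

lemma off_diagonal_minor2_in_hypersimplex_ideal:
  assumes "f \<in> off_diagonal_minors n 2"
  shows "f \<in> hypersimplex_ideal n"
proof -
  obtain a0 a1 b0 b1 where *: "a0 < a1" "b0 < b1" "{a0, a1, b0, b1} \<subseteq> {1..n}"
    "{a0, a1} \<inter> {b0, b1} = {}" "f = minor 2 {a0, a1} {b0, b1}"
    using off_diagonal_minor2_cases[OF assms] by blast
  then show ?thesis
    using binomial_in_hypersimplex_ideal[of a0 b0 a1 b1 n] by (auto simp: minor2_eq)
qed

text \<open>
  The contraction of \<open>I\<^sup>2\<close> from the localization at the prime ideal \<open>I\<close>. It is the symbolic square, but
  free of primary decompositions.
\<close>

definition localized_square :: "nat \<Rightarrow> (nat \<times> nat) mpoly set" where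
  "localized_square n = {f \<in> carrier (poly_ring (edges n)).
     \<exists>s \<in> carrier (poly_ring (edges n)) - hypersimplex_ideal n.
       s * f \<in> ideal_prod (poly_ring (edges n)) (hypersimplex_ideal n) (hypersimplex_ideal n)}"

lemma ideal_square:
  "ideal (ideal_prod (poly_ring (edges n)) (hypersimplex_ideal n) (hypersimplex_ideal n))
    (poly_ring (edges n))"
  by (rule poly_ring.ideal_prod_is_ideal[OF ideal_hypersimplex_ideal ideal_hypersimplex_ideal])

lemma mult_in_square:
  assumes "f \<in> hypersimplex_ideal n" "g \<in> hypersimplex_ideal n"
  shows "f * g \<in> ideal_prod (poly_ring (edges n)) (hypersimplex_ideal n) (hypersimplex_ideal n)"
  using ideal_prod.prod[OF assms, of "poly_ring (edges n)"] unfolding poly_ring_simps .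

text \<open>Sylvester's identity for the bordered minors of the first entry.\<close>

lemma off_diagonal_minor3_in_localized_square:
  assumes "f \<in> off_diagonal_minors n 3"
  shows "f \<in> localized_square n"
proof -
  let ?I2 = "ideal_prod (poly_ring (edges n)) (hypersimplex_ideal n) (hypersimplex_ideal n)"
  obtain a0 a1 a2 b0 b1 b2 where *: "a0 < a1" "a1 < a2" "b0 < b1" "b1 < b2"
    "{a0, a1, a2, b0, b1, b2} \<subseteq> {1..n}"
    "{a0, a1, a2} \<inter> {b0, b1, b2} = {}" "f = minor 3 {a0, a1, a2} {b0, b1, b2}"
    using off_diagonal_minor3_cases[OF assms] by blast
  have ne: "a \<noteq> b" if "a \<in> {a0, a1, a2}" "b \<in> {b0, b1, b2}" for a b
    using *(6) that by blast
  have range: "a \<in> {1..n}" if "a \<in> {a0, a1, a2, b0, b1, b2}" for a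
    using *(5) that by blast
  have cl: "xvar a b \<in> carrier (poly_ring (edges n))" if "a \<in> {a0, a1, a2}" "b \<in> {b0, b1, b2}" for a b
    by (rule xvar_closed[OF range range ne]) (use that in auto)
  define m where "m = (\<lambda>i j. xvar a0 b0 * xvar i j - xvar a0 j * xvar i b0)"
  have m: "m i j \<in> hypersimplex_ideal n" if "i \<in> {a1, a2}" "j \<in> {b1, b2}" for i j
    unfolding m_def
  proof (rule binomial_in_hypersimplex_ideal)
    have mem: "a0 \<in> {a0, a1, a2}" "i \<in> {a0, a1, a2}" "b0 \<in> {b0, b1, b2}" "j \<in> {b0, b1, b2}"
      using that by auto
    show "a0 \<noteq> b0" "i \<noteq> j" "a0 \<noteq> j" "i \<noteq> b0" by (rule ne mem)+
    show "{a0, b0, i, j} \<subseteq> {1..n}" using mem *(5) by blast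
  qed
  have f: "f \<in> carrier (poly_ring (edges n))"
    unfolding *(7) minor3_eq[OF *(1-4)]
    by (intro poly_ring_closed cl) simp_all
  have "xvar a0 b0 * f = m a1 b1 * m a2 b2 - m a1 b2 * m a2 b1"
    unfolding *(7) minor3_eq[OF *(1-4)] m_def by (simp add: algebra_simps)
  also have "\<dots> \<in> ?I2"
    by (intro poly_ring_ideal_diff[OF ideal_square] mult_in_square m) auto
  finally have "xvar a0 b0 * f \<in> ?I2" .
  moreover have "xvar a0 b0 \<in> carrier (poly_ring (edges n))"
    by (intro cl) simp_all
  ultimately show ?thesis
    using f xvar_not_in_hypersimplex_ideal unfolding localized_square_def by blast
qed

section \<open>Master polynomials\<close>

text \<open>
  Subsets of a set of commuting involutions are coded by truth values, one for each factor.
\<close>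

definition optional :: "('a \<Rightarrow> 'a) \<Rightarrow> bool \<Rightarrow> 'a \<Rightarrow> 'a" where
  "optional f x = (if x then f else id)"

lemma generate_commuting_transpositions:
  assumes abc: "a permutes {1..n}" "b permutes {1..n}" "c permutes {1..n}"
    and inv: "a \<circ> a = id" "b \<circ> b = id" "c \<circ> c = id"
    and comm: "b \<circ> a = a \<circ> b" "c \<circ> a = a \<circ> c" "c \<circ> b = b \<circ> c"
  shows "generate (sym_group n) {a, b, c} =
    range (\<lambda>(x, y, z). optional a x \<circ> optional b y \<circ> optional c z)"
proof -
  define g where "g = (\<lambda>(x, y, z). optional a x \<circ> optional b y \<circ> optional c z)"
  have mult: "g (x, y, z) \<circ> g (x', y', z') = g (x \<noteq> x', y \<noteq> y', z \<noteq> z')" for x y z x' y' z'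
  proof -
    have pt: "a (a t) = t" "b (b t) = t" "c (c t) = t" "b (a t) = a (b t)" "c (a t) = a (c t)"
      "c (b t) = b (c t)" for t
      using inv comm by (metis comp_apply id_apply)+
    show ?thesis by (auto simp: g_def optional_def fun_eq_iff pt)
  qed
  have gens: "h \<in> range g" if "h \<in> {a, b, c}" for h
  proof -
    have "g (True, False, False) = a" "g (False, True, False) = b" "g (False, False, True) = c"
      by (simp_all add: g_def optional_def)
    then have "a \<in> range g" "b \<in> range g" "c \<in> range g" by (metis rangeI)+
    then show ?thesis using that by blast
  qed
  have inv_eq: "inv\<^bsub>sym_group n\<^esub> h = h" if "h \<in> {a, b, c}" for h
  proof -
    have "h \<in> carrier (sym_group n)" using abc that by (auto simp: sym_group_carrier)
    moreover have "inv' h = h" using inv that by (auto intro: inv_unique_comp)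
    ultimately show ?thesis by simp
  qed
  have sub: "h \<in> range g" if "h \<in> generate (sym_group n) {a, b, c}" for h
    using that
  proof (induction h rule: generate.induct)
    case one
    have "g (False, False, False) = id" by (simp add: g_def optional_def)
    then show ?case by (metis rangeI sym_group_one)
  next
    case (incl h)
    then show ?case by (rule gens)
  next
    case (inv h)
    show ?case unfolding inv_eq[OF inv] using inv by (rule gens)
  next
    case (eng h1 h2)
    obtain s t where st: "h1 = g s" "h2 = g t" using eng.IH by auto
    obtain x y z x' y' z' where "s = (x, y, z)" "t = (x', y', z')" by (cases s, cases t)
    then have "h1 \<circ> h2 = g (x \<noteq> x', y \<noteq> y', z \<noteq> z')" using st mult by simp
    then show ?case unfolding sym_group_mult by simp
  qed
  have opt: "optional h x \<in> generate (sym_group n) {a, b, c}" if "h \<in> {a, b, c}" for h x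
    using generate.incl[OF that, of "sym_group n"] generate.one[of "sym_group n" "{a, b, c}"]
    by (simp add: optional_def sym_group_one)
  have "g t \<in> generate (sym_group n) {a, b, c}" for t
  proof -
    obtain x y z where t: "t = (x, y, z)" by (cases t)
    show ?thesis
      using generate.eng[OF generate.eng[OF opt[of a x] opt[of b y]] opt[of c z]]
      unfolding t g_def by (simp add: sym_group_mult)
  qed
  then have "generate (sym_group n) {a, b, c} = range g" using sub by auto
  then show ?thesis unfolding g_def .
qed

lemma conjugate_transpose:
  assumes "bij \<sigma>"
  shows "\<sigma> \<circ> transpose a b \<circ> inv' \<sigma> = transpose (\<sigma> a) (\<sigma> b)"
proof
  fix x
  obtain y where x: "x = \<sigma> y" using assms by (metis bij_pointE)
  have "inv' \<sigma> (\<sigma> y) = y" using assms by (simp add: bij_is_inj)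
  then show "(\<sigma> \<circ> transpose a b \<circ> inv' \<sigma>) x = transpose (\<sigma> a) (\<sigma> b) x"
    using bij_is_inj[OF assms] unfolding x by (auto simp: transpose_def inj_eq)
qed

lemma two_cycle_monomial_eq:
  assumes "{p1, q1, p2, q2, p3, q3} \<subseteq> {1..n}" and d: "distinct [p1, q1, p2, q2, p3, q3]"
  shows "two_cycle_monomial n (transpose p1 q1 \<circ> transpose p2 q2 \<circ> transpose p3 q3) =
    xvar p1 q1 * xvar p2 q2 * xvar p3 q3"
proof -
  define \<rho> where "\<rho> = transpose p1 q1 \<circ> transpose p2 q2 \<circ> transpose p3 q3"
  let ?e = "\<lambda>p q. (min p q, max p q) :: nat \<times> nat"
  have \<rho>_swap: "\<rho> p1 = q1" "\<rho> q1 = p1" "\<rho> p2 = q2" "\<rho> q2 = p2" "\<rho> p3 = q3" "\<rho> q3 = p3"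
    using d unfolding \<rho>_def by (auto simp: transpose_def)
  have \<rho>_else: "\<rho> x = x" if "x \<notin> {p1, q1, p2, q2, p3, q3}" for x
    using that unfolding \<rho>_def by (auto simp: transpose_def)
  have "{(a, b) \<in> edges n. \<rho> a = b \<and> \<rho> b = a} = {?e p1 q1, ?e p2 q2, ?e p3 q3}" (is "?L = ?R")
  proof
    show "?R \<subseteq> ?L"
    proof -
      have "?e p q \<in> ?L" if "p \<in> {1..n}" "q \<in> {1..n}" "p \<noteq> q" "\<rho> p = q" "\<rho> q = p" for p q
        using that by (cases "p < q") (auto simp: edges_iff min_def max_def)
      then show ?thesis using assms(1) d \<rho>_swap by simp
    qed
    show "?L \<subseteq> ?R"
    proof
      fix e assume "e \<in> ?L"
      then obtain a b where e: "e = (a, b)" "a < b" "\<rho> a = b" "\<rho> b = a"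
        by (auto simp: edges_iff)
      have "a \<in> {p1, q1, p2, q2, p3, q3}"
        using e(2,3) \<rho>_else[of a] by (metis less_irrefl)
      then have "(a, b) \<in> {(p1, q1), (q1, p1), (p2, q2), (q2, p2), (p3, q3), (q3, p3)}"
        using e(3) \<rho>_swap by auto
      then consider "a = p1 \<and> b = q1 \<or> a = q1 \<and> b = p1" | "a = p2 \<and> b = q2 \<or> a = q2 \<and> b = p2"
        | "a = p3 \<and> b = q3 \<or> a = q3 \<and> b = p3"
        by auto
      moreover have mm: "e = ?e a b" "e = ?e b a" using e(1,2) by simp_all
      ultimately have "e = ?e p1 q1 \<or> e = ?e p2 q2 \<or> e = ?e p3 q3"
        by cases metis+
      then show "e \<in> ?R" by simp
    qed
  qed
  moreover have "?e p1 q1 \<noteq> ?e p2 q2" "?e p1 q1 \<noteq> ?e p3 q3" "?e p2 q2 \<noteq> ?e p3 q3"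
    using d by (auto simp: min_def max_def split: if_splits)
  moreover have "xvar (min p q) (max p q) = xvar p q" for p q
    unfolding xvar_def by simp
  ultimately show ?thesis
    unfolding two_cycle_monomial_def \<rho>_def[symmetric] by (simp add: mult.assoc)
qed

text \<open>
  The eight permutations exchange \<open>i1\<close> with \<open>j3\<close>, \<open>i2\<close> with \<open>j1\<close> and \<open>i3\<close> with \<open>j2\<close> independently;
  conjugation moves the three chords along.
\<close>

lemma master_polynomial_eq:
  assumes sub: "{i1, j1, i2, j2, i3, j3} \<subseteq> {1..n}" and d: "distinct [i1, j1, i2, j2, i3, j3]"
  shows "master_polynomial n i1 j1 i2 j2 i3 j3 =
    xvar i1 j1 * xvar i2 j2 * xvar i3 j3 - xvar j3 j1 * xvar i2 j2 * xvar i3 i1 -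
    xvar i1 i2 * xvar j1 j2 * xvar i3 j3 - xvar i1 j1 * xvar i2 i3 * xvar j2 j3 +
    xvar j3 i2 * xvar j1 j2 * xvar i3 i1 + xvar j3 j1 * xvar i2 i3 * xvar j2 i1 +
    xvar i1 i2 * xvar j1 i3 * xvar j2 j3 - xvar j3 i2 * xvar j1 i3 * xvar j2 i1"
proof -
  let ?a = "transpose i1 j3" and ?b = "transpose i2 j1" and ?c = "transpose i3 j2"
  define g where "g = (\<lambda>(x, y, z). optional ?a x \<circ> optional ?b y \<circ> optional ?c z)"
  define F where "F = (\<lambda>\<sigma>. of_int (sign \<sigma>) * two_cycle_monomial n
      (\<sigma> \<circ> (transpose i1 j1 \<circ> transpose i2 j2 \<circ> transpose i3 j3) \<circ> inv' \<sigma>))"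
  have gen: "generate (sym_group n) {?a, ?b, ?c} = range g"
    unfolding g_def
  proof (rule generate_commuting_transpositions)
    show "?b \<circ> ?a = ?a \<circ> ?b" "?c \<circ> ?a = ?a \<circ> ?c" "?c \<circ> ?b = ?b \<circ> ?c"
      using d by (auto simp: fun_eq_iff transpose_def)
  qed (use sub in \<open>auto intro: permutes_swap_id\<close>)
  have gv: "g (x, y, z) i1 = (if x then j3 else i1)" "g (x, y, z) j3 = (if x then i1 else j3)"
    "g (x, y, z) i2 = (if y then j1 else i2)" "g (x, y, z) j1 = (if y then i2 else j1)"
    "g (x, y, z) i3 = (if z then j2 else i3)" "g (x, y, z) j2 = (if z then i3 else j2)" for x y z
    using d by (auto simp: g_def optional_def transpose_def)
  have "inj g"
  proof (rule injI)
    fix s t assume eq: "g s = g t"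
    have val: "g (x, y, z) i1 = i1 \<longleftrightarrow> \<not> x" "g (x, y, z) i2 = i2 \<longleftrightarrow> \<not> y"
      "g (x, y, z) i3 = i3 \<longleftrightarrow> \<not> z" for x y z
      using d by (auto simp: gv)
    obtain x y z where s: "s = (x, y, z)" by (cases s)
    obtain x' y' z' where t: "t = (x', y', z')" by (cases t)
    have "x = x'" "y = y'" "z = z'"
      using eq[unfolded s t] val[of x y z] val[of x' y' z'] by simp_all
    then show "s = t" using s t by simp
  qed
  have F: "F (g (x, y, z)) = (if x then - 1 else 1) * (if y then - 1 else 1) * (if z then - 1 else 1) *
      (xvar (g (x, y, z) i1) (g (x, y, z) j1) * xvar (g (x, y, z) i2) (g (x, y, z) j2) *
       xvar (g (x, y, z) i3) (g (x, y, z) j3))" for x y z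
  proof -
    let ?\<sigma> = "g (x, y, z)"
    have perm: "permutation (optional ?a x)" "permutation (optional ?b y)" "permutation (optional ?c z)"
      by (auto simp: optional_def permutation_swap_id)
    have "sign (optional ?a x) = (if x then - 1 else 1)" "sign (optional ?b y) = (if y then - 1 else 1)"
      "sign (optional ?c z) = (if z then - 1 else 1)"
      using d by (auto simp: optional_def sign_swap_id)
    then have sign: "sign ?\<sigma> = (if x then - 1 else 1) * (if y then - 1 else 1) * (if z then - 1 else 1)"
      using perm by (simp only: g_def prod.case sign_compose permutation_compose)
    have perm_\<sigma>: "?\<sigma> permutes {1..n}"
      unfolding g_def optional_def using sub
      by (auto intro!: permutes_compose permutes_swap_id permutes_id simp del: id_comp comp_id)
    then have bij: "bij ?\<sigma>" by (rule permutes_bij)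
    have "?\<sigma> \<circ> (transpose i1 j1 \<circ> transpose i2 j2 \<circ> transpose i3 j3) \<circ> inv' ?\<sigma> =
        (?\<sigma> \<circ> transpose i1 j1 \<circ> inv' ?\<sigma>) \<circ> (?\<sigma> \<circ> transpose i2 j2 \<circ> inv' ?\<sigma>) \<circ>
        (?\<sigma> \<circ> transpose i3 j3 \<circ> inv' ?\<sigma>)"
      using bij by (auto simp: fun_eq_iff bij_is_inj)
    also have "\<dots> = transpose (?\<sigma> i1) (?\<sigma> j1) \<circ> transpose (?\<sigma> i2) (?\<sigma> j2) \<circ> transpose (?\<sigma> i3) (?\<sigma> j3)"
      unfolding conjugate_transpose[OF bij] ..
    finally have conj: "?\<sigma> \<circ> (transpose i1 j1 \<circ> transpose i2 j2 \<circ> transpose i3 j3) \<circ> inv' ?\<sigma> =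
        transpose (?\<sigma> i1) (?\<sigma> j1) \<circ> transpose (?\<sigma> i2) (?\<sigma> j2) \<circ> transpose (?\<sigma> i3) (?\<sigma> j3)" .
    have "two_cycle_monomial n (transpose (?\<sigma> i1) (?\<sigma> j1) \<circ> transpose (?\<sigma> i2) (?\<sigma> j2) \<circ>
        transpose (?\<sigma> i3) (?\<sigma> j3)) = xvar (?\<sigma> i1) (?\<sigma> j1) * xvar (?\<sigma> i2) (?\<sigma> j2) * xvar (?\<sigma> i3) (?\<sigma> j3)"
    proof (rule two_cycle_monomial_eq)
      show "{?\<sigma> i1, ?\<sigma> j1, ?\<sigma> i2, ?\<sigma> j2, ?\<sigma> i3, ?\<sigma> j3} \<subseteq> {1..n}"
        using sub permutes_in_image[OF perm_\<sigma>] by blast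
      show "distinct [?\<sigma> i1, ?\<sigma> j1, ?\<sigma> i2, ?\<sigma> j2, ?\<sigma> i3, ?\<sigma> j3]"
        using d bij_is_inj[OF bij] by (simp add: inj_eq)
    qed
    then show ?thesis unfolding F_def sign conj by simp
  qed
  have "master_polynomial n i1 j1 i2 j2 i3 j3 = (\<Sum>\<sigma>\<in>range g. F \<sigma>)"
    unfolding master_polynomial_def gen F_def ..
  also have "\<dots> = (\<Sum>t\<in>UNIV. F (g t))"
    using \<open>inj g\<close> by (simp add: sum.reindex)
  also have "\<dots> = (\<Sum>x\<in>UNIV. \<Sum>y\<in>UNIV. \<Sum>z\<in>UNIV. F (g (x, y, z)))"
    by (simp add: sum.cartesian_product UNIV_Times_UNIV case_prod_unfold)
  also have "\<dots> = xvar i1 j1 * xvar i2 j2 * xvar i3 j3 - xvar j3 j1 * xvar i2 j2 * xvar i3 i1 -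
    xvar i1 i2 * xvar j1 j2 * xvar i3 j3 - xvar i1 j1 * xvar i2 i3 * xvar j2 j3 +
    xvar j3 i2 * xvar j1 j2 * xvar i3 i1 + xvar j3 j1 * xvar i2 i3 * xvar j2 i1 +
    xvar i1 i2 * xvar j1 i3 * xvar j2 j3 - xvar j3 i2 * xvar j1 i3 * xvar j2 i1"
    unfolding F gv by (simp add: UNIV_bool algebra_simps)
  finally show ?thesis .
qed

text \<open>
  For the \<open>2 \<times> 2\<close> matrices \<open>a\<close>, \<open>b\<close>, \<open>c\<close> and the skew matrix \<open>J\<close> with rows \<open>(0, -1)\<close> and \<open>(1, 0)\<close>, the
  second factor on the left is the trace of \<open>a J b J c J\<close>. Up to the factor \<open>a00\<close>, the matrix \<open>a\<close> is the
  product of its first column and its first row, plus \<open>det a\<close> in the last position, and likewise for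
  \<open>b\<close> and \<open>c\<close>. In the expansion of the trace, the terms with several determinants vanish by the
  skewness of \<open>J\<close>, and each other one has at least two factors that vanish on matrices of products of parameters.
\<close>

lemma master_identity:
  fixes a00 a01 a10 a11 b00 b01 b10 b11 c00 c01 c10 c11 :: "'a::comm_ring_1"
  shows "a00 * b00 * c00 *
     (a01 * b01 * c01 - a11 * b01 * c00 - a00 * b11 * c01 - a01 * b00 * c11 +
      a10 * b11 * c00 + a11 * b00 * c10 + a00 * b10 * c11 - a10 * b10 * c10) =
    (a01 * b00 - a00 * b10) * (b01 * c00 - b00 * c10) * (c01 * a00 - c00 * a10) -
    b00 * c00 * ((a00 * a11 - a01 * a10) * (b01 * c00 - b00 * c10)) -
    a00 * c00 * ((b00 * b11 - b01 * b10) * (c01 * a00 - c00 * a10)) -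
    a00 * b00 * ((c00 * c11 - c01 * c10) * (a01 * b00 - a00 * b10))"
  by (simp add: algebra_simps)

text \<open>
  The matrices in the identity have the rows \<open>(i1, j3)\<close>, \<open>(i2, j1)\<close>, \<open>(i3, j2)\<close> and, as columns, the next
  of these pairs in cyclic order; each entry is the variable of its row and column.
\<close>

lemma master_polynomial_in_localized_square:
  assumes sub: "{i1, j1, i2, j2, i3, j3} \<subseteq> {1..n}" and d: "distinct [i1, j1, i2, j2, i3, j3]"
  shows "master_polynomial n i1 j1 i2 j2 i3 j3 \<in> localized_square n"
proof -
  let ?R = "poly_ring (edges n)" and ?I = "hypersimplex_ideal n"
  let ?I2 = "ideal_prod ?R ?I ?I"
  let ?f = "master_polynomial n i1 j1 i2 j2 i3 j3"
  let ?s = "xvar i1 i2 * xvar i2 i3 * xvar i3 i1"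
  have cl: "xvar a b \<in> carrier ?R"
    if "a \<in> {i1, j1, i2, j2, i3, j3}" "b \<in> {i1, j1, i2, j2, i3, j3}" "a \<noteq> b" for a b
    using that sub by (intro xvar_closed) auto
  have f: "?f \<in> carrier ?R"
    unfolding master_polynomial_eq[OF sub d] by (intro poly_ring_closed cl) (use d in auto)
  let ?d1 = "xvar i1 i2 * xvar j3 j1 - xvar i1 j1 * xvar j3 i2"
  let ?d2 = "xvar i2 i3 * xvar j1 j2 - xvar i2 j2 * xvar j1 i3"
  let ?d3 = "xvar i3 i1 * xvar j2 j3 - xvar i3 j3 * xvar j2 i1"
  let ?s1 = "xvar i1 j1 * xvar i2 i3 - xvar i1 i2 * xvar j1 i3"
  let ?s2 = "xvar i2 j2 * xvar i3 i1 - xvar i2 i3 * xvar j2 i1"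
  let ?s3 = "xvar i3 j3 * xvar i1 i2 - xvar i3 i1 * xvar j3 i2"
  have I: "?d1 \<in> ?I" "?d2 \<in> ?I" "?d3 \<in> ?I" "?s1 \<in> ?I" "?s2 \<in> ?I" "?s3 \<in> ?I"
    using sub d binomial_in_hypersimplex_ideal[of i1 i2 j3 j1 n]
      binomial_in_hypersimplex_ideal[of i2 i3 j1 j2 n]
      binomial_in_hypersimplex_ideal[of i3 i1 j2 j3 n]
      binomial_in_hypersimplex_ideal[of i1 j1 i3 i2 n]
      binomial_in_hypersimplex_ideal[of i2 j2 i1 i3 n]
      binomial_in_hypersimplex_ideal[of i3 j3 i2 i1 n]
      xvar_commute[of i3 i2] xvar_commute[of i3 j1] xvar_commute[of i1 i3] xvar_commute[of i1 j2]
      xvar_commute[of i2 i1] xvar_commute[of i2 j3]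
    by auto
  have "?s * ?f = ?s1 * ?s2 * ?s3 - xvar i2 i3 * xvar i3 i1 * (?d1 * ?s2) -
      xvar i1 i2 * xvar i3 i1 * (?d2 * ?s3) - xvar i1 i2 * xvar i2 i3 * (?d3 * ?s1)"
    unfolding master_polynomial_eq[OF sub d]
    using master_identity[of "xvar i1 i2" "xvar i2 i3" "xvar i3 i1" "xvar i1 j1" "xvar i2 j2" "xvar i3 j3"
        "xvar j3 j1" "xvar j1 j2" "xvar j2 j3" "xvar j3 i2" "xvar j2 i1" "xvar j1 i3"]
    by simp
  also have "\<dots> \<in> ?I2"
  proof (intro poly_ring_ideal_diff[OF ideal_square])
    note right = poly_ring_ideal_mult_right[OF ideal_square mult_in_square]
    note left = poly_ring_ideal_mult_left[OF ideal_square mult_in_square]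
    have s3: "?s3 \<in> carrier ?R"
      using I(6) poly_ring_ideal_subset[OF ideal_hypersimplex_ideal] by (rule rev_subsetD)
    show "?s1 * ?s2 * ?s3 \<in> ?I2" by (rule right[OF I(4) I(5) s3])
    have prod: "xvar a b * xvar c e \<in> carrier ?R"
      if "a \<in> {i1, i2, i3}" "b \<in> {i1, i2, i3}" "a \<noteq> b" "c \<in> {i1, i2, i3}" "e \<in> {i1, i2, i3}" "c \<noteq> e"
      for a b c e
      by (intro poly_ring_mult cl) (use that in auto)
    show "xvar i2 i3 * xvar i3 i1 * (?d1 * ?s2) \<in> ?I2"
      by (rule left[OF I(1) I(5) prod]) (use d in auto)
    show "xvar i1 i2 * xvar i3 i1 * (?d2 * ?s3) \<in> ?I2"
      by (rule left[OF I(2) I(6) prod]) (use d in auto)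
    show "xvar i1 i2 * xvar i2 i3 * (?d3 * ?s1) \<in> ?I2"
      by (rule left[OF I(3) I(4) prod]) (use d in auto)
  qed
  finally have "?s * ?f \<in> ?I2" .
  moreover have "?s \<in> carrier ?R"
    by (intro poly_ring_mult cl) (use d in auto)
  moreover have "?s \<notin> ?I"
    by (simp add: mem_hypersimplex_ideal subst_param_xvar var_nonzero)
  ultimately show ?thesis using f unfolding localized_square_def by blast
qed

section \<open>Leading monomials of the minors and master polynomials\<close>

definition triple :: "nat \<times> nat \<Rightarrow> nat \<times> nat \<Rightarrow> nat \<times> nat \<Rightarrow> (nat \<times> nat) monomial" where
  "triple a b c = single a 1 + single b 1 + single c 1"

lemma keys_triple: "keys (triple a b c) = {a, b, c}"
  unfolding triple_def by (auto simp: in_keys_iff lookup_add lookup_single when_def split: if_splits)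

lemma keys_single_add_single: "keys (single a 1 + single b 1 :: 'v monomial) = {a, b}"
  by (auto simp: in_keys_iff lookup_add lookup_single when_def split: if_splits)

lemma var_mult3: "var a * var b * var c = single (triple a b c) 1"
  unfolding var_def triple_def by (simp add: mult_single)

lemma separated_irrefl: "e \<in> edges n \<Longrightarrow> \<not> separated e e"
  unfolding separated_def edges_iff by auto

definition planar_triple :: "nat \<Rightarrow> (nat \<times> nat) monomial \<Rightarrow> bool" where
  "planar_triple n m \<longleftrightarrow> (\<exists>a b c. {a, b, c} \<subseteq> edges n \<and>
     separated a b \<and> separated a c \<and> separated b c \<and> m = triple a b c)"

lemma planar_triple_iff:
  assumes "{a, b, c} \<subseteq> edges n"
  shows "planar_triple n (triple a b c) \<longleftrightarrow> separated a b \<and> separated a c \<and> separated b c"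
proof
  assume "planar_triple n (triple a b c)"
  then obtain x y z where xyz: "{x, y, z} \<subseteq> edges n" "separated x y" "separated x z" "separated y z"
    "triple a b c = triple x y z"
    unfolding planar_triple_def by blast
  have keys: "{a, b, c} = {x, y, z}" using arg_cong[OF xyz(5), of keys] by (simp add: keys_triple)
  have "\<not> separated w w" if "w \<in> {x, y, z}" for w
    using xyz(1) that separated_irrefl by blast
  then have "x \<noteq> y" "x \<noteq> z" "y \<noteq> z" using xyz(2-4) by blast+
  then have "card {a, b, c} = 3" unfolding keys by simp
  then have "a \<noteq> b" "a \<noteq> c" "b \<noteq> c" by (auto simp: card_insert_if split: if_splits)
  moreover have "separated u v" if "u \<in> {x, y, z}" "v \<in> {x, y, z}" "u \<noteq> v" for u v
    using that xyz(2-4) separated_sym by blast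
  ultimately show "separated a b \<and> separated a c \<and> separated b c"
    unfolding keys[symmetric] by simp
next
  assume "separated a b \<and> separated a c \<and> separated b c"
  then show "planar_triple n (triple a b c)" using assms unfolding planar_triple_def by blast
qed

text \<open>
  A product of three variables has too small a degree to contain two separated pairs, so it is
  itself the triangle.
\<close>

lemma (in circular_order) leading_monomial_planar_triple:
  assumes f: "f \<in> tangential_ideal n" "f \<noteq> 0"
    and lm: "leading_monomial r f = triple a b c"
  shows "planar_triple n (triple a b c)"
proof -
  define deg where "deg = (\<lambda>m :: (nat \<times> nat) monomial. \<Sum>e\<in>edges n. lookup m e)"
  have deg_add: "deg (p + q) = deg p + deg q" for p q
    unfolding deg_def by (simp add: lookup_add sum.distrib)
  have deg_single: "deg (single e 1) = 1" if "e \<in> edges n" for e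
    unfolding deg_def using that finite_edges by (simp add: lookup_single when_def)
  have fV: "f \<in> carrier (poly_ring (edges n))"
    using f poly_ring_ideal_subset[OF ideal_tangential_ideal] by blast
  have mon: "triple a b c \<in> monomials (edges n)"
    using leading_monomial(3)[OF fV f(2)] lm by simp
  then have "{a, b, c} \<subseteq> edges n" by (simp add: monomials_def keys_triple)
  then have deg3: "deg (triple a b c) = 3"
    unfolding triple_def by (simp add: deg_add deg_single[simplified])
  have "\<exists>x y z k. x \<in> edges n \<and> y \<in> edges n \<and> z \<in> edges n \<and>
      separated x y \<and> separated y z \<and> separated x z \<and> triple a b c = k + triple x y z"
  proof (rule ccontr)
    assume no: "\<not> ?thesis"
    then obtain x y z w k where
      "x \<in> edges n" "y \<in> edges n" "z \<in> edges n" "w \<in> edges n"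
      "triple a b c = k + ((single x 1 + single y 1) + (single z 1 + single w 1))"
      using leading_monomial_tangential_ideal[OF f] unfolding lm triple_def[symmetric] by blast
    then have "deg (triple a b c) = deg k + 4"
      by (simp add: deg_add deg_single[simplified])
    then show False using deg3 by simp
  qed
  then obtain x y z k where xyz: "x \<in> edges n" "y \<in> edges n" "z \<in> edges n"
    "separated x y" "separated y z" "separated x z" "triple a b c = k + triple x y z" by blast
  then have "deg k = 0"
    using deg3 deg_add[of k "triple x y z"]
    by (simp add: triple_def deg_add deg_single[simplified])
  moreover have "k \<in> monomials (edges n)"
    using mon xyz(7) monomials_add_cancel[of "triple x y z" k] by (simp add: add.commute)
  ultimately have "lookup k e = 0" for e
    using finite_edges lookup_outside_eq_0[of k "edges n" e] unfolding deg_def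
    by (cases "e \<in> edges n") auto
  then have "k = 0" by (intro poly_mapping_eqI) simp
  then have "triple a b c = triple x y z" using xyz(7) by simp
  then show ?thesis using xyz(1-6) unfolding planar_triple_def by blast
qed

definition nonplanar_forms :: "nat \<Rightarrow> (nat \<times> nat) mpoly set" where
  "nonplanar_forms n = {f. \<forall>m\<in>keys f. (\<exists>a b c. m = triple a b c) \<and> \<not> planar_triple n m}"

lemma nonplanar_forms_add: "f \<in> nonplanar_forms n \<Longrightarrow> g \<in> nonplanar_forms n \<Longrightarrow> f + g \<in> nonplanar_forms n"
  and nonplanar_forms_diff: "f \<in> nonplanar_forms n \<Longrightarrow> g \<in> nonplanar_forms n \<Longrightarrow> f - g \<in> nonplanar_forms n"
  and nonplanar_forms_zero: "0 \<in> nonplanar_forms n"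
  unfolding nonplanar_forms_def using keys_add[of f g] keys_diff[of f g] by auto

lemma nonplanar_forms_var:
  assumes "{a, b, c} \<subseteq> edges n" "\<not> (separated a b \<and> separated a c \<and> separated b c)"
  shows "var a * var b * var c \<in> nonplanar_forms n"
proof -
  have "keys (var a * var b * var c) = {triple a b c}" by (simp add: var_mult3)
  then have "m = triple a b c" if "m \<in> keys (var a * var b * var c)" for m
    using that by simp
  moreover have "\<not> planar_triple n (triple a b c)"
    using planar_triple_iff[OF assms(1)] assms(2) by blast
  ultimately show ?thesis unfolding nonplanar_forms_def by blast
qed

lemma nonplanar_forms_xvar:
  assumes "{a, a', b, b', c, c'} \<subseteq> {1..n}" "a \<noteq> a'" "b \<noteq> b'" "c \<noteq> c'"
    "\<not> (separated (min a a', max a a') (min b b', max b b') \<and>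
       separated (min a a', max a a') (min c c', max c c') \<and>
       separated (min b b', max b b') (min c c', max c c'))"
  shows "xvar a a' * xvar b b' * xvar c c' \<in> nonplanar_forms n"
  unfolding xvar_def
proof (rule nonplanar_forms_var)
  show "{(min a a', max a a'), (min b b', max b b'), (min c c', max c c')} \<subseteq> edges n"
    using assms(1-4) by (simp add: min_max_edge)
qed (rule assms(5))

text \<open>
  The leading monomial is one of the terms and must be planar, so the single planar term leads.
\<close>

lemma (in circular_order) leading_monomial_cubic:
  assumes f: "f \<in> tangential_ideal n"
    and eq: "f = g + var a * var b * var c \<or> f = g - var a * var b * var c"
    and g: "g \<in> nonplanar_forms n" and abc: "{a, b, c} \<subseteq> edges n"
    and sep: "separated a b" "separated a c" "separated b c"
  shows "f \<noteq> 0 \<and> leading_monomial r f = single a 1 + single b 1 + single c 1"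
proof -
  have planar: "planar_triple n (triple a b c)" using planar_triple_iff[OF abc] sep by blast
  then have "triple a b c \<notin> keys g" using g unfolding nonplanar_forms_def by blast
  then have "lookup g (triple a b c) = 0" by (simp add: in_keys_iff)
  then have "lookup f (triple a b c) \<noteq> 0"
    using eq by (auto simp: var_mult3 lookup_add lookup_minus)
  then have f0: "f \<noteq> 0" by auto
  have fV: "f \<in> carrier (poly_ring (edges n))"
    using f poly_ring_ideal_subset[OF ideal_tangential_ideal] by blast
  have "keys f \<subseteq> keys g \<union> {triple a b c}"
    using eq keys_add[of g "single (triple a b c) 1"] keys_diff[of g "single (triple a b c) 1"]
    by (auto simp: var_mult3)
  then have "leading_monomial r f \<in> keys g \<or> leading_monomial r f = triple a b c"
    using leading_monomial_in_keys[OF fV f0] by blast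
  moreover have "leading_monomial r f \<notin> keys g"
  proof
    assume "leading_monomial r f \<in> keys g"
    then have *: "\<exists>a b c. leading_monomial r f = triple a b c"
      "\<not> planar_triple n (leading_monomial r f)"
      using g unfolding nonplanar_forms_def by simp_all
    then obtain x y z where "leading_monomial r f = triple x y z" by (elim exE)
    then show False using leading_monomial_planar_triple[OF f f0] *(2) by simp
  qed
  ultimately show ?thesis using f0 unfolding triple_def by blast
qed

text \<open>
  Two separated edges form one of the two planar matchings of a convex quadrilateral; the third
  matching is the pair of diagonals.
\<close>

lemma (in circular_order) separated_pair_is_leading:
  assumes "e \<in> edges n" "f \<in> edges n" "separated e f"
  shows "\<exists>g\<in>off_diagonal_minors n 2. g \<noteq> 0 \<and> leading_monomial r g = single e 1 + single f 1"
  using assms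
proof (induction "fst e" "fst f" arbitrary: e f rule: linorder_wlog)
  case sym
  then show ?case using separated_sym by (metis add.commute)
next
  case le
  obtain a b c d where e: "e = (a, b)" and f: "f = (c, d)" by fastforce
  note ef = le[unfolded e f edges_iff separated_def, simplified]
  have leading: "g \<noteq> 0 \<and> leading_monomial r g = single e 1 + single f 1"
    if g: "g \<in> off_diagonal_minors n 2"
      and eq: "g = var e * var f - var e' * var f' \<or> g = var e' * var f' - var e * var f"
      and cross: "\<not> separated e' f'" "e' \<in> edges n" "f' \<in> edges n" for g e' f'
  proof -
    let ?m = "single e 1 + single f 1 :: (nat \<times> nat) monomial"
      and ?m' = "single e' 1 + single f' 1 :: (nat \<times> nat) monomial"
    have gI: "g \<in> hypersimplex_ideal n" by (rule off_diagonal_minor2_in_hypersimplex_ideal[OF g])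
    then have gV: "g \<in> carrier (poly_ring (edges n))" using mem_hypersimplex_ideal by blast
    have terms: "var e * var f = single ?m 1" "var e' * var f' = single ?m' 1"
      unfolding var_def by (simp_all add: mult_single)
    have sep: "separated e f" by fact
    have "?m \<noteq> ?m'"
    proof
      assume "?m = ?m'"
      from arg_cong[OF this, of keys] have "{e, f} = {e', f'}"
        unfolding keys_single_add_single .
      then have "e = e' \<and> f = f' \<or> e = f' \<and> f = e'" by (simp add: doubleton_eq_iff)
      then show False using sep cross(1) separated_sym[of e f] by (elim disjE conjE) simp_all
    qed
    then have "lookup g ?m \<noteq> 0"
      using eq by (auto simp: terms lookup_minus lookup_single when_def simp del: One_nat_def)
    then have g0: "g \<noteq> 0" by auto
    have "keys g \<subseteq> {?m, ?m'}"
      using eq keys_diff[of "var e * var f" "var e' * var f'"] keys_diff[of "var e' * var f'" "var e * var f"]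
      by (auto simp: terms simp del: One_nat_def)
    then have "leading_monomial r g = ?m \<or> leading_monomial r g = ?m'"
      using leading_monomial_in_keys[OF gV g0] by blast
    moreover have "leading_monomial r g \<noteq> ?m'"
    proof
      assume lm: "leading_monomial r g = ?m'"
      obtain x y where "x \<in> {e', f'}" "y \<in> {e', f'}" "separated x y"
        using leading_monomial_hypersimplex_ideal[OF gI g0] unfolding lm keys_single_add_single
        by blast
      then show False using cross separated_sym separated_irrefl by blast
    qed
    ultimately show ?thesis using g0 by blast
  qed
  consider "b < c" | "a < c" "d < b" using ef by linarith
  then show ?case
  proof cases
    case 1
    have mem: "minor 2 {a, d} {b, c} \<in> off_diagonal_minors n 2"
      using ef 1 by (intro minor2_mem) auto
    have eq: "minor 2 {a, d} {b, c} = var e * var f - var (a, c) * var (b, d)"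
      using ef 1 by (simp add: minor2_eq xvar_less e f)
    have "\<not> separated (a, c) (b, d)" "(a, c) \<in> edges n" "(b, d) \<in> edges n"
      using ef 1 by (auto simp: separated_def edges_iff)
    then show ?thesis using leading[OF mem disjI1[OF eq]] mem by blast
  next
    case 2
    have mem: "minor 2 {a, c} {d, b} \<in> off_diagonal_minors n 2"
      using ef 2 by (intro minor2_mem) auto
    have eq: "minor 2 {a, c} {d, b} = var (a, d) * var (c, b) - var e * var f"
      using ef 2 by (simp add: minor2_eq xvar_less e f)
    have "\<not> separated (a, d) (c, b)" "(a, d) \<in> edges n" "(c, b) \<in> edges n"
      using ef 2 by (auto simp: separated_def edges_iff)
    then show ?thesis using leading[OF mem disjI2[OF eq]] mem by blast
  qed
qed

lemma localized_square_subset_tangential_ideal: "localized_square n \<subseteq> tangential_ideal n"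
  unfolding localized_square_def
  using square_subset_tangential_ideal tangential_ideal_cancel by blast

lemma master_polynomials_cases:
  assumes "f \<in> master_polynomials n"
  obtains i1 j1 i2 j2 i3 j3 where "f = master_polynomial n i1 j1 i2 j2 i3 j3"
    "{i1, j1, i2, j2, i3, j3} \<subseteq> {1..n}" "distinct [i1, j1, i2, j2, i3, j3]"
  using assms unfolding master_polynomials_def circularly_ordered_def by blast

lemma finite_master_polynomials: "finite (master_polynomials n)"
proof (rule finite_subset)
  show "master_polynomials n \<subseteq> (\<lambda>(a, b, c, d, e, f). master_polynomial n a b c d e f) `
      ({1..n} \<times> {1..n} \<times> {1..n} \<times> {1..n} \<times> {1..n} \<times> {1..n})"
  proof
    fix f assume "f \<in> master_polynomials n"
    then obtain i1 j1 i2 j2 i3 j3 where "f = master_polynomial n i1 j1 i2 j2 i3 j3"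
      "{i1, j1, i2, j2, i3, j3} \<subseteq> {1..n}"
      by (rule master_polynomials_cases)
    then show "f \<in> (\<lambda>(a, b, c, d, e, f). master_polynomial n a b c d e f) `
        ({1..n} \<times> {1..n} \<times> {1..n} \<times> {1..n} \<times> {1..n} \<times> {1..n})"
      by (intro image_eqI[of _ _ "(i1, j1, i2, j2, i3, j3)"]) auto
  qed
qed simp

text \<open>
  The planar perfect matchings of a hexagon with vertices 1 to 6 are, in the order of the cases below,
  \<open>12|34|56\<close>, \<open>16|23|45\<close>, \<open>12|36|45\<close>, \<open>14|23|56\<close> and \<open>16|25|34\<close>. In the first two all edges are sides, and
  they are the leading terms of the two master polynomials. In the other three one chord separates
  the other two; choosing the vertices on either side of a transversal line as rows and columns
  gives a minor in which every other term has a crossing.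
\<close>

lemma (in circular_order) ordered_triangle_is_leading:
  assumes E: "e \<in> edges n" "f \<in> edges n" "g \<in> edges n"
    and sep: "separated e f" "separated e g" "separated f g"
    and less: "fst e < fst f" "fst f < fst g"
  shows "\<exists>h\<in>off_diagonal_minors n 3 \<union> master_polynomials n.
    h \<noteq> 0 \<and> leading_monomial r h = single e 1 + single f 1 + single g 1"
proof -
  obtain a a' b b' c c' where e: "e = (a, a')" and f: "f = (b, b')" and g: "g = (c, c')"
    by fastforce
  note efg = E[unfolded e f g edges_iff, simplified] sep[unfolded e f g separated_def, simplified]
    less[unfolded e f g, simplified]
  have minor: "h \<in> tangential_ideal n" if "h \<in> off_diagonal_minors n 3" for h
    using that off_diagonal_minor3_in_localized_square localized_square_subset_tangential_ideal
    by blast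
  have master: "h \<in> tangential_ideal n" if "h \<in> master_polynomials n" for h
    using that master_polynomial_in_localized_square localized_square_subset_tangential_ideal
    by (metis master_polynomials_cases subsetD)
  note nonplanar = nonplanar_forms_add nonplanar_forms_diff nonplanar_forms_zero nonplanar_forms_xvar
  have vars: "xvar a a' = var e" "xvar b b' = var f" "xvar c c' = var g"
    "xvar a' a = var e" "xvar b' b = var f" "xvar c' c = var g"
    using efg by (simp_all add: xvar_less e f g)
  consider (consecutive) "a' < b" "b' < c" | (nested_right) "a' < b" "c' < b'"
    | (nested_left) "b' < a'" "a' < c" | (outer) "c' < a'" "b' < c" | (nested) "b' < a'" "c' < b'"
    using efg by arith
  then show ?thesis
  proof cases
    case consecutive
    let ?h = "master_polynomial n a a' b b' c c'"
    have ord: "a < a'" "a' < b" "b < b'" "b' < c" "c < c'" "1 \<le> a" "c' \<le> n"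
      using efg consecutive by auto
    have "circularly_ordered n a a' b b' c c'"
      unfolding circularly_ordered_def using ord
    proof (intro conjI)
      show "\<exists>a1 b1 a2 b2 a3 b3. a1 < b1 \<and> b1 < a2 \<and> a2 < b2 \<and> b2 < a3 \<and> a3 < b3 \<and>
          b3 < a1 + int n \<and> [int a = a1] (mod int n) \<and> [int a' = b1] (mod int n) \<and>
          [int b = a2] (mod int n) \<and> [int b' = b2] (mod int n) \<and>
          [int c = a3] (mod int n) \<and> [int c' = b3] (mod int n)"
        by (rule exI[of _ "int a"], rule exI[of _ "int a'"], rule exI[of _ "int b"],
            rule exI[of _ "int b'"], rule exI[of _ "int c"], rule exI[of _ "int c'"])
          (use ord in auto)
    qed auto
    then have mem: "?h \<in> master_polynomials n" unfolding master_polynomials_def by blast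
    let ?g = "0 - xvar c' a' * xvar b b' * xvar c a - xvar a b * xvar a' b' * xvar c c' -
      xvar a a' * xvar b c * xvar b' c' + xvar c' b * xvar a' b' * xvar c a +
      xvar c' a' * xvar b c * xvar b' a + xvar a b * xvar a' c * xvar b' c' -
      xvar c' b * xvar a' c * xvar b' a"
    have "?h \<noteq> 0 \<and> leading_monomial r ?h = single e 1 + single f 1 + single g 1"
    proof (rule leading_monomial_cubic[OF master[OF mem]])
      have "?h = ?g + xvar a a' * xvar b b' * xvar c c'"
        by (subst master_polynomial_eq) (use ord in auto)
      then show "?h = ?g + var e * var f * var g \<or> ?h = ?g - var e * var f * var g"
        unfolding vars by blast
      show "?g \<in> nonplanar_forms n"
        by (intro nonplanar) (use ord in \<open>auto simp: separated_def min_def max_def\<close>)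
    qed (use E sep in auto)
    then show ?thesis using mem by blast
  next
    case outer
    let ?h = "master_polynomial n b b' c c' a' a"
    have ord: "a < b" "b < b'" "b' < c" "c < c'" "c' < a'" "1 \<le> a" "a' \<le> n"
      using efg outer by auto
    \<comment> \<open>The vertex \<open>a\<close> comes last, after one full turn.\<close>
    have "circularly_ordered n b b' c c' a' a"
      unfolding circularly_ordered_def using ord
    proof (intro conjI)
      show "\<exists>a1 b1 a2 b2 a3 b3. a1 < b1 \<and> b1 < a2 \<and> a2 < b2 \<and> b2 < a3 \<and> a3 < b3 \<and>
          b3 < a1 + int n \<and> [int b = a1] (mod int n) \<and> [int b' = b1] (mod int n) \<and>
          [int c = a2] (mod int n) \<and> [int c' = b2] (mod int n) \<and>
          [int a' = a3] (mod int n) \<and> [int a = b3] (mod int n)"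
        by (rule exI[of _ "int b"], rule exI[of _ "int b'"], rule exI[of _ "int c"],
            rule exI[of _ "int c'"], rule exI[of _ "int a'"], rule exI[of _ "int a + int n"])
          (use ord in \<open>auto simp: cong_def\<close>)
    qed auto
    then have mem: "?h \<in> master_polynomials n" unfolding master_polynomials_def by blast
    let ?g = "0 - xvar a b' * xvar c c' * xvar a' b - xvar b c * xvar b' c' * xvar a' a -
      xvar b b' * xvar c a' * xvar c' a + xvar a c * xvar b' c' * xvar a' b +
      xvar a b' * xvar c a' * xvar c' b + xvar b c * xvar b' a' * xvar c' a -
      xvar a c * xvar b' a' * xvar c' b"
    have "?h \<noteq> 0 \<and> leading_monomial r ?h = single f 1 + single g 1 + single e 1"
    proof (rule leading_monomial_cubic[OF master[OF mem]])
      have "?h = ?g + xvar b b' * xvar c c' * xvar a' a"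
        by (subst master_polynomial_eq) (use ord in auto)
      then show "?h = ?g + var f * var g * var e \<or> ?h = ?g - var f * var g * var e"
        unfolding vars by blast
      show "?g \<in> nonplanar_forms n"
        by (intro nonplanar) (use ord in \<open>auto simp: separated_def min_def max_def\<close>)
    qed (use E sep separated_sym in auto)
    then show ?thesis using mem by (auto simp: add_ac)
  next
    case nested_right
    let ?h = "minor 3 {a', b, c} {a, c', b'}"
    have ord: "a < a'" "a' < b" "b < c" "c < c'" "c' < b'" "1 \<le> a" "b' \<le> n"
      using efg nested_right by auto
    have mem: "?h \<in> off_diagonal_minors n 3" by (rule minor3_mem) (use ord in auto)
    let ?g = "xvar a' a * xvar b c' * xvar c b' + xvar a' c' * xvar b b' * xvar c a +
      xvar a' b' * xvar b a * xvar c c' -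
      xvar a' c' * xvar b a * xvar c b' - xvar a' b' * xvar b c' * xvar c a"
    have "?h \<noteq> 0 \<and> leading_monomial r ?h = single e 1 + single f 1 + single g 1"
    proof (rule leading_monomial_cubic[OF minor[OF mem]])
      have "?h = ?g - xvar a' a * xvar b b' * xvar c c'"
        by (subst minor3_eq) (use ord in auto)
      then show "?h = ?g + var e * var f * var g \<or> ?h = ?g - var e * var f * var g"
        unfolding vars by blast
      show "?g \<in> nonplanar_forms n"
        by (intro nonplanar) (use ord in \<open>auto simp: separated_def min_def max_def\<close>)
    qed (use E sep in auto)
    then show ?thesis using mem by blast
  next
    case nested_left
    let ?h = "minor 3 {a, b, c'} {b', a', c}"
    have ord: "a < b" "b < b'" "b' < a'" "a' < c" "c < c'" "1 \<le> a" "c' \<le> n"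
      using efg nested_left by auto
    have mem: "?h \<in> off_diagonal_minors n 3" by (rule minor3_mem) (use ord in auto)
    let ?g = "xvar a b' * xvar b a' * xvar c' c + xvar a a' * xvar b c * xvar c' b' +
      xvar a c * xvar b b' * xvar c' a' -
      xvar a b' * xvar b c * xvar c' a' - xvar a c * xvar b a' * xvar c' b'"
    have "?h \<noteq> 0 \<and> leading_monomial r ?h = single e 1 + single f 1 + single g 1"
    proof (rule leading_monomial_cubic[OF minor[OF mem]])
      have "?h = ?g - xvar a a' * xvar b b' * xvar c' c"
        by (subst minor3_eq) (use ord in auto)
      then show "?h = ?g + var e * var f * var g \<or> ?h = ?g - var e * var f * var g"
        unfolding vars by blast
      show "?g \<in> nonplanar_forms n"
        by (intro nonplanar) (use ord in \<open>auto simp: separated_def min_def max_def\<close>)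
    qed (use E sep in auto)
    then show ?thesis using mem by blast
  next
    case nested
    let ?h = "minor 3 {a, b, c} {c', b', a'}"
    have ord: "a < b" "b < c" "c < c'" "c' < b'" "b' < a'" "1 \<le> a" "a' \<le> n"
      using efg nested by auto
    have mem: "?h \<in> off_diagonal_minors n 3" by (rule minor3_mem) (use ord in auto)
    let ?g = "xvar a c' * xvar b b' * xvar c a' + xvar a b' * xvar b a' * xvar c c' +
      xvar a a' * xvar b c' * xvar c b' -
      xvar a c' * xvar b a' * xvar c b' - xvar a b' * xvar b c' * xvar c a'"
    have "?h \<noteq> 0 \<and> leading_monomial r ?h = single e 1 + single f 1 + single g 1"
    proof (rule leading_monomial_cubic[OF minor[OF mem]])
      have "?h = ?g - xvar a a' * xvar b b' * xvar c c'"
        by (subst minor3_eq) (use ord in auto)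
      then show "?h = ?g + var e * var f * var g \<or> ?h = ?g - var e * var f * var g"
        unfolding vars by blast
      show "?g \<in> nonplanar_forms n"
        by (intro nonplanar) (use ord in \<open>auto simp: separated_def min_def max_def\<close>)
    qed (use E sep in auto)
    then show ?thesis using mem by blast
  qed
qed

lemma (in circular_order) triangle_is_leading:
  assumes E: "e \<in> edges n" "f \<in> edges n" "g \<in> edges n"
    and sep: "separated e f" "separated e g" "separated f g"
  shows "\<exists>h\<in>off_diagonal_minors n 3 \<union> master_polynomials n.
    h \<noteq> 0 \<and> leading_monomial r h = single e 1 + single f 1 + single g 1"
proof -
  have ne: "fst e \<noteq> fst f" "fst e \<noteq> fst g" "fst f \<noteq> fst g"
    using E sep by (auto simp: separated_def edges_iff)
  note sep' = sep sep[THEN separated_sym[THEN iffD1]]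
  consider "fst e < fst f" "fst f < fst g" | "fst e < fst g" "fst g < fst f"
    | "fst f < fst e" "fst e < fst g" | "fst f < fst g" "fst g < fst e"
    | "fst g < fst e" "fst e < fst f" | "fst g < fst f" "fst f < fst e"
    using ne by linarith
  then show ?thesis
  proof cases
    case 1
    from ordered_triangle_is_leading[OF E(1,2,3) _ _ _ this] sep' show ?thesis by (simp add: add_ac)
  next
    case 2
    from ordered_triangle_is_leading[OF E(1,3,2) _ _ _ this] sep' show ?thesis by (simp add: add_ac)
  next
    case 3
    from ordered_triangle_is_leading[OF E(2,1,3) _ _ _ this] sep' show ?thesis by (simp add: add_ac)
  next
    case 4
    from ordered_triangle_is_leading[OF E(2,3,1) _ _ _ this] sep' show ?thesis by (simp add: add_ac)
  next
    case 5
    from ordered_triangle_is_leading[OF E(3,1,2) _ _ _ this] sep' show ?thesis by (simp add: add_ac)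
  next
    case 6
    from ordered_triangle_is_leading[OF E(3,2,1) _ _ _ this] sep' show ?thesis by (simp add: add_ac)
  qed
qed

section \<open>The symbolic square\<close>

lemma ideal_localized_square: "ideal (localized_square n) (poly_ring (edges n))"
proof (rule poly_ring_idealI)
  let ?R = "poly_ring (edges n)" and ?I = "hypersimplex_ideal n"
  let ?I2 = "ideal_prod ?R ?I ?I"
  note J = ideal_square[of n]
  have one: "1 \<in> carrier ?R - ?I" by (simp add: mem_hypersimplex_ideal)
  show "localized_square n \<subseteq> carrier ?R" unfolding localized_square_def by blast
  show "0 \<in> localized_square n"
    using one poly_ring_ideal_zero[OF J] unfolding localized_square_def by auto
  show "f + g \<in> localized_square n" if fg: "f \<in> localized_square n" "g \<in> localized_square n" for f g
  proof -
    obtain s t where s: "s \<in> carrier ?R - ?I" "s * f \<in> ?I2" and t: "t \<in> carrier ?R - ?I" "t * g \<in> ?I2"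
      using fg unfolding localized_square_def by blast
    have "s * t \<in> carrier ?R - ?I"
      using s t hypersimplex_ideal_prime poly_ring_mult by blast
    moreover have "t * (s * f) + s * (t * g) \<in> ?I2"
      using poly_ring_ideal_add[OF J poly_ring_ideal_mult_left[OF J s(2)] poly_ring_ideal_mult_left[OF J t(2)]]
        s(1) t(1) by blast
    then have "s * t * (f + g) \<in> ?I2" by (simp add: algebra_simps)
    moreover have "f + g \<in> carrier ?R"
      using fg poly_ring_add unfolding localized_square_def by blast
    ultimately show ?thesis unfolding localized_square_def by blast
  qed
  show "h * f \<in> localized_square n" if f: "f \<in> localized_square n" and h: "h \<in> carrier ?R" for f h
  proof -
    obtain s where s: "s \<in> carrier ?R - ?I" "s * f \<in> ?I2"
      using f unfolding localized_square_def by blast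
    have "s * (h * f) \<in> ?I2"
      using poly_ring_ideal_mult_left[OF J s(2) h] by (simp add: mult.left_commute)
    moreover have "h * f \<in> carrier ?R"
      using f h poly_ring_mult unfolding localized_square_def by blast
    ultimately show ?thesis using s unfolding localized_square_def by blast
  qed
qed

definition standard_generators :: "nat \<Rightarrow> (nat \<times> nat) mpoly set" where
  "standard_generators n = off_diagonal_minors n 3 \<union> master_polynomials n \<union>
    {f * g | f g. f \<in> off_diagonal_minors n 2 \<and> g \<in> off_diagonal_minors n 2}"

lemma square_subset_localized_square:
  "ideal_prod (poly_ring (edges n)) (hypersimplex_ideal n) (hypersimplex_ideal n) \<subseteq> localized_square n"
proof
  fix f assume f: "f \<in> ideal_prod (poly_ring (edges n)) (hypersimplex_ideal n) (hypersimplex_ideal n)"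
  have "1 \<in> carrier (poly_ring (edges n)) - hypersimplex_ideal n"
    by (simp add: mem_hypersimplex_ideal)
  moreover have "f \<in> carrier (poly_ring (edges n))"
    using f poly_ring_ideal_subset[OF ideal_square] by blast
  ultimately show "f \<in> localized_square n"
    using f unfolding localized_square_def by (intro CollectI conjI bexI[of _ 1]) auto
qed

lemma standard_generators_subset_localized_square: "standard_generators n \<subseteq> localized_square n"
proof
  fix f assume "f \<in> standard_generators n"
  then consider "f \<in> off_diagonal_minors n 3" | "f \<in> master_polynomials n"
    | g h where "f = g * h" "g \<in> off_diagonal_minors n 2" "h \<in> off_diagonal_minors n 2"
    unfolding standard_generators_def by blast
  then show "f \<in> localized_square n"
  proof cases
    case 1
    then show ?thesis by (rule off_diagonal_minor3_in_localized_square)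
  next
    case 2
    then show ?thesis
      using master_polynomial_in_localized_square by (metis master_polynomials_cases)
  next
    case 3
    then have "f \<in> ideal_prod (poly_ring (edges n)) (hypersimplex_ideal n) (hypersimplex_ideal n)"
      using mult_in_square off_diagonal_minor2_in_hypersimplex_ideal by simp
    then show ?thesis using square_subset_localized_square by blast
  qed
qed

lemma finite_standard_generators: "finite (standard_generators n)"
proof -
  have "{f * g | f g. f \<in> off_diagonal_minors n 2 \<and> g \<in> off_diagonal_minors n 2} =
      (\<lambda>(f, g). f * g) ` (off_diagonal_minors n 2 \<times> off_diagonal_minors n 2)"
    by auto
  then show ?thesis
    unfolding standard_generators_def
    by (simp add: finite_off_diagonal_minors finite_master_polynomials)
qed

lemma (in circular_order) standard_generators_leading:
  assumes f: "f \<in> tangential_ideal n" "f \<noteq> 0"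
  shows "\<exists>g\<in>standard_generators n. g \<noteq> 0 \<and>
    (\<exists>c\<in>monomials (edges n). leading_monomial r f = c + leading_monomial r g)"
proof -
  let ?m = "leading_monomial r f"
  have fV: "f \<in> carrier (poly_ring (edges n))"
    using f poly_ring_ideal_subset[OF ideal_tangential_ideal] by blast
  have "\<exists>g\<in>standard_generators n. g \<noteq> 0 \<and> (\<exists>c. ?m = c + leading_monomial r g)"
    using leading_monomial_tangential_ideal[OF f]
  proof (elim disjE exE conjE)
    fix a b c d k
    assume E: "a \<in> edges n" "b \<in> edges n" "separated a b" "c \<in> edges n" "d \<in> edges n" "separated c d"
      and m: "?m = k + ((single a 1 + single b 1) + (single c 1 + single d 1))"
    obtain g where g: "g \<in> off_diagonal_minors n 2" "g \<noteq> 0" "leading_monomial r g = single a 1 + single b 1"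
      using separated_pair_is_leading E(1-3) by blast
    obtain h where h: "h \<in> off_diagonal_minors n 2" "h \<noteq> 0" "leading_monomial r h = single c 1 + single d 1"
      using separated_pair_is_leading E(4-6) by blast
    have gh: "g \<in> carrier (poly_ring (edges n))" "h \<in> carrier (poly_ring (edges n))"
      using g h off_diagonal_minor2_in_hypersimplex_ideal mem_hypersimplex_ideal by blast+
    have "g * h \<noteq> 0" "?m = k + leading_monomial r (g * h)"
      using leading_monomial_mult[OF gh(1) g(2) gh(2) h(2)] g h m by simp_all
    moreover have "g * h \<in> standard_generators n"
      using g h unfolding standard_generators_def by blast
    ultimately show ?thesis by blast
  next
    fix a b c k
    assume E: "a \<in> edges n" "b \<in> edges n" "c \<in> edges n" "separated a b" "separated b c" "separated a c"
      and m: "?m = k + (single a 1 + single b 1 + single c 1)"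
    obtain g where "g \<in> off_diagonal_minors n 3 \<union> master_polynomials n" "g \<noteq> 0"
      "leading_monomial r g = single a 1 + single b 1 + single c 1"
      using triangle_is_leading[OF E(1-4) E(6) E(5)] by blast
    then show ?thesis using m unfolding standard_generators_def by auto
  qed
  then obtain g c where g: "g \<in> standard_generators n" "g \<noteq> 0" "?m = c + leading_monomial r g"
    by blast
  have "c + leading_monomial r g \<in> monomials (edges n)"
    using leading_monomial(3)[OF fV f(2)] g(3) by simp
  then have "c \<in> monomials (edges n)"
    using monomials_add_cancel[of "leading_monomial r g" c] by (simp add: add.commute)
  then show ?thesis using g by blast
qed

lemma xvar_cubic_form:
  assumes "{a, a', b, b', c, c'} \<subseteq> {1..n}" "a \<noteq> a'" "b \<noteq> b'" "c \<noteq> c'"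
  shows "xvar a a' * xvar b b' * xvar c c' \<in> cubic_forms (edges n)"
  unfolding xvar_def using assms by (intro cubic_forms.triple min_max_edge) auto

text \<open>
  They are cubic forms in the tangential ideal.
\<close>

lemma cubic_generators_in_secant_ideal:
  assumes "f \<in> off_diagonal_minors n 3 \<union> master_polynomials n"
  shows "f \<in> secant_ideal (edges n) (hypersimplex_ideal n)"
proof (rule cubic_form_in_secant_ideal[OF finite_edges ideal_hypersimplex_ideal])
  have "f \<in> tangential_ideal n"
    using assms standard_generators_subset_localized_square localized_square_subset_tangential_ideal
    unfolding standard_generators_def by blast
  then show "f \<in> hypersimplex_ideal n" "\<And>e. e \<in> edges n \<Longrightarrow> pd e f \<in> hypersimplex_ideal n"
    unfolding tangential_ideal_def by auto
  from assms show "f \<in> cubic_forms (edges n)"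
  proof
    assume "f \<in> off_diagonal_minors n 3"
    then obtain a0 a1 a2 b0 b1 b2 where *: "a0 < a1" "a1 < a2" "b0 < b1" "b1 < b2"
      "{a0, a1, a2, b0, b1, b2} \<subseteq> {1..n}"
      "{a0, a1, a2} \<inter> {b0, b1, b2} = {}" "f = minor 3 {a0, a1, a2} {b0, b1, b2}"
      by (rule off_diagonal_minor3_cases)
    have summand: "xvar a b * xvar a' b' * xvar a'' b'' \<in> cubic_forms (edges n)"
      if "a \<in> {a0, a1, a2}" "a' \<in> {a0, a1, a2}" "a'' \<in> {a0, a1, a2}"
        "b \<in> {b0, b1, b2}" "b' \<in> {b0, b1, b2}" "b'' \<in> {b0, b1, b2}" for a a' a'' b b' b''
    proof (rule xvar_cubic_form)
      show "{a, b, a', b', a'', b''} \<subseteq> {1..n}" using that *(5) by blast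
      show "a \<noteq> b" "a' \<noteq> b'" "a'' \<noteq> b''" using that *(6) by blast+
    qed
    show ?thesis
      unfolding *(7) minor3_eq[OF *(1-4)]
      by (intro cubic_forms.add cubic_forms.diff summand) simp_all
  next
    assume "f \<in> master_polynomials n"
    then obtain i1 j1 i2 j2 i3 j3 where *: "f = master_polynomial n i1 j1 i2 j2 i3 j3"
      "{i1, j1, i2, j2, i3, j3} \<subseteq> {1..n}" "distinct [i1, j1, i2, j2, i3, j3]"
      by (rule master_polynomials_cases)
    show ?thesis
      unfolding *(1) master_polynomial_eq[OF *(2,3)]
      by (intro cubic_forms.add cubic_forms.diff xvar_cubic_form) (use *(2,3) in auto)
  qed
qed

theorem corollary3p7:
  fixes n :: nat and ord :: "(nat \<times> nat) monomial rel"
  assumes "n \<ge> 2" and "circular_term_order n ord"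
  shows "groebner_basis (edges n) ord
           (symbolic_square (poly_ring (edges n)) (hypersimplex_ideal n))
           (off_diagonal_minors n 3 \<union> master_polynomials n \<union>
            {f * g | f g. f \<in> off_diagonal_minors n 2 \<and> g \<in> off_diagonal_minors n 2})
       \<and> symbolic_square (poly_ring (edges n)) (hypersimplex_ideal n) =
           ideal_prod (poly_ring (edges n)) (hypersimplex_ideal n) (hypersimplex_ideal n)
             <+>\<^bsub>poly_ring (edges n)\<^esub>
           secant_ideal (edges n) (hypersimplex_ideal n)"
proof -
  let ?R = "poly_ring (edges n)" and ?I = "hypersimplex_ideal n"
  let ?I2 = "ideal_prod ?R ?I ?I" and ?S = "secant_ideal (edges n) ?I"
  let ?G = "standard_generators n" and ?D = "tangential_ideal n"
  obtain s where s: "circular_order n s ord"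
    using assms(2) unfolding circular_term_order_def circular_order_def by blast
  interpret circular_order n s ord by (rule s)
  have symbolic: "symbolic_square ?R ?I = localized_square n"
    using poly_ring.symbolic_square_eq[OF wf_ideal_ascending primeideal_hypersimplex_ideal]
    unfolding localized_square_def by simp
  have GD: "?G \<subseteq> ?D"
    using standard_generators_subset_localized_square localized_square_subset_tangential_ideal by blast
  note groebner = groebner_basisI[OF ideal_tangential_ideal finite_standard_generators GD
      standard_generators_leading]
  have D_eq: "localized_square n = ?D"
  proof
    show "?D \<subseteq> localized_square n"
      using poly_ring.genideal_minimal[OF ideal_localized_square standard_generators_subset_localized_square, of n]
        groebner(2) by simp
  qed (rule localized_square_subset_tangential_ideal)
  note S = ideal_secant_ideal[OF poly_ring_ideal_subset[OF ideal_hypersimplex_ideal]]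
  have sum_iff: "f \<in> ?I2 <+>\<^bsub>?R\<^esub> ?S \<longleftrightarrow> (\<exists>g\<in>?I2. \<exists>h\<in>?S. f = g + h)" for f
    unfolding set_add_def' by auto
  have "?D \<subseteq> ?I2 <+>\<^bsub>?R\<^esub> ?S"
  proof -
    have "?G \<subseteq> ?I2 <+>\<^bsub>?R\<^esub> ?S"
    proof
      fix f assume "f \<in> ?G"
      then have "f \<in> ?S \<or> f \<in> ?I2"
        using cubic_generators_in_secant_ideal mult_in_square off_diagonal_minor2_in_hypersimplex_ideal
        unfolding standard_generators_def by blast
      then show "f \<in> ?I2 <+>\<^bsub>?R\<^esub> ?S"
        unfolding sum_iff
        using poly_ring_ideal_zero[OF S] poly_ring_ideal_zero[OF ideal_square] by force
    qed
    then have sub: "genideal ?R ?G \<subseteq> ?I2 <+>\<^bsub>?R\<^esub> ?S"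
      by (rule poly_ring.genideal_minimal[OF poly_ring.add_ideals[OF ideal_square S]])
    have "?D = genideal ?R ?G" by (rule groebner(2)[symmetric])
    then show ?thesis using sub by (simp only:)
  qed
  moreover have "?I2 <+>\<^bsub>?R\<^esub> ?S \<subseteq> ?D"
    using square_subset_tangential_ideal secant_ideal_subset_tangential_ideal[OF assms(1)]
      poly_ring_ideal_add[OF ideal_tangential_ideal] unfolding sum_iff subset_iff by blast
  ultimately show ?thesis
    using groebner(1) unfolding symbolic D_eq standard_generators_def by blast
qed

end
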